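(* Let $\phi\colon E\to G$ be a morphism of finite free multigraded $Q$-modules that is a minimal free multigraded presentation of a Noetherian multigraded $Q$-module $M$. If $\phi$ is generic (that is, combinatorially generic and of uniform rank), then the Scarf complex $S_\bullet(\phi)$ is a minimal free multigraded resolution of $M$ over $Q$.
   Context: **Setting.** $\Bbbk$ is a field and $Q=\Bbbk[x_1,\dots,x_n]$ with its standard $\mathbb N^n$-grading ("multigrading"), where $x^{a}=x_1^{a_1}\cdots x_n^{a_n}$ has multidegree $|x^{a}|=a=(a_1,\dots,a_n)$. On multidegrees, $\preceq$ is the componentwise partial order and $\mathrm{lcm}(a,b)=a\vee b$ is the componentwise maximum. The support of a vector is the set of indices of its nonzero coordinates. $E$ and $G$ are finite free $\mathbb N^n$-graded $Q$-modules of ranks $e,g$ with fixed homogeneous bases $\epsilon_1,\dots,\epsilon_e$ of $E$ and $\gamma_1,\dots,\gamma_g$ of $G$, and $\phi\colon E\to G$ is a $Q$-linear map preserving multidegrees. Its matrix in these bases has entries $f_{ij}=c_{ij}x^{a_{ij}}$ with $c_{ij}\in\Bbbk$; the matrix $C=(c_{ij})$ is the coefficient matrix. Let $U$ and $W$ be the $\Bbbk$-vector spaces with bases $\epsilon_1,\dots,\epsilon_e$ and $\gamma_1,\dots,\gamma_g$, let $s\colon U\to W$ be the linear map with matrix $C$, let $r=\mathrm{rank}\,\phi=\mathrm{rank}\,C$, and let $V=\mathrm{im}(s)$, so $\dim V=r$. $V^*=\mathrm{Hom}_\Bbbk(V,\Bbbk)$, and $D_p$ denotes the $p$-th divided power,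 so $D_pV^*=(\mathrm{Sym}_pV)^*$. Unadorned tensor products are over $\Bbbk$. **Simplex and multidegrees of faces.** $\Delta$ is the full simplex on the vertices $\{1,\dots,e\}$; for a (nonempty) face $I=\{i_1<\dots<i_p\}$ put $\epsilon_I=\epsilon_{i_1}\wedge\dots\wedge\epsilon_{i_p}\in\wedge^pU$, of multidegree $|\epsilon_I|=\mathrm{lcm}(|\epsilon_{i_1}|,\dots,|\epsilon_{i_p}|)$. Elements of $D_pV^*$ and $\wedge^rV^*$ have multidegree $0$. **Maps $s_i$.** Let $\upsilon_1,\dots,\upsilon_r$ be a basis of $V^*$, $\upsilon_{[r]}=\upsilon_1\wedge\dots\wedge\upsilon_r$, and for $b=(b_1,\dots,b_r)$ let $\upsilon^{(b)}=\upsilon_1^{(b_1)}\cdots\upsilon_r^{(b_r)}$ (these, with $b_j\ge 0$ and $\sum b_j=p$, are a basis of $D_pV^*$), with $\upsilon^{(b)}=0$ if some $b_j<0$; let $b_j$-lowered index $b-e_j$ denote $b$ with its $j$-th entry decreased by $1$. For $i\ge 2$ let $B_i=D_{i-2}V^*\otimes\wedge^{r+i-1}U\otimes\wedge^rV^*$, and $B_1=U$, $B_0=W$. For $i\ge3$ and $|I|=r+i-1$, $$s_i(\upsilon^{(b)}\otimes\epsilon_I\otimes\upsilon_{[r]})=\sum_{j=1}^r\sum_{l\in I}\mathrm{sgn}(l,I\setminus l)\,\upsilon_j(s(\epsilon_l))\,\upsilon^{(b-e_j)}\otimes\epsilon_{I\setminus l}\otimes\upsilon_{[r]},$$ and for $|J|=r+1$,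 $$s_2(\epsilon_J\otimes\upsilon_{[r]})=\sum_{l\in J}\mathrm{sgn}(l,J\setminus l)\,\det\big(\upsilon_j(s(\epsilon_k))\big)_{1\le j\le r,\;k\in J\setminus l}\;\epsilon_l,$$ where $\mathrm{sgn}(l,I\setminus l)=(-1)^{\#\{k\in I:\,k<l\}}$. These maps do not depend on the basis $\upsilon$, and $(B_\bullet,s_\bullet)$, with $s_1=s$, is a complex (the Buchsbaum–Rim complex of $s$). **BRT systems and complexes.** A Buchsbaum–Rim–Taylor (BRT) system is a family $\mathbb F=\{F_I\}_{I\in\Delta}$ of vector spaces with: (1) $F_I=0$ if $|I|\le r$; (2) $F_I\subseteq D_{|I|-r-1}V^*$ if $|I|\ge r+1$; (3) if $|I|=p\ge r+2$ then $s_{p-r+1}(F_I\otimes\epsilon_I\otimes\wedge^rV^* )\subseteq\bigoplus_{J\subset I,\,|J|=p-1}F_J\otimes\epsilon_J\otimes\wedge^rV^*$. Its BRT complex $R_\bullet(\mathbb F,\phi)$ is the complex of free multigraded $Q$-modules with $R_0=G$, $R_1=E$, $R_i=\bigoplus_{|I|=r+i-1}Q\otimes F_I\otimes\epsilon_I\otimes\wedge^rV^*$ for $i\ge2$, with $\phi_1=\phi$ and, for $i\ge2$, $\phi_i\colon R_i\to R_{i-1}$ the homogenization of $s_i$: if $s_i^{I,J}$ is the component of $s_i$ from $F_I\otimes\epsilon_I\otimes\wedge^rV^*$ to $F_J\otimes\epsilon_J\otimes\wedge^rV^*$ (for $i=2$: to $\Bbbk\epsilon_l$, $J=\{l\}$),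 then $\phi_i^{I,J}(y\otimes z)=x^{|\epsilon_I|-|\epsilon_J|}y\otimes s_i^{I,J}(z)$. **Scarf complex.** The Scarf simplicial complex is $\Delta_S=\{I\in\Delta: |\epsilon_I|\ne|\epsilon_J|\text{ for all }J\ne I\}$. The LCM-lattice is $L_\phi=\{|\epsilon_I|: I\in\Delta\}$; $L_S\subseteq L_\phi$ is the set of multidegrees of faces of $\Delta_S$ and $L_S^0=L_\phi\setminus L_S$. For a multidegree $\alpha$ let $I_\alpha=\{i:|\epsilon_i|\preceq\alpha\}$, let $I(\alpha)$ be the intersection of all faces of $\Delta$ of multidegree $\alpha$, and $I^\alpha=I_\alpha\setminus I(\alpha)$. For $I\subseteq\{1,\dots,e\}$ let $V_I=s(\mathrm{span}\{\epsilon_i:i\in I\})\subseteq V$ and $K_I=\ker(V^*\to V_I^* )$. The Scarf system $\mathbb F_S=\{F_I\}$ is: $F_I=0$ if $|I|\le r$; $F_I=D_{|I|-r-1}V^*$ if $|I|\ge r+1$ and $I\in\Delta_S$; $F_I=D_{|I|-r-1}K_{I^\alpha}$ if $|I|\ge r+1$ and $I=I_\alpha$ for some $\alpha\in L_S^0$; $F_I=0$ otherwise. It is a BRT system, and the Scarf complex is $S_\bullet(\phi)=R_\bullet(\mathbb F_S,\phi)$. **Genericity.** $\phi$ is combinatorially generic if for all $1\le i<j\le e$ the support of $|\epsilon_i|-|\epsilon_j|\in\mathbb Z^n$ contains the supports of $|\epsilon_i|$ and of $|\epsilon_j|$. $\phi$ (of rank $r$) is of uniform rank if every $g\times r$ submatrix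 of $C$ has rank $r$. $\phi$ is generic if it is combinatorially generic and of uniform rank. **Minimality.** With $\mathfrak m=(x_1,\dots,x_n)$: $\phi$ is a minimal presentation of $M$ if $M\cong\mathrm{coker}\,\phi$, $\phi(E)\subseteq\mathfrak mG$ and $\ker\phi\subseteq\mathfrak mE$. A minimal free multigraded resolution of $M$ is a complex of finite free multigraded modules, with multidegree-preserving differentials, whose homology is $M$ in degree $0$ and $0$ elsewhere, and whose differentials have image in $\mathfrak m$ times the target. *)

theory Defs
  imports
    "HOL-Library.Poly_Mapping"
    "Jordan_Normal_Form.DL_Rank"
    "Jordan_Normal_Form.DL_Submatrix"
begin

section \<open>Multigraded modules over a polynomial ring\<close>

text \<open>
  The polynomial ring over a field \<open>'k\<close> in finitely many variables indexed by \<open>'n\<close>. A multidegree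
  is an exponent vector \<open>'n \<Rightarrow>\<^sub>0 nat\<close>. The order instance of \<open>\<Rightarrow>\<^sub>0\<close> in the library is
  lexicographic, so the componentwise order is introduced separately.
\<close>

text \<open>The library hides the short names of these two constants.\<close>

abbreviation lookup :: "('a \<Rightarrow>\<^sub>0 'b::zero) \<Rightarrow> 'a \<Rightarrow> 'b" where
  "lookup \<equiv> Poly_Mapping.lookup"

abbreviation keys :: "('a \<Rightarrow>\<^sub>0 'b::zero) \<Rightarrow> 'a set" where
  "keys \<equiv> Poly_Mapping.keys"

type_synonym 'n mdegree = "'n \<Rightarrow>\<^sub>0 nat"
type_synonym ('n, 'k) mpolys = "('n \<Rightarrow>\<^sub>0 nat) \<Rightarrow>\<^sub>0 'k"

definition mdeg_le :: "'n mdegree \<Rightarrow> 'n mdegree \<Rightarrow> bool" (infix "\<preceq>" 50) where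
  "a \<preceq> b \<longleftrightarrow> (\<forall>t. lookup a t \<le> lookup b t)"

text \<open>
  \<open>'b \<Rightarrow>\<^sub>0 'r\<close> serves as the free \<open>'r\<close>-module on the set \<open>'b\<close>; this is used both for
  \<open>'r\<close> the ground field and for \<open>'r\<close> the polynomial ring.
\<close>

definition pm_scale :: "'r::comm_ring_1 \<Rightarrow> ('b \<Rightarrow>\<^sub>0 'r) \<Rightarrow> ('b \<Rightarrow>\<^sub>0 'r)" where
  "pm_scale c x = Poly_Mapping.map ((*) c) x"

lemma lookup_pm_scale: "lookup (pm_scale c x) u = c * lookup x u"
  by (simp add: pm_scale_def Poly_Mapping.map.rep_eq when_def)

interpretation pm: Modules.module "pm_scale :: 'r::comm_ring_1 \<Rightarrow> ('b \<Rightarrow>\<^sub>0 'r) \<Rightarrow> ('b \<Rightarrow>\<^sub>0 'r)"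
  by unfold_locales
    (rule poly_mapping_eqI; simp add: lookup_pm_scale lookup_add algebra_simps)+

definition pm_free :: "'b set \<Rightarrow> ('b \<Rightarrow>\<^sub>0 'r::comm_ring_1) set" where
  "pm_free S = pm.span ((\<lambda>u. Poly_Mapping.single u 1) ` S)"

definition max_ideal :: "('n, 'k::comm_ring_1) mpolys set" where
  "max_ideal = Modules.module.span (*)
     (range (\<lambda>t. Poly_Mapping.single (Poly_Mapping.single t 1) 1))"

definition max_ideal_times ::
  "('b \<Rightarrow>\<^sub>0 ('n, 'k::comm_ring_1) mpolys) set \<Rightarrow> ('b \<Rightarrow>\<^sub>0 ('n, 'k) mpolys) set" where
  "max_ideal_times N = pm.span {pm_scale q x | q x. q \<in> max_ideal \<and> x \<in> N}"

text \<open>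
  Given multidegrees of the basis elements, the homogeneous elements of multidegree \<open>a\<close> of the
  free module. Submodules \<open>N\<close> carry the induced grading \<open>N \<inter> hcomp deg a\<close>.
\<close>

definition hcomp ::
  "('b \<Rightarrow> 'n mdegree) \<Rightarrow> 'n mdegree \<Rightarrow> ('b \<Rightarrow>\<^sub>0 ('n, 'k::comm_ring_1) mpolys) set" where
  "hcomp deg a = {x. \<forall>u\<in>keys x. \<forall>m\<in>keys (lookup x u). m + deg u = a}"

definition finite_free_multigraded ::
  "('b \<Rightarrow> 'n mdegree) \<Rightarrow> ('b \<Rightarrow>\<^sub>0 ('n, 'k::comm_ring_1) mpolys) set \<Rightarrow> bool" where
  "finite_free_multigraded deg N \<longleftrightarrow>
     (\<exists>B. finite B \<and> pm.independent B \<and> pm.span B = N \<and> (\<forall>x\<in>B. \<exists>a. x \<in> hcomp deg a))"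

definition multigraded_hom ::
  "('b \<Rightarrow> 'n mdegree) \<Rightarrow> ('b \<Rightarrow>\<^sub>0 ('n, 'k::comm_ring_1) mpolys) set \<Rightarrow>
   ('b \<Rightarrow>\<^sub>0 ('n, 'k) mpolys) set \<Rightarrow>
   (('b \<Rightarrow>\<^sub>0 ('n, 'k) mpolys) \<Rightarrow> ('b \<Rightarrow>\<^sub>0 ('n, 'k) mpolys)) \<Rightarrow> bool" where
  "multigraded_hom deg N P f \<longleftrightarrow>
     (\<forall>x\<in>N. f x \<in> P) \<and>
     (\<forall>x\<in>N. \<forall>y\<in>N. f (x + y) = f x + f y) \<and>
     (\<forall>q. \<forall>x\<in>N. f (pm_scale q x) = pm_scale q (f x)) \<and>
     (\<forall>a. \<forall>x\<in>N \<inter> hcomp deg a. f x \<in> hcomp deg a)"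

definition multigraded_module ::
  "(('n, 'k::comm_ring_1) mpolys \<Rightarrow> 'm::ab_group_add \<Rightarrow> 'm) \<Rightarrow> ('n mdegree \<Rightarrow> 'm set) \<Rightarrow> bool" where
  "multigraded_module scl gr \<longleftrightarrow>
     Modules.module scl \<and>
     (\<forall>a. 0 \<in> gr a \<and> (\<forall>x\<in>gr a. \<forall>y\<in>gr a. x + y \<in> gr a)) \<and>
     (\<forall>a b c. \<forall>x\<in>gr a. scl (Poly_Mapping.single b c) x \<in> gr (b + a)) \<and>
     (\<forall>x. \<exists>!h::'n mdegree \<Rightarrow>\<^sub>0 'm. (\<forall>a. lookup h a \<in> gr a) \<and> x = (\<Sum>a\<in>keys h. lookup h a))"

definition noetherian_module :: "('r::comm_ring_1 \<Rightarrow> 'm::ab_group_add \<Rightarrow> 'm) \<Rightarrow> bool" where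
  "noetherian_module scl \<longleftrightarrow>
     (\<forall>N. Modules.module.subspace scl N \<longrightarrow> (\<exists>S. finite S \<and> Modules.module.span scl S = N))"

text \<open>\<open>Z / Y\<close>, as the set of cosets, is isomorphic to the multigraded module \<open>(scl, gr)\<close>.\<close>

definition quotient_iso ::
  "('b \<Rightarrow> 'n mdegree) \<Rightarrow> ('b \<Rightarrow>\<^sub>0 ('n, 'k::comm_ring_1) mpolys) set \<Rightarrow>
   ('b \<Rightarrow>\<^sub>0 ('n, 'k) mpolys) set \<Rightarrow>
   (('n, 'k) mpolys \<Rightarrow> 'm::ab_group_add \<Rightarrow> 'm) \<Rightarrow> ('n mdegree \<Rightarrow> 'm set) \<Rightarrow> bool" where
  "quotient_iso deg Z Y scl gr \<longleftrightarrow>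
     (let cs = (\<lambda>x. (+) x ` Y) in
      \<exists>h. bij_betw h (cs ` Z) UNIV \<and>
        (\<forall>x\<in>Z. \<forall>y\<in>Z. h (cs (x + y)) = h (cs x) + h (cs y)) \<and>
        (\<forall>q. \<forall>x\<in>Z. h (cs (pm_scale q x)) = scl q (h (cs x))) \<and>
        (\<forall>a. h ` cs ` (Z \<inter> hcomp deg a) = gr a))"

definition minimal_presentation ::
  "('b \<Rightarrow> 'n mdegree) \<Rightarrow> ('b \<Rightarrow>\<^sub>0 ('n, 'k::comm_ring_1) mpolys) set \<Rightarrow>
   ('b \<Rightarrow>\<^sub>0 ('n, 'k) mpolys) set \<Rightarrow>
   (('b \<Rightarrow>\<^sub>0 ('n, 'k) mpolys) \<Rightarrow> ('b \<Rightarrow>\<^sub>0 ('n, 'k) mpolys)) \<Rightarrow>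
   (('n, 'k) mpolys \<Rightarrow> 'm::ab_group_add \<Rightarrow> 'm) \<Rightarrow> ('n mdegree \<Rightarrow> 'm set) \<Rightarrow> bool" where
  "minimal_presentation deg E G \<phi> scl gr \<longleftrightarrow>
     multigraded_hom deg E G \<phi> \<and>
     quotient_iso deg G (\<phi> ` E) scl gr \<and>
     \<phi> ` E \<subseteq> max_ideal_times G \<and>
     {x \<in> E. \<phi> x = 0} \<subseteq> max_ideal_times E"

text \<open>Here \<open>d i\<close> is the differential from \<open>R i\<close> to \<open>R (i - 1)\<close>, for \<open>i \<ge> 1\<close>.\<close>

definition minimal_free_resolution ::
  "('b \<Rightarrow> 'n mdegree) \<Rightarrow> (nat \<Rightarrow> ('b \<Rightarrow>\<^sub>0 ('n, 'k::comm_ring_1) mpolys) set) \<Rightarrow>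
   (nat \<Rightarrow> ('b \<Rightarrow>\<^sub>0 ('n, 'k) mpolys) \<Rightarrow> ('b \<Rightarrow>\<^sub>0 ('n, 'k) mpolys)) \<Rightarrow>
   (('n, 'k) mpolys \<Rightarrow> 'm::ab_group_add \<Rightarrow> 'm) \<Rightarrow> ('n mdegree \<Rightarrow> 'm set) \<Rightarrow> bool" where
  "minimal_free_resolution deg R d scl gr \<longleftrightarrow>
     (\<forall>i. finite_free_multigraded deg (R i)) \<and>
     (\<forall>i\<ge>1. multigraded_hom deg (R i) (R (i - 1)) (d i)) \<and>
     (\<forall>i\<ge>2. \<forall>x\<in>R i. d (i - 1) (d i x) = 0) \<and>
     quotient_iso deg (R 0) (d 1 ` R 1) scl gr \<and>
     (\<forall>i\<ge>1. {x \<in> R i. d i x = 0} = d (i + 1) ` R (i + 1)) \<and>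
     (\<forall>i\<ge>1. d i ` R i \<subseteq> max_ideal_times (R (i - 1)))"

section \<open>The morphism and its coefficient matrix\<close>

text \<open>
  Indices run from \<open>0\<close>. All modules of a Buchsbaum--Rim--Taylor complex are
  submodules of the free module on the following symbols:
  \<open>Gam i\<close> is the basis element \<open>\<gamma>\<^sub>i\<close> of \<open>G\<close>, \<open>Eps j\<close> is the basis element \<open>\<epsilon>\<^sub>j\<close> of \<open>E\<close>, and
  \<open>Ups b I\<close> stands for \<open>\<upsilon>\<^sup>(\<^sup>b\<^sup>) \<otimes> \<epsilon>\<^sub>I \<otimes> (\<upsilon>\<^sub>0 \<and> \<dots> \<and> \<upsilon>\<^sub>r\<^sub>-\<^sub>1)\<close>.
\<close>

datatype br_sym = Gam nat | Eps nat | Ups "nat \<Rightarrow>\<^sub>0 nat" "nat set"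

definition lcm_deg :: "(nat \<Rightarrow> 'n::finite mdegree) \<Rightarrow> nat set \<Rightarrow> 'n mdegree" where
  "lcm_deg dE I = Abs_poly_mapping (\<lambda>t. Max ((\<lambda>i. lookup (dE i) t) ` I))"

primrec br_deg ::
  "(nat \<Rightarrow> 'n::finite mdegree) \<Rightarrow> (nat \<Rightarrow> 'n mdegree) \<Rightarrow> br_sym \<Rightarrow> 'n mdegree" where
  "br_deg dE dG (Gam i) = dG i"
| "br_deg dE dG (Eps j) = dE j"
| "br_deg dE dG (Ups b I) = lcm_deg dE I"

definition E_mod :: "nat \<Rightarrow> (br_sym \<Rightarrow>\<^sub>0 'r::comm_ring_1) set" where
  "E_mod e = pm_free (Eps ` {..<e})"

definition G_mod :: "nat \<Rightarrow> (br_sym \<Rightarrow>\<^sub>0 'r::comm_ring_1) set" where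
  "G_mod g = pm_free (Gam ` {..<g})"

text \<open>
  Since \<open>\<phi>\<close> preserves multidegrees, the \<open>(i, j)\<close> entry of its matrix is a scalar times
  the monomial of exponent \<open>dE j - dG i\<close>, and it is \<open>0\<close> unless \<open>dG i \<preceq> dE j\<close>.
\<close>

definition coeff_mat ::
  "nat \<Rightarrow> nat \<Rightarrow> (nat \<Rightarrow> 'n mdegree) \<Rightarrow> (nat \<Rightarrow> 'n mdegree) \<Rightarrow>
   ((br_sym \<Rightarrow>\<^sub>0 ('n, 'k::comm_ring_1) mpolys) \<Rightarrow> (br_sym \<Rightarrow>\<^sub>0 ('n, 'k) mpolys)) \<Rightarrow> 'k mat" where
  "coeff_mat e g dE dG \<phi> =
     mat g e (\<lambda>(i, j).
       lookup (lookup (\<phi> (Poly_Mapping.single (Eps j) 1)) (Gam i)) (dE j - dG i))"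

abbreviation mat_rank :: "'k::field mat \<Rightarrow> nat" where
  "mat_rank C \<equiv> vec_space.rank (dim_row C) C"

definition combinatorially_generic :: "nat \<Rightarrow> (nat \<Rightarrow> 'n mdegree) \<Rightarrow> bool" where
  "combinatorially_generic e dE \<longleftrightarrow>
     (\<forall>i j. i < j \<and> j < e \<longrightarrow>
        keys (dE i) \<union> keys (dE j) \<subseteq> {t. int (lookup (dE i) t) - int (lookup (dE j) t) \<noteq> 0})"

definition uniform_rank :: "'k::field mat \<Rightarrow> bool" where
  "uniform_rank C \<longleftrightarrow>
     (\<forall>J \<subseteq> {..<dim_col C}. card J = mat_rank C \<longrightarrow> mat_rank (submatrix C UNIV J) = mat_rank C)"

definition generic :: "(nat \<Rightarrow> 'n mdegree) \<Rightarrow> 'k::field mat \<Rightarrow> bool" where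
  "generic dE C \<longleftrightarrow> combinatorially_generic (dim_col C) dE \<and> uniform_rank C"

section \<open>The dual of the image and its divided powers\<close>

text \<open>The map \<open>s\<close> is multiplication by \<open>C\<close>; \<open>im_sub C I\<close> is \<open>V\<^sub>I\<close>, and \<open>im_space C\<close> is \<open>V\<close>.\<close>

definition im_sub :: "'k::field mat \<Rightarrow> nat set \<Rightarrow> 'k vec set" where
  "im_sub C I = {C *\<^sub>v u | u. u \<in> carrier_vec (dim_col C) \<and> (\<forall>j<dim_col C. j \<notin> I \<longrightarrow> u $ j = 0)}"

definition im_space :: "'k::field mat \<Rightarrow> 'k vec set" where
  "im_space C = (\<lambda>u. C *\<^sub>v u) ` carrier_vec (dim_col C)"

text \<open>Linear forms on \<open>V\<close> are represented by functions that vanish outside of \<open>V\<close>.\<close>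

definition dual_space :: "'k::field mat \<Rightarrow> ('k vec \<Rightarrow> 'k) set" where
  "dual_space C = {f.
     (\<forall>v\<in>im_space C. \<forall>w\<in>im_space C. f (v + w) = f v + f w) \<and>
     (\<forall>c. \<forall>v\<in>im_space C. f (c \<cdot>\<^sub>v v) = c * f v) \<and>
     (\<forall>v. v \<notin> im_space C \<longrightarrow> f v = 0)}"

definition dual_basis :: "'k::field mat \<Rightarrow> (nat \<Rightarrow> 'k vec \<Rightarrow> 'k) \<Rightarrow> bool" where
  "dual_basis C \<upsilon> \<longleftrightarrow>
     (\<forall>j<mat_rank C. \<upsilon> j \<in> dual_space C) \<and>
     (\<forall>f\<in>dual_space C. \<exists>!c. (\<forall>j\<ge>mat_rank C. c j = 0) \<and> f = (\<lambda>v. \<Sum>j<mat_rank C. c j * \<upsilon> j v))"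

definition annihilator :: "'k::field mat \<Rightarrow> nat set \<Rightarrow> ('k vec \<Rightarrow> 'k) set" where
  "annihilator C I = {f \<in> dual_space C. \<forall>v\<in>im_sub C I. f v = 0}"

text \<open>
  The divided power algebra of \<open>V\<^sup>*\<close> has the basis \<open>\<upsilon>\<^sup>(\<^sup>b\<^sup>)\<close>, here \<open>Poly_Mapping.single b 1\<close>, with
  \<open>\<upsilon>\<^sup>(\<^sup>b\<^sup>) \<upsilon>\<^sup>(\<^sup>c\<^sup>) = (\<Prod>\<^sub>j (b\<^sub>j + c\<^sub>j choose b\<^sub>j)) \<upsilon>\<^sup>(\<^sup>b\<^sup>+\<^sup>c\<^sup>)\<close>. The multiplication \<open>*\<close> of
  the type \<open>\<Rightarrow>\<^sub>0\<close> is that of the polynomial ring, hence the separate product below.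
  The \<open>q\<close>-th divided power of \<open>\<Sum>\<^sub>j c\<^sub>j \<upsilon>\<^sub>j\<close> is the sum of all
  \<open>(\<Prod>\<^sub>j c\<^sub>j\<^sup>b\<^sup>j) \<upsilon>\<^sup>(\<^sup>b\<^sup>)\<close> with \<open>\<Sum>\<^sub>j b\<^sub>j = q\<close>.
\<close>

definition dp_mult ::
  "((nat \<Rightarrow>\<^sub>0 nat) \<Rightarrow>\<^sub>0 'k::field) \<Rightarrow> ((nat \<Rightarrow>\<^sub>0 nat) \<Rightarrow>\<^sub>0 'k) \<Rightarrow> ((nat \<Rightarrow>\<^sub>0 nat) \<Rightarrow>\<^sub>0 'k)" where
  "dp_mult y z = (\<Sum>b\<in>keys y. \<Sum>c\<in>keys z. Poly_Mapping.single (b + c)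
     (of_nat (\<Prod>j\<in>keys b. (lookup b j + lookup c j) choose lookup b j) * lookup y b * lookup z c))"

definition dp_power :: "nat \<Rightarrow> (nat \<Rightarrow> 'k::field) \<Rightarrow> nat \<Rightarrow> ((nat \<Rightarrow>\<^sub>0 nat) \<Rightarrow>\<^sub>0 'k)" where
  "dp_power r c q = (\<Sum>b | keys b \<subseteq> {..<r} \<and> (\<Sum>j<r. lookup b j) = q.
     Poly_Mapping.single b (\<Prod>j<r. c j ^ lookup b j))"

text \<open>
  For a subspace \<open>K\<close> of \<open>V\<^sup>*\<close>, the subspace \<open>D\<^sub>p K\<close> of \<open>D\<^sub>p V\<^sup>*\<close> is spanned by the products
  \<open>w\<^sub>1\<^sup>(\<^sup>q\<^sup>1\<^sup>) \<cdots> w\<^sub>m\<^sup>(\<^sup>q\<^sup>m\<^sup>)\<close> with \<open>w\<^sub>i \<in> K\<close> and \<open>q\<^sub>1 + \<cdots> + q\<^sub>m = p\<close>.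
  In the list \<open>ws\<close> each \<open>w\<^sub>i\<close> is given by its coordinates in the basis \<open>\<upsilon>\<close>.
\<close>

definition dpow ::
  "'k::field mat \<Rightarrow> (nat \<Rightarrow> 'k vec \<Rightarrow> 'k) \<Rightarrow> nat \<Rightarrow> ('k vec \<Rightarrow> 'k) set \<Rightarrow>
   ((nat \<Rightarrow>\<^sub>0 nat) \<Rightarrow>\<^sub>0 'k) set" where
  "dpow C \<upsilon> p K = pm.span
     {foldr (\<lambda>(c, q). dp_mult (dp_power (mat_rank C) c q)) ws (Poly_Mapping.single 0 1) | ws.
        (\<forall>(c, q)\<in>set ws. (\<lambda>v. \<Sum>j<mat_rank C. c j * \<upsilon> j v) \<in> K) \<and>
        sum_list (map snd ws) = p}"

section \<open>Buchsbaum--Rim--Taylor complexes\<close>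

definition face_sgn :: "nat \<Rightarrow> nat set \<Rightarrow> 'k::comm_ring_1" where
  "face_sgn l I = (- 1) ^ card {k \<in> I. k < l}"

text \<open>
  The maps \<open>s\<^sub>i\<close> of the Buchsbaum--Rim complex, for \<open>i \<ge> 2\<close>, on basis elements.
  The vector \<open>col C l\<close> is \<open>s(\<epsilon>\<^sub>l)\<close>.
\<close>

fun br_map ::
  "'k::field mat \<Rightarrow> (nat \<Rightarrow> 'k vec \<Rightarrow> 'k) \<Rightarrow> nat \<Rightarrow> br_sym \<Rightarrow> (br_sym \<Rightarrow>\<^sub>0 'k)" where
  "br_map C \<upsilon> i (Ups b I) =
     (if i \<ge> 3 then
        (\<Sum>j<mat_rank C. \<Sum>l\<in>I.
           if lookup b j = 0 then 0
           else Poly_Mapping.single (Ups (b - Poly_Mapping.single j 1) (I - {l}))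
                  (face_sgn l I * \<upsilon> j (col C l)))
      else if i = 2 then
        (\<Sum>l\<in>I. Poly_Mapping.single (Eps l)
           (face_sgn l I *
            det (mat (mat_rank C) (mat_rank C)
                   (\<lambda>(j, k). \<upsilon> j (col C (sorted_list_of_set (I - {l}) ! k))))))
      else 0)"
| "br_map C \<upsilon> i _ = 0"

text \<open>
  The homogenization of a \<open>'k\<close>-linear map, given on basis elements: a component from \<open>u\<close> to
  \<open>v\<close> is multiplied by the monomial of exponent \<open>deg u - deg v\<close>.
\<close>

definition homogenization ::
  "('b \<Rightarrow> 'n mdegree) \<Rightarrow> ('b \<Rightarrow> ('b \<Rightarrow>\<^sub>0 'k::field)) \<Rightarrow>
   ('b \<Rightarrow>\<^sub>0 ('n, 'k) mpolys) \<Rightarrow> ('b \<Rightarrow>\<^sub>0 ('n, 'k) mpolys)" where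
  "homogenization deg f x = (\<Sum>u\<in>keys x. \<Sum>v\<in>keys (f u).
     Poly_Mapping.single v (lookup x u * Poly_Mapping.single (deg u - deg v) (lookup (f u) v)))"

text \<open>
  The complex attached to a family \<open>F\<close>, where \<open>F I\<close> is a subspace of \<open>D\<^sub>p V\<^sup>*\<close> for
  \<open>p = card I - r - 1\<close>. The module in degree \<open>i \<ge> 2\<close> is generated by the elements
  \<open>y \<otimes> \<epsilon>\<^sub>I \<otimes> (\<upsilon>\<^sub>0 \<and> \<dots> \<and> \<upsilon>\<^sub>r\<^sub>-\<^sub>1)\<close> with \<open>y \<in> F I\<close>.
\<close>

definition ups_elem ::
  "nat set \<Rightarrow> ((nat \<Rightarrow>\<^sub>0 nat) \<Rightarrow>\<^sub>0 'k::field) \<Rightarrow> (br_sym \<Rightarrow>\<^sub>0 ('n, 'k) mpolys)" where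
  "ups_elem I y =
     (\<Sum>b\<in>keys y. Poly_Mapping.single (Ups b I) (Poly_Mapping.single 0 (lookup y b)))"

definition brt_mod ::
  "'k::field mat \<Rightarrow> (nat set \<Rightarrow> ((nat \<Rightarrow>\<^sub>0 nat) \<Rightarrow>\<^sub>0 'k) set) \<Rightarrow> nat \<Rightarrow>
   (br_sym \<Rightarrow>\<^sub>0 ('n, 'k) mpolys) set" where
  "brt_mod C F i =
     (if i = 0 then G_mod (dim_row C)
      else if i = 1 then E_mod (dim_col C)
      else pm.span {ups_elem I y | I y.
             I \<subseteq> {..<dim_col C} \<and> card I = mat_rank C + i - 1 \<and> y \<in> F I})"

definition brt_diff ::
  "(nat \<Rightarrow> 'n::finite mdegree) \<Rightarrow> (nat \<Rightarrow> 'n mdegree) \<Rightarrow>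
   ((br_sym \<Rightarrow>\<^sub>0 ('n, 'k::field) mpolys) \<Rightarrow> (br_sym \<Rightarrow>\<^sub>0 ('n, 'k) mpolys)) \<Rightarrow>
   'k mat \<Rightarrow> (nat \<Rightarrow> 'k vec \<Rightarrow> 'k) \<Rightarrow> nat \<Rightarrow>
   (br_sym \<Rightarrow>\<^sub>0 ('n, 'k) mpolys) \<Rightarrow> (br_sym \<Rightarrow>\<^sub>0 ('n, 'k) mpolys)" where
  "brt_diff dE dG \<phi> C \<upsilon> i =
     (if i = 1 then \<phi> else homogenization (br_deg dE dG) (br_map C \<upsilon> i))"

section \<open>The Scarf complex\<close>

definition faces :: "nat \<Rightarrow> nat set set" where
  "faces e = {I. I \<noteq> {} \<and> I \<subseteq> {..<e}}"

definition scarf_faces :: "nat \<Rightarrow> (nat \<Rightarrow> 'n::finite mdegree) \<Rightarrow> nat set set" where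
  "scarf_faces e dE = {I \<in> faces e. \<forall>J\<in>faces e. J \<noteq> I \<longrightarrow> lcm_deg dE I \<noteq> lcm_deg dE J}"

definition lcm_lattice :: "nat \<Rightarrow> (nat \<Rightarrow> 'n::finite mdegree) \<Rightarrow> 'n mdegree set" where
  "lcm_lattice e dE = lcm_deg dE ` faces e"

definition non_scarf_degs :: "nat \<Rightarrow> (nat \<Rightarrow> 'n::finite mdegree) \<Rightarrow> 'n mdegree set" where
  "non_scarf_degs e dE = lcm_lattice e dE - lcm_deg dE ` scarf_faces e dE"

text \<open>The sets \<open>I\<^sub>\<alpha>\<close>, \<open>I(\<alpha>)\<close> and \<open>I\<^sup>\<alpha>\<close>, in this order.\<close>

definition face_below :: "nat \<Rightarrow> (nat \<Rightarrow> 'n mdegree) \<Rightarrow> 'n mdegree \<Rightarrow> nat set" where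
  "face_below e dE \<alpha> = {i. i < e \<and> dE i \<preceq> \<alpha>}"

definition face_core :: "nat \<Rightarrow> (nat \<Rightarrow> 'n::finite mdegree) \<Rightarrow> 'n mdegree \<Rightarrow> nat set" where
  "face_core e dE \<alpha> = \<Inter> {I \<in> faces e. lcm_deg dE I = \<alpha>}"

definition face_upper :: "nat \<Rightarrow> (nat \<Rightarrow> 'n::finite mdegree) \<Rightarrow> 'n mdegree \<Rightarrow> nat set" where
  "face_upper e dE \<alpha> = face_below e dE \<alpha> - face_core e dE \<alpha>"

text \<open>
  In the third case \<open>\<alpha>\<close> is unique, since \<open>I = I\<^sub>\<alpha>\<close> with \<open>\<alpha>\<close> in the lcm-lattice has
  multidegree \<open>\<alpha>\<close>.
\<close>

definition scarf_system ::
  "(nat \<Rightarrow> 'n::finite mdegree) \<Rightarrow> 'k::field mat \<Rightarrow> (nat \<Rightarrow> 'k vec \<Rightarrow> 'k) \<Rightarrow> nat set \<Rightarrow>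
   ((nat \<Rightarrow>\<^sub>0 nat) \<Rightarrow>\<^sub>0 'k) set" where
  "scarf_system dE C \<upsilon> I =
     (let e = dim_col C; r = mat_rank C in
      if card I \<le> r then {0}
      else if I \<in> scarf_faces e dE then dpow C \<upsilon> (card I - r - 1) (dual_space C)
      else if \<exists>\<alpha>\<in>non_scarf_degs e dE. I = face_below e dE \<alpha> then
        dpow C \<upsilon> (card I - r - 1)
          (annihilator C
             (face_upper e dE (THE \<alpha>. \<alpha> \<in> non_scarf_degs e dE \<and> I = face_below e dE \<alpha>)))
      else {0})"

definition scarf_mod ::
  "(nat \<Rightarrow> 'n::finite mdegree) \<Rightarrow> 'k::field mat \<Rightarrow> (nat \<Rightarrow> 'k vec \<Rightarrow> 'k) \<Rightarrow> nat \<Rightarrow>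
   (br_sym \<Rightarrow>\<^sub>0 ('n, 'k) mpolys) set" where
  "scarf_mod dE C \<upsilon> = brt_mod C (scarf_system dE C \<upsilon>)"

end

theory Submission
  imports Defs
begin

text \<open>
  Exactness and minimality can be tested one multidegree at a time. In multidegree \<open>\<alpha>\<close> the Scarf
  complex becomes a complex of vector spaces that only involves the basis elements
  \<open>\<epsilon>\<^sub>i\<close> with \<open>i \<in> A = I\<^sub>\<alpha>\<close>, and it is a subcomplex of the Buchsbaum--Rim complex of the
  restriction of \<open>s\<close> to their span, in which every face \<open>I \<subseteq> A\<close> carries the full divided
  power of \<open>V\<^sup>*\<close>. As any \<open>r\<close> columns of \<open>C\<close> are linearly independent, the latter complex is exact
  (\<open>buchsbaum_rim_exact\<close>, \<open>cramer_map_onto_kernel\<close>). It therefore suffices to move a chain of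
  the Buchsbaum--Rim complex whose boundary lies in the Scarf complex into the Scarf complex by
  adding a boundary (\<open>reduce_to_scarf\<close>).

  To do this, filter by the multidegrees \<open>\<beta>\<close> of faces. Genericity implies that the faces of
  multidegree \<open>\<beta>\<close> are exactly the sets between \<open>I(\<beta>)\<close> and \<open>I\<^sub>\<beta>\<close> (\<open>mdeg_eq_iff\<close>), so that the
  corresponding subquotient of the Buchsbaum--Rim complex is a strand of the Koszul complex
  \<open>D V\<^sup>* \<otimes> \<Lambda> U\<^sub>X\<close> with \<open>X = I\<^sup>\<beta>\<close>. The columns in \<open>X\<close> are linearly independent, or they contain a basis
  of \<open>V\<close>. In the first case the homology of the Koszul complex sits at the top face \<open>I\<^sub>\<beta>\<close> and consists
  of the elements of \<open>D V\<^sup>*\<close> that are killed by the contractions with all \<open>s(\<epsilon>\<^sub>l)\<close>, \<open>l \<in> X\<close>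
  (\<open>koszul_homology\<close>). These elements form the divided power of the annihilator \<open>K\<^sub>X\<close>
  (\<open>dpow_eq_kill\<close>), which is what the Scarf system attaches to \<open>I\<^sub>\<beta>\<close> (\<open>scarf_system_eq\<close>).
  In the second case the only homology is in \<open>D\<^sub>0 V\<^sup>*\<close>, on faces of \<open>r + 1\<close> elements that contain
  \<open>I(\<beta>)\<close> and \<open>r\<close> further elements. There are none, because \<open>I(\<beta>)\<close> has at least two elements
  (\<open>card_core\<close>): otherwise some \<open>\<epsilon>\<^sub>i\<close> would have multidegree \<open>\<beta>\<close>, and Cramer's rule would give a
  relation of multidegree \<open>\<beta>\<close> in which the coefficient of \<open>\<epsilon>\<^sub>i\<close> is a nonzero scalar, although the
  presentation is minimal (\<open>generic_system_of_presentation\<close>).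

  The homology of the Koszul complex and the description of the divided power of \<open>K\<^sub>X\<close> both rest on
  one property of the divided power algebra: if \<open>v\<^sub>1, \<dots>, v\<^sub>k\<close> are linearly independent, then the contraction with \<open>v\<^sub>k\<close> maps the common kernel
  of the contractions with \<open>v\<^sub>1, \<dots>, v\<^bsub>k-1\<^esub>\<close> onto itself, as one sees by integrating by parts
  (\<open>antiderivative\<close>).

  Minimality of the resolution is visible on the components of the differential
  (\<open>differential_minimal\<close>). The component from \<open>I = I\<^sub>\<beta>\<close> to \<open>I \<setminus> l\<close> changes the multidegree if
  \<open>l \<in> I(\<beta>)\<close>, and it vanishes if \<open>l \<in> I\<^sup>\<beta>\<close>, since it contracts elements of \<open>D K\<^sub>X\<close> with \<open>s(\<epsilon>\<^sub>l)\<close>.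
\<close>

section \<open>Divided powers and contractions\<close>

text \<open>
  The contraction of an element of the divided power algebra of \<open>V\<^sup>*\<close> with the \<open>j\<close>-th vector of the
  basis of \<open>V\<close> that is dual to \<open>\<upsilon>\<close>: it lowers the \<open>j\<close>-th exponent of \<open>\<upsilon>\<^sup>(\<^sup>b\<^sup>)\<close> by one.
\<close>

definition dp_shift :: "nat \<Rightarrow> ((nat \<Rightarrow>\<^sub>0 nat) \<Rightarrow>\<^sub>0 'k::field) \<Rightarrow> ((nat \<Rightarrow>\<^sub>0 nat) \<Rightarrow>\<^sub>0 'k)" where
  "dp_shift j y = Poly_Mapping.map_key (\<lambda>b. b + Poly_Mapping.single j 1) y"

text \<open>
  The contraction with the vector of \<open>V\<close> on which \<open>\<upsilon>\<^sub>j\<close> takes the value \<open>c j\<close>.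
\<close>

definition contr ::
  "nat \<Rightarrow> (nat \<Rightarrow> 'k::field) \<Rightarrow> ((nat \<Rightarrow>\<^sub>0 nat) \<Rightarrow>\<^sub>0 'k) \<Rightarrow> ((nat \<Rightarrow>\<^sub>0 nat) \<Rightarrow>\<^sub>0 'k)" where
  "contr r c y = (\<Sum>j<r. pm_scale (c j) (dp_shift j y))"

text \<open>The homogeneous component \<open>D\<^sub>n V\<^sup>*\<close>.\<close>

definition dp_hom :: "nat \<Rightarrow> nat \<Rightarrow> ((nat \<Rightarrow>\<^sub>0 nat) \<Rightarrow>\<^sub>0 'k::field) set" where
  "dp_hom r n = {y. \<forall>b\<in>keys y. keys b \<subseteq> {..<r} \<and> (\<Sum>j<r. lookup b j) = n}"

lemma lookup_dp_shift: "lookup (dp_shift j y) b = lookup y (b + Poly_Mapping.single j 1)"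
  by (simp add: dp_shift_def Poly_Mapping.map_key.rep_eq inj_on_def)

lemma lookup_contr: "lookup (contr r c y) b = (\<Sum>j<r. c j * lookup y (b + Poly_Mapping.single j 1))"
  by (simp add: contr_def lookup_sum lookup_pm_scale lookup_dp_shift)

lemma contr_add: "contr r c (y + z) = contr r c y + contr r c z"
  by (rule poly_mapping_eqI) (simp add: lookup_contr lookup_add algebra_simps sum.distrib)

lemma contr_scale: "contr r c (pm_scale s y) = pm_scale s (contr r c y)"
  by (rule poly_mapping_eqI) (simp add: lookup_contr lookup_pm_scale sum_distrib_left mult_ac)

lemma contr_zero [simp]: "contr r c 0 = 0"
  by (rule poly_mapping_eqI) (simp add: lookup_contr)

lemma contr_diff: "contr r c (y - z) = contr r c y - contr r c z"
  by (rule poly_mapping_eqI) (simp add: lookup_contr lookup_minus algebra_simps sum_subtractf)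

lemma contr_sum: "contr r c (sum f S) = (\<Sum>i\<in>S. contr r c (f i))"
  by (induction S rule: infinite_finite_induct) (auto simp: contr_add)

lemma contr_commute: "contr r c (contr r d y) = contr r d (contr r c y)"
proof (rule poly_mapping_eqI)
  fix b
  show "lookup (contr r c (contr r d y)) b = lookup (contr r d (contr r c y)) b"
    unfolding lookup_contr sum_distrib_left
    by (subst sum.swap) (simp add: mult_ac add_ac)
qed

lemma contr_cong: "(\<And>j. j < r \<Longrightarrow> c j = d j) \<Longrightarrow> contr r c y = contr r d y"
  by (simp add: contr_def)

lemma contr_lincomb:
  "contr r (\<lambda>j. \<Sum>p\<in>S. a p * m p j) y = (\<Sum>p\<in>S. pm_scale (a p) (contr r (m p) y))"
proof (rule poly_mapping_eqI)
  fix b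
  show "lookup (contr r (\<lambda>j. \<Sum>p\<in>S. a p * m p j) y) b =
      lookup (\<Sum>p\<in>S. pm_scale (a p) (contr r (m p) y)) b"
    unfolding lookup_contr lookup_sum lookup_pm_scale sum_distrib_left sum_distrib_right
    by (subst sum.swap) (simp add: mult_ac)
qed

lemma sum_pm_single:
  "j < r \<Longrightarrow> (\<Sum>i<(r::nat). lookup (b + Poly_Mapping.single j (1::nat)) i) = Suc (\<Sum>i<r. lookup b i)"
  by (simp add: lookup_add lookup_single sum.distrib when_def)

lemma keys_add_single:
  "keys (b + Poly_Mapping.single j (1::nat)) = insert j (keys b)"
  by (auto simp: in_keys_iff lookup_add lookup_single when_def split: if_splits)

lemma dp_hom_0 [simp]: "0 \<in> dp_hom r n"
  by (simp add: dp_hom_def)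

lemma dp_hom_iff:
  "y \<in> dp_hom r n \<longleftrightarrow> (\<forall>b. \<not> (keys b \<subseteq> {..<r} \<and> (\<Sum>j<r. lookup b j) = n) \<longrightarrow> lookup y b = 0)"
  by (auto simp: dp_hom_def in_keys_iff)

lemma dp_hom_add: "y \<in> dp_hom r n \<Longrightarrow> z \<in> dp_hom r n \<Longrightarrow> y + z \<in> dp_hom r n"
  by (simp add: dp_hom_iff lookup_add)

lemma dp_hom_diff: "y \<in> dp_hom r n \<Longrightarrow> z \<in> dp_hom r n \<Longrightarrow> y - z \<in> dp_hom r n"
  by (simp add: dp_hom_iff lookup_minus)

lemma dp_hom_scale: "y \<in> dp_hom r n \<Longrightarrow> pm_scale c y \<in> dp_hom r n"
  by (simp add: dp_hom_iff lookup_pm_scale)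

lemma dp_hom_sum: "(\<And>i. i \<in> S \<Longrightarrow> f i \<in> dp_hom r n) \<Longrightarrow> sum f S \<in> dp_hom r n"
  by (induction S rule: infinite_finite_induct) (auto intro: dp_hom_add)

lemma dp_hom_contr:
  assumes "y \<in> dp_hom r (Suc n)"
  shows "contr r c y \<in> dp_hom r n"
  unfolding dp_hom_iff
proof (intro allI impI)
  fix b assume b: "\<not> (keys b \<subseteq> {..<r} \<and> (\<Sum>j<r. lookup b j) = n)"
  have "lookup y (b + Poly_Mapping.single j 1) = 0" if "j < r" for j
    using assms[unfolded dp_hom_iff, rule_format, of "b + Poly_Mapping.single j 1"] b that
    by (simp only: keys_add_single sum_pm_single) auto
  then show "lookup (contr r c y) b = 0"
    by (simp add: lookup_contr)
qed

lemma contr_dp_hom_0: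
  assumes "y \<in> dp_hom r 0"
  shows "contr r c y = 0"
proof (rule poly_mapping_eqI)
  fix b
  have "lookup y (b + Poly_Mapping.single j 1) = 0" if "j < r" for j
    using assms[unfolded dp_hom_iff, rule_format, of "b + Poly_Mapping.single j 1"] that
    by (simp only: keys_add_single sum_pm_single) auto
  then show "lookup (contr r c y) b = lookup 0 b"
    by (simp add: lookup_contr)
qed

lemma dp_hom_0_const:
  assumes "y \<in> dp_hom r 0"
  shows "y = pm_scale (lookup y 0) (Poly_Mapping.single 0 1)"
proof (rule poly_mapping_eqI)
  fix b
  have "b = 0" if "lookup y b \<noteq> 0"
  proof -
    have "keys b \<subseteq> {..<r}" "(\<Sum>j<r. lookup b j) = 0"
      using assms that by (auto simp: dp_hom_iff)
    then show ?thesis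
      by (metis finite_lessThan in_keys_iff lessThan_iff poly_mapping_eqI lookup_zero subsetD sum_eq_0_iff)
  qed
  then show "lookup y b = lookup (pm_scale (lookup y 0) (Poly_Mapping.single 0 1)) b"
    by (auto simp: lookup_pm_scale lookup_one when_def)
qed

text \<open>
  In positive degree every monomial can be lowered, so the contractions detect all coefficients.
\<close>

lemma dp_hom_eq_0I:
  assumes y: "y \<in> dp_hom r (Suc n)" and shift: "\<And>j. j < r \<Longrightarrow> dp_shift j y = 0"
  shows "y = 0"
proof (rule ccontr)
  assume "y \<noteq> 0"
  then obtain b where b: "b \<in> keys y"
    by (metis keys_eq_empty ex_in_conv)
  with y have kb: "keys b \<subseteq> {..<r}" and "(\<Sum>j<r. lookup b j) = Suc n"
    by (auto simp: dp_hom_def)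
  then obtain j where j: "j < r" "lookup b j \<noteq> 0"
    by (metis lessThan_iff nat.distinct(1) sum.neutral)
  have "b = (b - Poly_Mapping.single j 1) + Poly_Mapping.single j 1"
    using j by (intro poly_mapping_eqI) (auto simp: lookup_add lookup_minus lookup_single when_def)
  then have "lookup y b = lookup (dp_shift j y) (b - Poly_Mapping.single j 1)"
    by (simp add: lookup_dp_shift)
  with shift[OF j(1)] b show False
    by (simp add: in_keys_iff)
qed

subsection \<open>Multiplication\<close>

text \<open>
  The defining sum runs over the supports of the factors, which obstructs additivity; over fixed larger
  sets each term is bilinear.
\<close>

lemma dp_mult_superset:
  assumes "finite B" "keys y \<subseteq> B" "finite D" "keys z \<subseteq> D"
  shows "dp_mult y z = (\<Sum>b\<in>B. \<Sum>c\<in>D. Poly_Mapping.single (b + c)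
     (of_nat (\<Prod>j\<in>keys b. (lookup b j + lookup c j) choose lookup b j) * lookup y b * lookup z c))"
  unfolding dp_mult_def
  using assms
  by (intro sum.mono_neutral_cong_left) (auto simp: in_keys_iff intro!: sum.neutral sum.mono_neutral_cong_left)

lemma dp_mult_add_left: "dp_mult (y + y') z = dp_mult y z + dp_mult y' z"
proof -
  have "keys (y + y') \<subseteq> keys y \<union> keys y'"
    by (rule Poly_Mapping.keys_add)
  then show ?thesis
    using dp_mult_superset[of "keys y \<union> keys y'" "y + y'" "keys z" z]
      dp_mult_superset[of "keys y \<union> keys y'" y "keys z" z]
      dp_mult_superset[of "keys y \<union> keys y'" y' "keys z" z]
    by (simp add: lookup_add algebra_simps single_add sum.distrib)
qed

lemma dp_mult_add_right: "dp_mult y (z + z') = dp_mult y z + dp_mult y z'"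
proof -
  have "keys (z + z') \<subseteq> keys z \<union> keys z'"
    by (rule Poly_Mapping.keys_add)
  then show ?thesis
    using dp_mult_superset[of "keys y" y "keys z \<union> keys z'" "z + z'"]
      dp_mult_superset[of "keys y" y "keys z \<union> keys z'" z]
      dp_mult_superset[of "keys y" y "keys z \<union> keys z'" z']
    by (simp add: lookup_add algebra_simps single_add sum.distrib)
qed

lemma keys_pm_scale: "keys (pm_scale c y) \<subseteq> keys y"
  by (auto simp: in_keys_iff lookup_pm_scale)

lemma pm_scale_single [simp]:
  "pm_scale c (Poly_Mapping.single b s) = Poly_Mapping.single b (c * s)"
  by (rule poly_mapping_eqI) (simp add: lookup_pm_scale lookup_single when_def)

lemma dp_mult_scale_left: "dp_mult (pm_scale c y) z = pm_scale c (dp_mult y z)"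
  using dp_mult_superset[of "keys y" "pm_scale c y" "keys z" z]
  by (simp add: keys_pm_scale dp_mult_def lookup_pm_scale pm.scale_sum_right mult_ac)

lemma dp_mult_scale_right: "dp_mult y (pm_scale c z) = pm_scale c (dp_mult y z)"
  using dp_mult_superset[of "keys y" y "keys z" "pm_scale c z"]
  by (simp add: keys_pm_scale dp_mult_def lookup_pm_scale pm.scale_sum_right mult_ac)

lemma dp_mult_0 [simp]: "dp_mult 0 z = 0" "dp_mult y 0 = 0"
  by (simp_all add: dp_mult_def)

lemma dp_mult_sum_left: "dp_mult (sum f S) z = (\<Sum>i\<in>S. dp_mult (f i) z)"
  by (induction S rule: infinite_finite_induct) (auto simp: dp_mult_add_left)

lemma dp_mult_sum_right: "dp_mult z (sum f S) = (\<Sum>i\<in>S. dp_mult z (f i))"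
  by (induction S rule: infinite_finite_induct) (auto simp: dp_mult_add_right)

lemma dp_mult_single:
  "dp_mult (Poly_Mapping.single b s) (Poly_Mapping.single c t) = Poly_Mapping.single (b + c)
     (of_nat (\<Prod>j\<in>keys b. (lookup b j + lookup c j) choose lookup b j) * s * t)"
  using dp_mult_superset[of "{b}" "Poly_Mapping.single b s" "{c}" "Poly_Mapping.single c t"]
  by simp

lemma sum_singles: "(\<Sum>b\<in>keys y. Poly_Mapping.single b (lookup y b)) = y"
proof (rule poly_mapping_eqI)
  fix b
  have "(\<Sum>c\<in>keys y. if c = b then lookup y c else 0) = lookup y b"
    by (simp add: in_keys_iff)
  then show "lookup (\<Sum>b\<in>keys y. Poly_Mapping.single b (lookup y b)) b = lookup y b"
    by (simp add: lookup_sum lookup_single when_def)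
qed

lemma dp_mult_hom:
  assumes "y \<in> dp_hom r m" "z \<in> dp_hom r n"
  shows "dp_mult y z \<in> dp_hom r (m + n)"
  unfolding dp_mult_def
proof (intro dp_hom_sum)
  fix b c assume "b \<in> keys y" "c \<in> keys z"
  with assms have "keys b \<subseteq> {..<r}" "(\<Sum>j<r. lookup b j) = m"
    "keys c \<subseteq> {..<r}" "(\<Sum>j<r. lookup c j) = n"
    by (auto simp: dp_hom_def)
  moreover have "keys (b + c) \<subseteq> keys b \<union> keys c"
    by (rule Poly_Mapping.keys_add)
  ultimately show "Poly_Mapping.single (b + c) s \<in> dp_hom r (m + n)" for s :: 'a
    by (auto simp: dp_hom_def lookup_add sum.distrib split: if_splits)
qed

lemma dp_shift_single:
  "dp_shift j (Poly_Mapping.single b s) =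
     (if lookup b j = 0 then 0 else Poly_Mapping.single (b - Poly_Mapping.single j 1) s)"
proof (rule poly_mapping_eqI)
  fix d
  have "b = d + Poly_Mapping.single j 1 \<longleftrightarrow> lookup b j \<noteq> 0 \<and> b - Poly_Mapping.single j 1 = d"
    by (auto simp: poly_mapping_eq_iff fun_eq_iff lookup_add lookup_minus lookup_single when_def)
  then show "lookup (dp_shift j (Poly_Mapping.single b s)) d = lookup
      (if lookup b j = 0 then 0 else Poly_Mapping.single (b - Poly_Mapping.single j 1) s) d"
    by (auto simp: lookup_dp_shift lookup_single when_def)
qed

lemma dp_shift_linear: "dp_shift j (y + z) = dp_shift j y + dp_shift j z" "dp_shift j 0 = 0"
  "dp_shift j (pm_scale s y) = pm_scale s (dp_shift j y)"
  by (rule poly_mapping_eqI, simp add: lookup_dp_shift lookup_add lookup_pm_scale)+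

lemma dp_shift_sum: "dp_shift j (sum f S) = (\<Sum>i\<in>S. dp_shift j (f i))"
  by (induction S rule: infinite_finite_induct) (auto simp: dp_shift_linear)

text \<open>
  By Pascal's rule applied to the factor of the product of binomial coefficients that belongs to \<open>j\<close>.
\<close>

lemma dp_shift_mult_single:
  fixes s t :: "'k::field"
  defines "N \<equiv> \<lambda>(b :: nat \<Rightarrow>\<^sub>0 nat) (c :: nat \<Rightarrow>\<^sub>0 nat). \<Prod>i\<in>keys b. (lookup b i + lookup c i) choose lookup b i"
  shows "dp_shift j (dp_mult (Poly_Mapping.single b s) (Poly_Mapping.single c t)) =
    dp_mult (dp_shift j (Poly_Mapping.single b s)) (Poly_Mapping.single c t)
    + dp_mult (Poly_Mapping.single b s) (dp_shift j (Poly_Mapping.single c t))"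
proof -
  define E where "E = Poly_Mapping.single j (1::nat)"
  have E: "lookup E i = (if i = j then 1 else 0)" for i
    by (simp add: E_def lookup_single when_def)
  define R where "R = (\<lambda>(b :: nat \<Rightarrow>\<^sub>0 nat) (c :: nat \<Rightarrow>\<^sub>0 nat).
    \<Prod>i\<in>keys b - {j}. (lookup b i + lookup c i) choose lookup b i)"
  have N: "N b c = (lookup b j + lookup c j choose lookup b j) * R b c" for b c
    by (cases "j \<in> keys b") (auto simp: N_def R_def prod.remove[of _ j] in_keys_iff)
  have kb: "keys (b - E) - {j} = keys b - {j}" for b
    by (auto simp: in_keys_iff lookup_minus E split: if_splits)
  have R1: "R (b - E) c = R b c" for b c
    unfolding R_def kb by (intro prod.cong) (auto simp: lookup_minus E)
  have R2: "R b (c - E) = R b c" for b c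
    unfolding R_def by (intro prod.cong) (auto simp: lookup_minus E)
  have e1: "(b - E) + c = b + c - E" if "lookup b j \<noteq> 0"
    using that by (intro poly_mapping_eqI) (auto simp: lookup_minus lookup_add E)
  have e2: "b + (c - E) = b + c - E" if "lookup c j \<noteq> 0"
    using that by (intro poly_mapping_eqI) (auto simp: lookup_minus lookup_add E)
  have pascal: "(x + y choose x) = (x - 1 + y choose (x - 1)) + (x + (y - 1) choose x)"
    if "x \<noteq> 0" "y \<noteq> 0" for x y :: nat
    using that by (cases x; cases y) (auto simp: add.commute)
  have mult: "dp_mult (Poly_Mapping.single b s) (Poly_Mapping.single c t) =
    Poly_Mapping.single (b + c) (of_nat (N b c) * s * t)" for b c and s t :: 'k
    unfolding N_def by (rule dp_mult_single)
  have shift: "dp_shift j (Poly_Mapping.single b s) =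
    (if lookup b j = 0 then 0 else Poly_Mapping.single (b - E) s)" for b and s :: 'k
    unfolding E_def by (rule dp_shift_single)
  show ?thesis
  proof (cases "lookup b j = 0 \<or> lookup c j = 0")
    case True
    then show ?thesis
      by (auto simp: mult shift lookup_add N R1 R2 e1 e2 lookup_minus E)
  next
    case False
    then have "N (b - E) c + N b (c - E) = N b c"
      by (simp add: N R1 R2 lookup_minus E pascal algebra_simps)
    then have "(of_nat (N b c) :: 'k) = of_nat (N (b - E) c) + of_nat (N b (c - E))"
      by (metis of_nat_add)
    with False show ?thesis
      by (simp add: mult shift lookup_add e1 e2 single_add[symmetric] distrib_right)
  qed
qed

lemma dp_shift_mult: "dp_shift j (dp_mult y z) = dp_mult (dp_shift j y) z + dp_mult y (dp_shift j z)"
proof -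
  have *: "dp_shift j (dp_mult (\<Sum>b\<in>B. Poly_Mapping.single b (f b)) (\<Sum>c\<in>D. Poly_Mapping.single c (h c)))
    = dp_mult (dp_shift j (\<Sum>b\<in>B. Poly_Mapping.single b (f b))) (\<Sum>c\<in>D. Poly_Mapping.single c (h c))
      + dp_mult (\<Sum>b\<in>B. Poly_Mapping.single b (f b)) (dp_shift j (\<Sum>c\<in>D. Poly_Mapping.single c (h c)))"
    for B D f and h :: "_ \<Rightarrow> 'a"
    by (simp add: dp_mult_sum_left dp_mult_sum_right dp_shift_sum dp_shift_mult_single sum.distrib)
  show ?thesis
    using *[of "lookup y" "keys y" "lookup z" "keys z"] by (simp add: sum_singles)
qed

lemma contr_mult: "contr r c (dp_mult y z) = dp_mult (contr r c y) z + dp_mult y (contr r c z)"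
  by (simp add: contr_def dp_shift_mult dp_mult_sum_left dp_mult_sum_right dp_mult_scale_left
      dp_mult_scale_right pm.scale_right_distrib sum.distrib)

lemma dp_mult_one [simp]: "dp_mult (Poly_Mapping.single 0 1) z = z"
  using dp_mult_superset[of "{0}" "Poly_Mapping.single 0 1" "keys z" z] by (simp add: sum_singles)

subsection \<open>Divided powers of a vector\<close>

lemma finite_exponents: "finite {b :: nat \<Rightarrow>\<^sub>0 nat. keys b \<subseteq> {..<r} \<and> (\<Sum>j<r. lookup b j) = n}"
proof -
  let ?S = "{b :: nat \<Rightarrow>\<^sub>0 nat. keys b \<subseteq> {..<r} \<and> (\<Sum>j<r. lookup b j) = n}"
  have "lookup ` ?S \<subseteq> {f. \<forall>x. (x \<in> {..<r} \<longrightarrow> f x \<in> {..n}) \<and> (x \<notin> {..<r} \<longrightarrow> f x = 0)}"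
  proof clarify
    fix b x assume b: "keys b \<subseteq> {..<r}" "n = (\<Sum>j<r. lookup b j)"
    show "(x \<in> {..<r} \<longrightarrow> lookup b x \<in> {..\<Sum>j<r. lookup b j}) \<and> (x \<notin> {..<r} \<longrightarrow> lookup b x = 0)"
      using b member_le_sum[of x "{..<r}" "lookup b"] by (auto simp: in_keys_iff)
  qed
  then have "finite (lookup ` ?S)"
    by (rule finite_subset) (intro finite_set_of_finite_funs; simp)
  then show ?thesis
    by (rule finite_imageD) (auto simp: inj_on_def intro: poly_mapping_eqI)
qed

lemma lookup_dp_power:
  "lookup (dp_power r c q) b =
     (if keys b \<subseteq> {..<r} \<and> (\<Sum>j<r. lookup b j) = q then (\<Prod>j<r. c j ^ lookup b j) else 0)"
  using finite_exponents[of r q]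
  by (auto simp: dp_power_def lookup_sum lookup_single when_def sum.delta)

lemma dp_power_hom: "dp_power r c q \<in> dp_hom r q"
  by (simp add: dp_hom_iff lookup_dp_power)

lemma dp_power_0: "dp_power r c 0 = Poly_Mapping.single 0 1"
proof -
  have "dp_power r c 0 = pm_scale (lookup (dp_power r c 0) 0) (Poly_Mapping.single 0 1)"
    using dp_hom_0_const[OF dp_power_hom] .
  then show ?thesis
    by (simp add: lookup_dp_power)
qed

lemma contr_dp_power:
  "contr r d (dp_power r c (Suc q)) = pm_scale (\<Sum>j<r. d j * c j) (dp_power r c q)"
proof (rule poly_mapping_eqI)
  fix b
  have "(\<Prod>i<r. c i ^ lookup (b + Poly_Mapping.single j 1) i) = c j * (\<Prod>i<r. c i ^ lookup b i)"
    if "j < r" for j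
  proof -
    have "(\<Prod>i<r. c i ^ lookup (b + Poly_Mapping.single j 1) i)
        = (\<Prod>i<r. (if i = j then c j else 1) * c i ^ lookup b i)"
      by (intro prod.cong) (auto simp: lookup_add lookup_single when_def)
    with that show ?thesis
      by (simp add: prod.distrib)
  qed
  then have *: "d j * lookup (dp_power r c (Suc q)) (b + Poly_Mapping.single j 1)
      = d j * c j * lookup (dp_power r c q) b" if "j < r" for j
    using that unfolding lookup_dp_power keys_add_single sum_pm_single[OF that] by simp
  show "lookup (contr r d (dp_power r c (Suc q))) b =
      lookup (pm_scale (\<Sum>j<r. d j * c j) (dp_power r c q)) b"
    unfolding lookup_contr lookup_pm_scale sum_distrib_right by (intro sum.cong) (auto simp: * simp del: One_nat_def)
qed

lemma contr_dp_power_orthogonal: "(\<Sum>j<r. d j * c j) = 0 \<Longrightarrow> contr r d (dp_power r c q) = 0"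
  by (cases q) (auto simp: dp_power_0 contr_dp_power intro: contr_dp_hom_0 simp: dp_hom_def)

section \<open>Maximal minors, dual vectors and divided powers of annihilators\<close>

text \<open>
  The minor on the columns in \<open>J\<close> of the matrix whose column \<open>l\<close> is \<open>m l\<close>.
\<close>

definition minor :: "nat \<Rightarrow> (nat \<Rightarrow> nat \<Rightarrow> 'k::field) \<Rightarrow> nat set \<Rightarrow> 'k" where
  "minor r m J = det (mat r r (\<lambda>(j, k). m (sorted_list_of_set J ! k) j))"

lemma sorted_list_of_set_remove_nth:
  assumes "finite J" "card J = Suc r" "k < Suc r" "i < r"
  shows "sorted_list_of_set (J - {sorted_list_of_set J ! k}) ! i =
    sorted_list_of_set J ! (if i < k then i else Suc i)"
proof -
  let ?xs = "sorted_list_of_set J"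
  have len: "length ?xs = Suc r" and d: "distinct ?xs"
    using assms by auto
  have split: "?xs = take k ?xs @ ?xs ! k # drop (Suc k) ?xs"
    using assms len by (simp add: id_take_nth_drop)
  have "?xs ! k \<notin> set (take k ?xs)"
    using d split by (metis distinct_append not_distinct_conv_prefix)
  then have "remove1 (?xs ! k) ?xs = take k ?xs @ drop (Suc k) ?xs"
    by (subst (2) split) (simp add: remove1_append)
  moreover have "sorted_list_of_set (J - {?xs ! k}) = remove1 (?xs ! k) ?xs"
    using assms(1) by (rule sorted_list_of_set_remove)
  ultimately show ?thesis
    using assms len by (simp add: nth_append min_def)
qed

lemma face_sgn_nth:
  assumes "finite J" "k < card J"
  shows "face_sgn (sorted_list_of_set J ! k) J = (- 1) ^ k"
proof -
  let ?xs = "sorted_list_of_set J"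
  have s: "sorted_wrt (<) ?xs" and len: "length ?xs = card J"
    using assms by auto
  have "{x \<in> J. x < ?xs ! k} = (\<lambda>i. ?xs ! i) ` {..<k}"
  proof (intro equalityI subsetI)
    fix x assume "x \<in> {x \<in> J. x < ?xs ! k}"
    then obtain i where i: "i < card J" "x = ?xs ! i" "?xs ! i < ?xs ! k"
      using assms(1) len by (metis (mono_tags, lifting) in_set_conv_nth mem_Collect_eq set_sorted_list_of_set)
    then have "i < k"
      using s len by (metis (no_types) assms(2) linorder_neqE_nat order_less_asym sorted_wrt_nth_less)
    then show "x \<in> (\<lambda>i. ?xs ! i) ` {..<k}"
      using i by auto
  next
    fix x assume "x \<in> (\<lambda>i. ?xs ! i) ` {..<k}"
    then obtain i where "i < k" "x = ?xs ! i"
      by auto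
    then show "x \<in> {x \<in> J. x < ?xs ! k}"
      using s len assms by (auto simp: sorted_wrt_iff_nth_less) (metis len nth_mem order_less_trans set_sorted_list_of_set)
  qed
  moreover have "inj_on (\<lambda>i. ?xs ! i) {..<k}"
    using assms len by (auto simp: inj_on_def nth_eq_iff_index_eq)
  ultimately show ?thesis
    by (simp add: face_sgn_def card_image)
qed

lemma sum_sorted_list_nth:
  assumes "finite J"
  shows "(\<Sum>l\<in>J. f l) = (\<Sum>k<card J. f (sorted_list_of_set J ! k))"
proof -
  have "bij_betw (\<lambda>k. sorted_list_of_set J ! k) {..<card J} J"
    using assms by (intro bij_betw_nth) auto
  then show ?thesis
    by (simp add: sum.reindex_bij_betw)
qed

text \<open>
  The left side is the Laplace expansion of a determinant of size \<open>r + 1\<close> in which the row \<open>j\<close> occurs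
  twice.
\<close>

lemma cramer_relation:
  fixes m :: "nat \<Rightarrow> nat \<Rightarrow> 'k::field"
  assumes J: "finite J" "card J = Suc r" and j: "j < r"
  shows "(\<Sum>l\<in>J. face_sgn l J * minor r m (J - {l}) * m l j) = 0"
proof -
  let ?xs = "sorted_list_of_set J"
  \<comment> \<open>The row \<open>j\<close> is put in front of all rows.\<close>
  define M where "M = mat (Suc r) (Suc r) (\<lambda>(i, k). if i = 0 then m (?xs ! k) j else m (?xs ! k) (i - 1))"
  have M: "M \<in> carrier_mat (Suc r) (Suc r)"
    by (simp add: M_def)
  have "det M = 0"
  proof (rule Determinant.det_identical_rows[OF M])
    show "0 \<noteq> Suc j" "0 < Suc r" "Suc j < Suc r"
      using j by auto
    show "row M 0 = row M (Suc j)"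
      using j by (intro eq_vecI) (auto simp: M_def)
  qed
  moreover have "det M = (\<Sum>k<Suc r. M $$ (0, k) * cofactor M 0 k)"
    by (rule laplace_expansion_row[OF M]) simp
  moreover have "M $$ (0, k) * cofactor M 0 k
      = face_sgn (?xs ! k) J * minor r m (J - {?xs ! k}) * m (?xs ! k) j" if k: "k < Suc r" for k
  proof -
    have "mat_delete M 0 k = mat r r (\<lambda>(i, c). m (sorted_list_of_set (J - {?xs ! k}) ! c) i)"
      using k by (intro eq_matI)
        (auto simp: M_def mat_delete_def sorted_list_of_set_remove_nth[OF J k])
    then show ?thesis
      using k J by (simp add: cofactor_def minor_def face_sgn_nth M_def)
  qed
  ultimately show ?thesis
    unfolding sum_sorted_list_nth[OF J(1)] J(2) by simp
qed

text \<open>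
  In the application \<open>m l j\<close> is \<open>\<upsilon>\<^sub>j(s(\<epsilon>\<^sub>l))\<close>, so that the vectors \<open>m l\<close> are the \<open>s(\<epsilon>\<^sub>l)\<close> in coordinates.
  Nonvanishing of the maximal minors is the form in which uniform rank is used.
\<close>

locale uniform_columns =
  fixes e r :: nat and m :: "nat \<Rightarrow> nat \<Rightarrow> 'k::field"
  assumes rank_le: "r \<le> e"
    and minors: "\<And>J. J \<subseteq> {..<e} \<Longrightarrow> card J = r \<Longrightarrow> minor r m J \<noteq> 0"
begin

text \<open>
  The part of \<open>kill Q\<close> in each \<open>D\<^sub>n V\<^sup>*\<close> is the divided power of the annihilator of the \<open>s(\<epsilon>\<^sub>l)\<close>,
  \<open>l \<in> Q\<close> (see \<open>dpow_eq_kill\<close>). As a common kernel of commuting operators it is easier to handle.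
\<close>

definition kill :: "nat set \<Rightarrow> ((nat \<Rightarrow>\<^sub>0 nat) \<Rightarrow>\<^sub>0 'k) set" where
  "kill Q = {y. \<forall>l\<in>Q. contr r (m l) y = 0}"

lemma extend_face:
  assumes "Q \<subseteq> {..<e}" "card Q \<le> r"
  obtains P where "Q \<subseteq> P" "P \<subseteq> {..<e}" "card P = r"
proof -
  have fin: "finite Q"
    using assms(1) finite_subset by blast
  then have "r - card Q \<le> card ({..<e} - Q)"
    using assms rank_le by (simp add: card_Diff_subset diff_le_mono)
  then obtain S where S: "S \<subseteq> {..<e} - Q" "card S = r - card Q" "finite S"
    by (rule obtain_subset_with_card_n)
  then have "card (Q \<union> S) = r"
    using fin assms(2) by (subst card_Un_disjoint) auto
  with S assms(1) show thesis
    by (intro that[of "Q \<union> S"]) auto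
qed

text \<open>
  The \<open>w\<close> are the rows of the inverse of the square matrix with columns in \<open>P\<close>; the two equations
  say that it is a left and a right inverse.
\<close>

lemma dual_vectors:
  assumes P: "P \<subseteq> {..<e}" "card P = r"
  obtains w :: "nat \<Rightarrow> nat \<Rightarrow> 'k"
  where "\<And>p q. p \<in> P \<Longrightarrow> q \<in> P \<Longrightarrow> (\<Sum>j<r. m p j * w q j) = (if p = q then 1 else 0)"
    and "\<And>i j. i < r \<Longrightarrow> j < r \<Longrightarrow> (\<Sum>p\<in>P. m p j * w p i) = (if i = j then 1 else 0)"
proof -
  let ?xs = "sorted_list_of_set P"
  define M where "M = mat r r (\<lambda>(j, k). m (?xs ! k) j)"
  have M: "M \<in> carrier_mat r r" and "det M \<noteq> 0"
    using minors[OF P] by (auto simp: M_def minor_def)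
  then have "M \<in> Units (ring_mat TYPE('k) r ())"
    by (rule det_non_zero_imp_unit)
  then obtain N where N: "N \<in> carrier_mat r r" "N * M = 1\<^sub>m r" "M * N = 1\<^sub>m r"
    by (auto simp: Units_def ring_mat_def)
  have fin: "finite P"
    using P finite_subset by blast
  have bij: "bij_betw (\<lambda>k. ?xs ! k) {..<r} P"
    using fin P(2) by (intro bij_betw_nth) auto
  define ix where "ix = the_inv_into {..<r} (\<lambda>k. ?xs ! k)"
  have ix: "ix (?xs ! k) = k" if "k < r" for k
    using bij that unfolding ix_def bij_betw_def by (intro the_inv_into_f_f) auto
  define w where "w = (\<lambda>p j. N $$ (ix p, j))"
  show thesis
  proof
    fix p q assume "p \<in> P" "q \<in> P"
    then obtain k l where kl: "k < r" "l < r" "p = ?xs ! k" "q = ?xs ! l"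
      using bij unfolding bij_betw_def by (metis imageE lessThan_iff)
    have "(N * M) $$ (l, k) = (\<Sum>j<r. N $$ (l, j) * M $$ (j, k))"
      using N(1) M kl by (simp add: scalar_prod_def atLeast0LessThan)
    moreover have "p = q \<longleftrightarrow> k = l"
      using kl ix by metis
    moreover have "(\<Sum>j<r. m p j * w q j) = (\<Sum>j<r. N $$ (l, j) * M $$ (j, k))"
      using kl ix by (simp add: w_def M_def mult.commute)
    ultimately show "(\<Sum>j<r. m p j * w q j) = (if p = q then 1 else 0)"
      using N(2) kl by (auto split: if_splits)
  next
    fix i j assume ij: "i < r" "j < r"
    have "(M * N) $$ (j, i) = (\<Sum>k<r. M $$ (j, k) * N $$ (k, i))"
      using N(1) M ij by (simp add: scalar_prod_def atLeast0LessThan)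
    moreover have "(\<Sum>p\<in>P. m p j * w p i) = (\<Sum>k<r. m (?xs ! k) j * w (?xs ! k) i)"
      using bij by (rule sum.reindex_bij_betw[symmetric])
    moreover have "\<dots> = (\<Sum>k<r. M $$ (j, k) * N $$ (k, i))"
      using ij ix by (simp add: w_def M_def)
    ultimately show "(\<Sum>p\<in>P. m p j * w p i) = (if i = j then 1 else 0)"
      using N(3) ij by (auto split: if_splits)
  qed
qed

lemma columns_independent:
  assumes P: "P \<subseteq> {..<e}" "card P \<le> r" and u: "\<And>j. j < r \<Longrightarrow> (\<Sum>p\<in>P. u p * m p j) = 0"
    and p: "p \<in> P"
  shows "u p = 0"
proof -
  obtain P' where P': "P \<subseteq> P'" "P' \<subseteq> {..<e}" "card P' = r"
    using extend_face P by metis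
  obtain w where w: "\<And>p q. p \<in> P' \<Longrightarrow> q \<in> P' \<Longrightarrow> (\<Sum>j<r. m p j * w q j) = (if p = q then 1 else 0)"
    using dual_vectors[OF P'(2,3)] by metis
  have "0 = (\<Sum>j<r. (\<Sum>q\<in>P. u q * m q j) * w p j)"
    using u by simp
  also have "\<dots> = (\<Sum>q\<in>P. u q * (\<Sum>j<r. m q j * w p j))"
    unfolding sum_distrib_left sum_distrib_right by (subst sum.swap) (simp add: mult_ac)
  also have "\<dots> = (\<Sum>q\<in>P. if q = p then u q else 0)"
    using P'(1) p by (intro sum.cong) (simp_all add: w subsetD)
  also have "\<dots> = u p"
    using p P finite_subset[OF P(1)] by simp
  finally show ?thesis by simp
qed

lemma columns_span:
  assumes P: "P \<subseteq> {..<e}" "card P = r"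
  obtains a where "\<And>j. j < r \<Longrightarrow> x j = (\<Sum>p\<in>P. a p * m p j)"
proof -
  obtain w where w: "\<And>i j. i < r \<Longrightarrow> j < r \<Longrightarrow> (\<Sum>p\<in>P. m p j * w p i) = (if i = j then 1 else 0)"
    using dual_vectors[OF P] by metis
  have "x j = (\<Sum>p\<in>P. (\<Sum>i<r. x i * w p i) * m p j)" if "j < r" for j
  proof -
    have "(\<Sum>p\<in>P. (\<Sum>i<r. x i * w p i) * m p j) = (\<Sum>i<r. x i * (\<Sum>p\<in>P. m p j * w p i))"
      unfolding sum_distrib_left sum_distrib_right by (subst sum.swap) (simp add: mult_ac)
    also have "\<dots> = (\<Sum>i<r. if i = j then x i else 0)"
      using w that by (intro sum.cong) auto
    finally show ?thesis
      using that by simp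
  qed
  then show thesis
    using that[of "\<lambda>p. \<Sum>i<r. x i * w p i"] by blast
qed

text \<open>
  The columns in \<open>P\<close> span, so contractions with them determine all contractions.
\<close>

lemma kill_all:
  assumes P: "P \<subseteq> {..<e}" "card P = r" and y: "y \<in> dp_hom r (Suc n)" "y \<in> kill P"
  shows "y = 0"
proof (rule dp_hom_eq_0I[OF y(1)])
  fix j assume j: "j < r"
  obtain a where a: "\<And>i. i < r \<Longrightarrow> (if i = j then 1 else 0) = (\<Sum>p\<in>P. a p * m p i)"
    using columns_span[OF P, of "\<lambda>i. if i = j then 1 else 0"] by blast
  have "dp_shift j y = contr r (\<lambda>i. if i = j then 1 else 0) y"
    using j by (intro poly_mapping_eqI) (simp add: lookup_contr lookup_dp_shift if_distrib[of "\<lambda>t. t * _"] cong: if_cong)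
  also have "\<dots> = contr r (\<lambda>i. \<Sum>p\<in>P. a p * m p i) y"
    using a by (rule contr_cong)
  also have "\<dots> = 0"
    using y(2) by (simp add: contr_lincomb kill_def)
  finally show "dp_shift j y = 0" .
qed

lemma kill_contr: "y \<in> kill Q \<Longrightarrow> contr r c y \<in> kill Q"
  by (simp add: kill_def contr_commute[of r _ c])

lemma kill_diff: "y \<in> kill Q \<Longrightarrow> z \<in> kill Q \<Longrightarrow> y - z \<in> kill Q"
  by (simp add: kill_def contr_diff)

lemma kill_mult_power:
  assumes "\<And>q. q \<in> Q \<Longrightarrow> (\<Sum>j<r. m q j * w j) = 0" "z \<in> kill Q"
  shows "dp_mult (dp_power r w i) z \<in> kill Q"
  using assms by (simp add: kill_def contr_mult contr_dp_power_orthogonal)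

text \<open>
  Integration by parts: \<open>w\<^bsup>(q+1)\<^esup> z\<close> has the derivative \<open>w\<^sup>(\<^sup>q\<^sup>) z + w\<^bsup>(q+1)\<^esup> z'\<close>, where \<open>z'\<close> is the
  derivative of \<open>z\<close> and has lower degree. The induction thus needs all \<open>q\<close> at once. The family \<open>T\<close>
  records that the antiderivative is built from the given elements by multiplication with divided powers
  of \<open>w\<close>, which is what the proof of \<open>dpow_eq_kill\<close> needs.
\<close>

lemma antiderivative_aux:
  assumes w: "(\<Sum>j<r. m p j * w j) = 1" "\<And>q. q \<in> Q \<Longrightarrow> (\<Sum>j<r. m q j * w j) = 0"
    and T: "\<And>i. i \<le> n \<Longrightarrow> dp_hom r i \<inter> kill Q \<subseteq> T i"
      "\<And>i q t. t \<in> T i \<Longrightarrow> dp_mult (dp_power r w q) t \<in> T (q + i)"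
      "\<And>i t t'. t \<in> T i \<Longrightarrow> t' \<in> T i \<Longrightarrow> t - t' \<in> T i"
    and z: "z \<in> dp_hom r n \<inter> kill Q"
  shows "\<exists>y\<in>dp_hom r (Suc (q + n)) \<inter> kill Q \<inter> T (Suc (q + n)).
    contr r (m p) y = dp_mult (dp_power r w q) z"
  using T(1) z
proof (induction n arbitrary: z q)
  case 0
  let ?y = "dp_mult (dp_power r w (Suc q)) z"
  have "?y \<in> dp_hom r (Suc (q + 0)) \<inter> kill Q \<inter> T (Suc (q + 0))"
    using dp_mult_hom[OF dp_power_hom, of z r 0 w "Suc q"] 0 T(2)[of z 0 "Suc q"]
      kill_mult_power[OF w(2), where z = z]
    by auto
  moreover have "contr r (m p) ?y = dp_mult (dp_power r w q) z"
    using 0 by (simp add: contr_mult contr_dp_power w(1) contr_dp_hom_0)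
  ultimately show ?case by blast
next
  case (Suc n)
  let ?y = "dp_mult (dp_power r w (Suc q)) z"
  have "contr r (m p) z \<in> dp_hom r n \<inter> kill Q"
    using Suc.prems by (auto intro: dp_hom_contr kill_contr)
  then obtain y where y: "y \<in> dp_hom r (Suc (Suc q + n)) \<inter> kill Q \<inter> T (Suc (Suc q + n))"
    "contr r (m p) y = dp_mult (dp_power r w (Suc q)) (contr r (m p) z)"
    using Suc.IH[of "contr r (m p) z" "Suc q"] Suc.prems(1) by auto
  have "z \<in> T (Suc n)"
    using Suc.prems by auto
  then have "?y \<in> dp_hom r (Suc (Suc q + n)) \<inter> kill Q \<inter> T (Suc (Suc q + n))"
    using dp_mult_hom[OF dp_power_hom, of z r "Suc n" w "Suc q"] Suc.prems T(2)[of z "Suc n" "Suc q"]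
      kill_mult_power[OF w(2), where z = z]
    by auto
  with y(1) have "?y - y \<in> dp_hom r (Suc (q + Suc n)) \<inter> kill Q \<inter> T (Suc (q + Suc n))"
    by (auto intro: dp_hom_diff kill_diff T(3))
  moreover have "contr r (m p) (?y - y) = dp_mult (dp_power r w q) z"
    by (simp add: contr_diff y(2) contr_mult contr_dp_power w(1))
  ultimately show ?case by blast
qed

text \<open>Contractions with independent vectors form a coregular sequence.\<close>

lemma antiderivative:
  assumes Q: "insert p Q \<subseteq> {..<e}" "card (insert p Q) \<le> r" "p \<notin> Q"
    and z: "z \<in> dp_hom r n" "z \<in> kill Q"
  obtains y where "y \<in> dp_hom r (Suc n)" "y \<in> kill Q" "contr r (m p) y = z"
proof -
  obtain P where P: "insert p Q \<subseteq> P" "P \<subseteq> {..<e}" "card P = r"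
    using extend_face Q by metis
  obtain w where w: "\<And>p q. p \<in> P \<Longrightarrow> q \<in> P \<Longrightarrow> (\<Sum>j<r. m p j * w q j) = (if p = q then 1 else 0)"
    using dual_vectors[OF P(2,3)] by metis
  have "\<exists>y\<in>dp_hom r (Suc (0 + n)) \<inter> kill Q \<inter> UNIV. contr r (m p) y = dp_mult (dp_power r (w p) 0) z"
    using w P Q(3) z by (intro antiderivative_aux[where T = "\<lambda>_. UNIV"]) auto
  then show thesis
    using that by (auto simp: dp_power_0 simp del: single_one)
qed

text \<open>
  Products of divided powers of elements of \<open>K\<close> are killed by the derivation rule. Conversely, extend
  the columns in \<open>X\<close> to a basis and proceed by induction on the number of basis vectors that
  remain: an element and the antiderivative of its contraction with such a vector differ by an element of
  a smaller common kernel.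
\<close>

lemma dpow_eq_kill:
  assumes r: "mat_rank C = r" and X: "X \<subseteq> {..<e}"
    and K: "\<And>c. (\<lambda>v. \<Sum>j<r. c j * \<upsilon> j v) \<in> K \<longleftrightarrow> (\<forall>l\<in>X. (\<Sum>j<r. m l j * c j) = 0)"
  shows "dpow C \<upsilon> n K = dp_hom r n \<inter> kill X"
proof
  define gen where "gen = (\<lambda>n. {foldr (\<lambda>(c, q). dp_mult (dp_power (mat_rank C) c q)) ws
      (Poly_Mapping.single 0 (1::'k)) | ws.
        (\<forall>(c, q)\<in>set ws. (\<lambda>v. \<Sum>j<mat_rank C. c j * \<upsilon> j v) \<in> K) \<and> sum_list (map snd ws) = n})"
  have dpow: "dpow C \<upsilon> n K = pm.span (gen n)" for n
    by (simp add: dpow_def gen_def)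
  have gen: "gen n \<subseteq> dp_hom r n \<inter> kill X" for n
  proof
    fix y assume "y \<in> gen n"
    then obtain ws where ws: "\<forall>(c, q)\<in>set ws. (\<lambda>v. \<Sum>j<r. c j * \<upsilon> j v) \<in> K"
      "sum_list (map snd ws) = n"
      "y = foldr (\<lambda>(c, q). dp_mult (dp_power r c q)) ws (Poly_Mapping.single 0 1)"
      unfolding gen_def r by blast
    show "y \<in> dp_hom r n \<inter> kill X"
      using ws
    proof (induction ws arbitrary: n y)
      case Nil
      have "Poly_Mapping.single 0 (1::'k) \<in> dp_hom r 0"
        by (metis dp_power_0 dp_power_hom)
      with Nil show ?case
        by (auto simp: kill_def intro: contr_dp_hom_0)
    next
      case (Cons cq ws)
      obtain c q where cq: "cq = (c, q)" by force
      let ?z = "foldr (\<lambda>(c, q). dp_mult (dp_power r c q)) ws (Poly_Mapping.single 0 1)"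
      have "?z \<in> dp_hom r (sum_list (map snd ws)) \<inter> kill X"
        using Cons by auto
      moreover have "(\<Sum>j<r. m l j * c j) = 0" if "l \<in> X" for l
        using Cons.prems(1) K that cq by auto
      ultimately show ?case
        using Cons.prems cq dp_mult_hom[OF dp_power_hom] kill_mult_power[of X c ?z q]
        by auto
    qed
  qed
  show "dpow C \<upsilon> n K \<subseteq> dp_hom r n \<inter> kill X"
    unfolding dpow
  proof (rule pm.span_minimal[OF gen])
    show "pm.subspace (dp_hom r n \<inter> kill X)"
      by (auto simp: pm.subspace_def dp_hom_add dp_hom_scale kill_def contr_add contr_scale)
  qed
  have closed: "dp_mult (dp_power r w q) t \<in> dpow C \<upsilon> (q + i) K"
    if w: "(\<lambda>v. \<Sum>j<r. w j * \<upsilon> j v) \<in> K" and t: "t \<in> dpow C \<upsilon> i K" for w q t i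
  proof -
    have "t \<in> pm.span (gen i)"
      using t dpow by simp
    then show ?thesis
    proof (induction rule: pm.span_induct_alt)
      case base
      then show ?case by (simp add: dpow pm.span_zero)
    next
      case (step s y z)
      from step(1) obtain ws where ws: "\<forall>(c, q)\<in>set ws. (\<lambda>v. \<Sum>j<r. c j * \<upsilon> j v) \<in> K"
        "sum_list (map snd ws) = i"
        "y = foldr (\<lambda>(c, q). dp_mult (dp_power r c q)) ws (Poly_Mapping.single 0 1)"
        unfolding gen_def r by blast
      have "dp_mult (dp_power r w q) y \<in> gen (q + i)"
        unfolding gen_def r using ws w by (intro CollectI exI[of _ "(w, q) # ws"]) auto
      then show ?case
        using step(2) unfolding dpow dp_mult_add_right dp_mult_scale_right
        by (intro pm.span_add pm.span_scale pm.span_base[of "dp_mult _ y"])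
    qed
  qed
  have base: "dp_hom r n \<inter> kill P \<subseteq> dpow C \<upsilon> n K" if P: "P \<subseteq> {..<e}" "card P = r" for P n
  proof
    fix y assume y: "y \<in> dp_hom r n \<inter> kill P"
    have "Poly_Mapping.single 0 1 \<in> gen 0"
      unfolding gen_def by (intro CollectI exI[of _ "[]"]) auto
    show "y \<in> dpow C \<upsilon> n K"
    proof (cases n)
      case 0
      then have "y = pm_scale (lookup y 0) (Poly_Mapping.single 0 1)"
        using y by (intro dp_hom_0_const[of y r]) simp
      with 0 show ?thesis
        unfolding dpow using \<open>Poly_Mapping.single 0 1 \<in> gen 0\<close>
        by (metis pm.span_base pm.span_scale)
    next
      case (Suc n')
      then have "y = 0"
        using kill_all[OF P] y by blast
      then show ?thesis
        by (simp add: dpow pm.span_zero)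
    qed
  qed
  show "dp_hom r n \<inter> kill X \<subseteq> dpow C \<upsilon> n K"
  proof (cases "card X \<le> r")
    case False
    then obtain P where P: "P \<subseteq> X" "card P = r"
      by (meson nle_le obtain_subset_with_card_n)
    then have "kill X \<subseteq> kill P"
      by (auto simp: kill_def)
    with base[of P n] P X show ?thesis by blast
  next
    case True
    obtain P where P: "X \<subseteq> P" "P \<subseteq> {..<e}" "card P = r"
      using extend_face[OF X True] by metis
    have fP: "finite P"
      using P(2) finite_subset by blast
    obtain w where w: "\<And>p q. p \<in> P \<Longrightarrow> q \<in> P \<Longrightarrow> (\<Sum>j<r. m p j * w q j) = (if p = q then 1 else 0)"
      using dual_vectors[OF P(2,3)] by metis
    have "dp_hom r n \<inter> kill Q \<subseteq> dpow C \<upsilon> n K" if "X \<subseteq> Q" "Q \<subseteq> P" for Q n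
      using that
    proof (induction "card (P - Q)" arbitrary: Q n)
      case 0
      then have "Q = P"
        using fP by auto
      then show ?case
        using base P by simp
    next
      case (Suc k)
      then obtain p where p: "p \<in> P - Q"
        by (metis card.empty ex_in_conv nat.distinct(1))
      have IH: "dp_hom r n \<inter> kill (insert p Q) \<subseteq> dpow C \<upsilon> n K" for n
      proof (rule Suc.hyps(1))
        show "k = card (P - insert p Q)"
          unfolding Diff_insert[of P p Q] card_Diff_singleton[OF p] Suc.hyps(2)[symmetric] by (rule diff_Suc_1[symmetric])
      qed (use Suc.prems p in auto)
      have wK: "(\<lambda>v. \<Sum>j<r. w p j * \<upsilon> j v) \<in> K"
        unfolding K
      proof
        fix l assume "l \<in> X"
        then have "l \<in> P" "l \<noteq> p"
          using Suc.prems p by auto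
        then show "(\<Sum>j<r. m l j * w p j) = 0"
          using w p by simp
      qed
      show ?case
      proof (induction n rule: less_induct)
        case (less n)
        show ?case
        proof
          fix y assume y: "y \<in> dp_hom r n \<inter> kill Q"
          show "y \<in> dpow C \<upsilon> n K"
          proof (cases n)
            case 0
            then have "y \<in> kill P"
              using y by (auto simp: kill_def intro: contr_dp_hom_0)
            then show ?thesis
              using base P(2,3) y by blast
          next
            case (Suc n')
            \<comment> \<open>The inner induction hypothesis covers the contraction of \<open>y\<close>, which has lower degree.\<close>
            have "\<exists>y'\<in>dp_hom r (Suc (0 + n')) \<inter> kill Q \<inter> dpow C \<upsilon> (Suc (0 + n')) K.
              contr r (m p) y' = dp_mult (dp_power r (w p) 0) (contr r (m p) y)"
            proof (rule antiderivative_aux)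
              show "(\<Sum>j<r. m p j * w p j) = 1"
                using w p by auto
              show "(\<Sum>j<r. m q j * w p j) = 0" if "q \<in> Q" for q
                using w p that Suc.prems by auto
              show "dp_hom r i \<inter> kill Q \<subseteq> dpow C \<upsilon> i K" if "i \<le> n'" for i
                using less Suc that by auto
              show "contr r (m p) y \<in> dp_hom r n' \<inter> kill Q"
                using y Suc by (auto intro: dp_hom_contr kill_contr)
              show "t - t' \<in> dpow C \<upsilon> i K" if "t \<in> dpow C \<upsilon> i K" "t' \<in> dpow C \<upsilon> i K" for i t t'
                using that by (auto simp: dpow intro: pm.span_diff)
            qed (rule closed[OF wK])
            then obtain y' where y': "y' \<in> dp_hom r n \<inter> kill Q \<inter> dpow C \<upsilon> n K"
              "contr r (m p) y' = contr r (m p) y"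
              using Suc by (auto simp: dp_power_0 simp del: single_one)
            have "y - y' \<in> dp_hom r n \<inter> kill (insert p Q)"
              using y y' by (auto simp: kill_def contr_diff intro: dp_hom_diff)
            then have "y - y' \<in> dpow C \<upsilon> n K"
              using IH by blast
            then have "(y - y') + y' \<in> dpow C \<upsilon> n K"
              using y' unfolding dpow by (intro pm.span_add) auto
            then show ?thesis by simp
          qed
        qed
      qed
    qed
    then show ?thesis
      using P(1) by blast
  qed
qed

end

section \<open>The Koszul and the Buchsbaum--Rim complex\<close>

lemma face_sgn_square [simp]: "face_sgn l J * (face_sgn l J * x) = (x :: 'k::comm_ring_1)"
  "face_sgn l J * face_sgn l J = (1 :: 'k::comm_ring_1)"
proof -
  show "face_sgn l J * face_sgn l J = (1 :: 'k)"
    unfolding face_sgn_def power_add[symmetric] by simp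
  then show "face_sgn l J * (face_sgn l J * x) = (x :: 'k)"
    by (metis mult.assoc mult_1)
qed

lemma face_sgn_nonzero: "face_sgn l J \<noteq> (0 :: 'k::field)"
  by (simp add: face_sgn_def)

lemma face_sgn_insert_self [simp]: "face_sgn l (insert l J) = face_sgn l J"
proof -
  have "{k \<in> insert l J. k < l} = {k \<in> J. k < l}"
    by auto
  then show ?thesis
    by (simp add: face_sgn_def)
qed

lemma face_sgn_remove_self [simp]: "face_sgn l (J - {l}) = face_sgn l J"
proof -
  have "{k \<in> J - {l}. k < l} = {k \<in> J. k < l}"
    by auto
  then show ?thesis
    by (simp add: face_sgn_def)
qed

lemma face_sgn_insert:
  assumes "k \<notin> J"
  shows "face_sgn l (insert k J) = (if k < l then - face_sgn l J else face_sgn l J)"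
proof (cases "k < l")
  case True
  then have "{i \<in> insert k J. i < l} = insert k {i \<in> J. i < l}"
    by auto
  moreover have "finite {i \<in> J. i < l}"
    by (rule finite_subset[of _ "{..<l}"]) auto
  ultimately show ?thesis
    using assms True by (simp add: face_sgn_def)
next
  case False
  then have "{i \<in> insert k J. i < l} = {i \<in> J. i < l}"
    by auto
  with False show ?thesis
    by (simp add: face_sgn_def)
qed

lemma face_sgn_swap:
  assumes "k \<notin> J" "l \<notin> J" "k \<noteq> l"
  shows "face_sgn l J * face_sgn k (insert l J) = - (face_sgn k J * face_sgn l (insert k J) :: 'k::comm_ring_1)"
  using assms by (auto simp: face_sgn_insert mult.commute)

text \<open>
  The terms are cancelled in pairs, since twice the sum being zero says nothing in characteristic 2.
\<close>

lemma antisymmetric_sum: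
  fixes f :: "'a \<Rightarrow> 'a \<Rightarrow> 'b::ab_group_add"
  assumes "finite Y" "\<And>k l. k \<in> Y \<Longrightarrow> l \<in> Y \<Longrightarrow> k \<noteq> l \<Longrightarrow> f k l = - f l k"
  shows "(\<Sum>k\<in>Y. \<Sum>l\<in>Y - {k}. f k l) = 0"
  using assms
proof (induction Y)
  case (insert a Y)
  have "(\<Sum>l\<in>insert a Y - {k}. f k l) = f k a + (\<Sum>l\<in>Y - {k}. f k l)" if "k \<in> Y" for k
  proof -
    have "insert a Y - {k} = insert a (Y - {k})"
      using insert.hyps that by auto
    with insert.hyps show ?thesis by simp
  qed
  then have "(\<Sum>k\<in>Y. \<Sum>l\<in>insert a Y - {k}. f k l) = (\<Sum>k\<in>Y. f k a) + (\<Sum>k\<in>Y. \<Sum>l\<in>Y - {k}. f k l)"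
    by (simp add: sum.distrib)
  moreover have "(\<Sum>k\<in>Y. f k a) = (\<Sum>k\<in>Y. - f a k)"
    using insert.hyps by (intro sum.cong refl insert.prems) auto
  moreover have "insert a Y - {a} = Y"
    using insert.hyps by auto
  moreover have "(\<Sum>k\<in>Y. \<Sum>l\<in>Y - {k}. f k l) = 0"
    by (intro insert.IH insert.prems) auto
  ultimately show ?case
    using insert.hyps by (simp add: sum_negf)
qed simp

text \<open>
  Both sides sum over the pairs \<open>l \<in> K\<close>, where \<open>J = K \<setminus> l\<close>.
\<close>

lemma sum_flags:
  assumes "finite Z"
  shows "(\<Sum>J | J \<subseteq> Z \<and> card J = q. \<Sum>l\<in>Z - J. h l (insert l J)) =
    (\<Sum>K | K \<subseteq> Z \<and> card K = Suc q. \<Sum>l\<in>K. h l K)"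
proof -
  have fin: "finite {J. J \<subseteq> Z \<and> card J = n}" "finite (Z - J)" "J \<subseteq> Z \<Longrightarrow> finite J" for J n
    using assms by (auto intro: finite_subset)
  have "(\<Sum>(J, l)\<in>(SIGMA J:{J. J \<subseteq> Z \<and> card J = q}. Z - J). h l (insert l J)) =
    (\<Sum>(K, l)\<in>(SIGMA K:{K. K \<subseteq> Z \<and> card K = Suc q}. K). h l K)"
    by (rule sum.reindex_bij_witness[where i = "\<lambda>(K, l). (K - {l}, l)" and j = "\<lambda>(J, l). (insert l J, l)"])
      (auto simp: fin)
  then show ?thesis
    using fin by (simp add: sum.Sigma)
qed

lemma lookup_sum_scaled: "lookup (\<Sum>i\<in>S. pm_scale (a i) (y i)) b = (\<Sum>i\<in>S. a i * lookup (y i) b)"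
  by (simp add: lookup_sum lookup_pm_scale)

context uniform_columns
begin

text \<open>
  The differential of \<open>D V\<^sup>* \<otimes> \<Lambda> U\<^sub>X\<close>. A chain \<open>\<Sum>\<^sub>I z\<^sub>I \<otimes> \<epsilon>\<^sub>I\<close> is a function of \<open>I\<close>, and the value of
  its boundary at \<open>J\<close> collects the contributions of the sets that arise from \<open>J\<close> by adding an element
  of \<open>X\<close>. For \<open>X\<close> smaller than the set of all vertices this is the differential of a subquotient, in
  which a set becomes zero when a vertex outside of \<open>X\<close> is removed.
\<close>

definition koszul :: "nat set \<Rightarrow> (nat set \<Rightarrow> ((nat \<Rightarrow>\<^sub>0 nat) \<Rightarrow>\<^sub>0 'k)) \<Rightarrow> nat set \<Rightarrow> ((nat \<Rightarrow>\<^sub>0 nat) \<Rightarrow>\<^sub>0 'k)" where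
  "koszul X z J = (\<Sum>l\<in>X - J. pm_scale (face_sgn l J) (contr r (m l) (z (insert l J))))"

text \<open>
  The numbers \<open>q\<close> of vertices and \<open>n\<close> of divided power factors are independent: the Koszul complex does
  not link them, while the Buchsbaum--Rim complex has \<open>q = n + r + 1\<close>.
\<close>

definition chain :: "nat set \<Rightarrow> nat set \<Rightarrow> nat \<Rightarrow> nat \<Rightarrow> (nat set \<Rightarrow> ((nat \<Rightarrow>\<^sub>0 nat) \<Rightarrow>\<^sub>0 'k)) set" where
  "chain M X q n = {z. \<forall>J. z J \<in> dp_hom r n \<and> (z J \<noteq> 0 \<longrightarrow> M \<subseteq> J \<and> J \<subseteq> M \<union> X \<and> card J = q)}"

lemma chain_hom: "z \<in> chain M X q n \<Longrightarrow> z J \<in> dp_hom r n"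
  by (simp add: chain_def)

lemma chain_support: "z \<in> chain M X q n \<Longrightarrow> z J \<noteq> 0 \<Longrightarrow> M \<subseteq> J \<and> J \<subseteq> M \<union> X \<and> card J = q"
  by (simp add: chain_def)

lemma chain_0: "(\<lambda>_. 0) \<in> chain M X q n"
  by (simp add: chain_def)

lemma chain_add:
  assumes "y \<in> chain M X q n" "z \<in> chain M X q n"
  shows "(\<lambda>J. y J + z J) \<in> chain M X q n"
  unfolding chain_def mem_Collect_eq
proof (intro allI conjI)
  fix J
  show "y J + z J \<in> dp_hom r n"
    using assms by (auto simp: chain_def intro: dp_hom_add)
  have "y J \<noteq> 0 \<or> z J \<noteq> 0" if "y J + z J \<noteq> 0"
    using that by auto
  then show "y J + z J \<noteq> 0 \<longrightarrow> M \<subseteq> J \<and> J \<subseteq> M \<union> X \<and> card J = q"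
    using assms chain_support by metis
qed

lemma chain_diff:
  assumes "y \<in> chain M X q n" "z \<in> chain M X q n"
  shows "(\<lambda>J. y J - z J) \<in> chain M X q n"
  unfolding chain_def mem_Collect_eq
proof (intro allI conjI)
  fix J
  show "y J - z J \<in> dp_hom r n"
    using assms by (auto simp: chain_def intro: dp_hom_diff)
  have "y J \<noteq> 0 \<or> z J \<noteq> 0" if "y J - z J \<noteq> 0"
    using that by auto
  then show "y J - z J \<noteq> 0 \<longrightarrow> M \<subseteq> J \<and> J \<subseteq> M \<union> X \<and> card J = q"
    using assms chain_support by metis
qed

lemma koszul_add: "koszul X (\<lambda>J. y J + z J) J = koszul X y J + koszul X z J"
  by (simp add: koszul_def contr_add pm.scale_right_distrib sum.distrib)

lemma koszul_diff: "koszul X (\<lambda>J. y J - z J) J = koszul X y J - koszul X z J"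
  by (simp add: koszul_def contr_diff pm.scale_right_diff_distrib sum_subtractf)

lemma koszul_zero: "koszul X (\<lambda>_. 0) J = 0"
  by (simp add: koszul_def)

lemma koszul_chain:
  assumes "y \<in> chain M X (Suc q) (Suc n)" "M \<inter> X = {}" "finite M" "finite X"
  shows "koszul X y \<in> chain M X q n"
  unfolding chain_def mem_Collect_eq
proof (intro allI conjI impI)
  fix J
  show "koszul X y J \<in> dp_hom r n"
    using assms(1) unfolding koszul_def chain_def by (intro dp_hom_sum dp_hom_scale dp_hom_contr) auto
next
  fix J assume "koszul X y J \<noteq> 0"
  then obtain l where l: "l \<in> X - J" "y (insert l J) \<noteq> 0"
    unfolding koszul_def by (metis (no_types, lifting) contr_zero pm.scale_zero_right sum.neutral)
  then have *: "M \<subseteq> insert l J" "insert l J \<subseteq> M \<union> X" "card (insert l J) = Suc q"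
    using assms(1) by (auto simp: chain_def)
  then show "M \<subseteq> J" "J \<subseteq> M \<union> X"
    using l assms by auto
  have "finite J"
    using * assms(3,4) by (meson finite_UnI finite_insert finite_subset)
  then show "card J = q"
    using * l by simp
qed

lemma koszul_koszul:
  assumes "finite X"
  shows "koszul X (koszul X z) J = 0"
proof -
  define f where "f k l = pm_scale (face_sgn k J * face_sgn l (insert k J))
    (contr r (m k) (contr r (m l) (z (insert l (insert k J)))))" for k l
  have "koszul X (koszul X z) J = (\<Sum>k\<in>X - J. \<Sum>l\<in>(X - J) - {k}. f k l)"
    unfolding koszul_def
  proof (intro sum.cong refl)
    fix k
    have "X - insert k J = (X - J) - {k}"
      by auto
    then show "pm_scale (face_sgn k J) (contr r (m k) (\<Sum>l\<in>X - insert k J. pm_scale (face_sgn l (insert k J))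
        (contr r (m l) (z (insert l (insert k J)))))) = (\<Sum>l\<in>X - J - {k}. f k l)"
      by (simp add: f_def contr_sum contr_scale pm.scale_sum_right)
  qed
  also have "\<dots> = 0"
  proof (rule antisymmetric_sum)
    fix k l assume "k \<in> X - J" "l \<in> X - J" "k \<noteq> l"
    then have "face_sgn k J * face_sgn l (insert k J) = - (face_sgn l J * face_sgn k (insert l J) :: 'k)"
      by (intro face_sgn_swap) auto
    then show "f k l = - f l k"
      by (simp add: f_def contr_commute[of r "m k"] insert_commute[of k])
  qed (use assms in auto)
  finally show ?thesis .
qed

text \<open>
  If \<open>p\<close> is a vertex whose contraction is onto on the relevant coefficients, then the homology is
  carried by the sets that contain \<open>p\<close>, with coefficients killed by \<open>p\<close>. This is applied to the elements of
  \<open>P\<close> one after the other; the coefficients that are left are those in \<open>kill P\<close>, and \<open>antiderivative\<close>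
  shows that the next contraction is still onto on them.
\<close>

lemma koszul_homology:
  assumes X: "X \<subseteq> {..<e}" and M: "finite M" "M \<inter> X = {}"
    and P: "P \<subseteq> X" "card P \<le> r"
    and z: "z \<in> chain M X q n" "\<And>J. koszul X z J = 0"
  shows "\<exists>y\<in>chain M X (Suc q) (Suc n).
    \<forall>J. z J - koszul X y J \<in> kill P \<and> (z J - koszul X y J \<noteq> 0 \<longrightarrow> P \<subseteq> J)"
proof -
  have finX: "finite X"
    using X finite_subset by blast
  with P(1) have "finite P"
    using finite_subset by blast
  then show ?thesis
    using P
  proof (induction P)
    case empty
    show ?case
      by (intro bexI[of _ "\<lambda>_. 0"]) (auto simp: chain_0 kill_def)
  next
    case (insert p P)
    then obtain y where y: "y \<in> chain M X (Suc q) (Suc n)"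
      "\<And>J. z J - koszul X y J \<in> kill P" "\<And>J. z J - koszul X y J \<noteq> 0 \<Longrightarrow> P \<subseteq> J"
      by auto
    define z1 where "z1 = (\<lambda>J. z J - koszul X y J)"
    have z1: "z1 \<in> chain M X q n"
      unfolding z1_def by (intro chain_diff z koszul_chain[OF y(1)] M finX)
    have "\<exists>u. u \<in> dp_hom r (Suc n) \<and> u \<in> kill P \<and> contr r (m p) u = z1 J \<and> (z1 J = 0 \<longrightarrow> u = 0)" for J
    proof (cases "z1 J = 0")
      case True
      then show ?thesis
        by (intro exI[of _ 0]) (simp add: kill_def)
    next
      case False
      have "insert p P \<subseteq> {..<e}"
        using insert.prems X by auto
      moreover have "z1 J \<in> dp_hom r n" "z1 J \<in> kill P"
        using z1 y(2) by (auto simp: chain_def z1_def)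
      ultimately show ?thesis
        using antiderivative[of p P "z1 J" n] insert False by metis
    qed
    then obtain u where u: "\<And>J. u J \<in> dp_hom r (Suc n)" "\<And>J. u J \<in> kill P"
      "\<And>J. contr r (m p) (u J) = z1 J" "\<And>J. z1 J = 0 \<Longrightarrow> u J = 0"
      by metis
    \<comment> \<open>The boundary of \<open>y'\<close> at a set \<open>J\<close> without \<open>p\<close> is \<open>z1 J\<close>, since \<open>p\<close> is the only vertex whose addition
      leads to the support of \<open>y'\<close>.\<close>
    define y' where "y' = (\<lambda>K. if p \<in> K then pm_scale (face_sgn p K) (u (K - {p})) else 0)"
    have y'_supp: "z1 (K - {p}) \<noteq> 0" "p \<in> K" if "y' K \<noteq> 0" for K
      using that u(4) by (auto simp: y'_def split: if_splits)
    have y'_kill: "y' K \<in> kill P" for K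
      using u(2) by (auto simp: y'_def kill_def contr_scale)
    have y'_chain: "y' \<in> chain M X (Suc q) (Suc n)"
      unfolding chain_def mem_Collect_eq
    proof (intro allI conjI impI)
      show "y' K \<in> dp_hom r (Suc n)" for K
        using u(1) by (simp add: y'_def dp_hom_scale)
    next
      fix K assume "y' K \<noteq> 0"
      then have K: "M \<subseteq> K - {p}" "K - {p} \<subseteq> M \<union> X" "card (K - {p}) = q" "p \<in> K"
        using y'_supp z1 by (auto simp: chain_def)
      then show "M \<subseteq> K" "K \<subseteq> M \<union> X"
        using insert.prems by auto
      moreover have "finite (K - {p})"
        using K M finX by (meson finite_UnI finite_subset)
      ultimately show "card K = Suc q"
        using K by (metis card_Suc_Diff1 finite_Diff_insert finite.emptyI finite_Diff2)
    qed
    define z2 where "z2 = (\<lambda>J. z1 J - koszul X y' J)"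
    have z2_eq: "z2 J = z J - koszul X (\<lambda>J. y J + y' J) J" for J
      by (simp add: z2_def z1_def koszul_add)
    have z2_0: "z2 J = 0" if "p \<notin> J" for J
    proof -
      have "koszul X y' J = (\<Sum>l\<in>X - J. if l = p then z1 J else 0)"
        unfolding koszul_def
        using that by (intro sum.cong) (auto simp: y'_def contr_scale u(3))
      also have "\<dots> = z1 J"
        using that insert.prems finX by simp
      finally show ?thesis
        by (simp add: z2_def)
    qed
    have P2: "P \<subseteq> J" if "z2 J \<noteq> 0" for J
    proof (cases "z1 J = 0")
      case False
      with y(3) show ?thesis
        by (simp add: z1_def)
    next
      case True
      with that have "koszul X y' J \<noteq> 0"
        by (simp add: z2_def)
      then obtain l where l: "l \<in> X - J" "contr r (m l) (y' (insert l J)) \<noteq> 0"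
        unfolding koszul_def by (metis (no_types, lifting) pm.scale_zero_right sum.neutral)
      then have "z1 (insert l J - {p}) \<noteq> 0"
        using y'_supp by (metis contr_zero)
      then have "P \<subseteq> insert l J - {p}"
        using y(3) by (simp add: z1_def)
      moreover have "l \<notin> P"
        using l(2) y'_kill by (auto simp: kill_def)
      ultimately show ?thesis by blast
    qed
    have kill2: "z2 J \<in> kill P" for J
      unfolding z2_def koszul_def
    proof (rule kill_diff)
      show "z1 J \<in> kill P"
        using y(2) by (simp add: z1_def)
      show "(\<Sum>l\<in>X - J. pm_scale (face_sgn l J) (contr r (m l) (y' (insert l J)))) \<in> kill P"
        using kill_contr[OF y'_kill] by (simp add: kill_def contr_sum contr_scale)
    qed
    \<comment> \<open>\<open>z2\<close> is a cycle that lives on sets containing \<open>p\<close>, so its boundary at \<open>J - {p}\<close> has a single term.\<close>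
    have "contr r (m p) (z2 J) = 0" for J
    proof (cases "p \<in> J")
      case False
      then show ?thesis
        by (simp add: z2_0)
    next
      case True
      have "koszul X z2 (J - {p}) = 0"
        unfolding z2_eq koszul_diff z(2)
        using finX koszul_koszul by simp
      moreover have "koszul X z2 (J - {p}) =
        (\<Sum>l\<in>X - (J - {p}). if l = p then pm_scale (face_sgn p J) (contr r (m p) (z2 J)) else 0)"
        unfolding koszul_def
      proof (intro sum.cong refl)
        fix l assume "l \<in> X - (J - {p})"
        then show "pm_scale (face_sgn l (J - {p})) (contr r (m l) (z2 (insert l (J - {p})))) =
          (if l = p then pm_scale (face_sgn p J) (contr r (m p) (z2 J)) else 0)"
          using True z2_0[of "insert l (J - {p})"] by (cases "l = p") (auto simp: insert_absorb)
      qed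
      moreover have "p \<in> X - (J - {p})" "finite (X - (J - {p}))"
        using insert.prems finX by auto
      ultimately have "pm_scale (face_sgn p J) (contr r (m p) (z2 J)) = 0"
        by simp
      then show ?thesis
        using pm.scale_scale[of "face_sgn p J" "face_sgn p J" "contr r (m p) (z2 J)"] by simp
    qed
    with kill2 have "z2 J \<in> kill (insert p P)" for J
      by (simp add: kill_def)
    moreover have "z2 J \<noteq> 0 \<longrightarrow> insert p P \<subseteq> J" for J
      using P2 z2_0 by auto
    ultimately show ?case
      unfolding z2_eq by (intro bexI[OF _ chain_add[OF y(1) y'_chain]] allI conjI)
  qed
qed

lemma koszul_mono_support:
  assumes "z \<in> chain M X q n" "M \<union> X \<subseteq> Y" "finite Y" "M \<inter> X = {}" "M \<subseteq> J"
  shows "koszul Y z J = koszul X z J"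
  unfolding koszul_def
proof (rule sum.mono_neutral_right)
  show "\<forall>l\<in>(Y - J) - (X - J). pm_scale (face_sgn l J) (contr r (m l) (z (insert l J))) = 0"
  proof
    fix l assume "l \<in> (Y - J) - (X - J)"
    then have "\<not> insert l J \<subseteq> M \<union> X"
      using assms by auto
    then have "z (insert l J) = 0"
      using assms(1) by (auto simp: chain_def)
    then show "pm_scale (face_sgn l J) (contr r (m l) (z (insert l J))) = 0"
      by simp
  qed
qed (use assms in auto)

text \<open>
  The map \<open>s\<^sub>2\<close> of the Buchsbaum--Rim complex, on chains with values in \<open>D\<^sub>0 V\<^sup>*\<close>: the coefficient of
  \<open>\<epsilon>\<^sub>l\<close> in the image of \<open>z\<close>.
\<close>

definition cramer_map :: "(nat set \<Rightarrow> ((nat \<Rightarrow>\<^sub>0 nat) \<Rightarrow>\<^sub>0 'k)) \<Rightarrow> nat \<Rightarrow> 'k" where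
  "cramer_map z l = (\<Sum>J | J \<subseteq> {..<e} - {l} \<and> card J = r.
     face_sgn l J * minor r m J * lookup (z (insert l J)) 0)"

lemma cramer_map_diff: "cramer_map (\<lambda>J. y J - z J) l = cramer_map y l - cramer_map z l"
  by (simp add: cramer_map_def lookup_minus algebra_simps sum_subtractf)

lemma columns_cramer_map:
  assumes "j < r"
  shows "(\<Sum>l<e. cramer_map z l * m l j) = 0"
proof -
  define h where "h l K = face_sgn l K * minor r m (K - {l}) * m l j * lookup (z K) 0" for l K
  have "(\<Sum>l<e. cramer_map z l * m l j) =
    (\<Sum>l\<in>{..<e}. \<Sum>J | J \<in> {J. J \<subseteq> {..<e} \<and> card J = r} \<and> l \<notin> J. h l (insert l J))"
    unfolding cramer_map_def sum_distrib_right
    by (intro sum.cong) (auto simp: h_def mult_ac)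
  also have "\<dots> = (\<Sum>J\<in>{J. J \<subseteq> {..<e} \<and> card J = r}. \<Sum>l | l \<in> {..<e} \<and> l \<notin> J. h l (insert l J))"
    by (rule sum.swap_restrict) auto
  also have "\<dots> = (\<Sum>J | J \<subseteq> {..<e} \<and> card J = r. \<Sum>l\<in>{..<e} - J. h l (insert l J))"
    by (intro sum.cong) auto
  also have "\<dots> = (\<Sum>K | K \<subseteq> {..<e} \<and> card K = Suc r. \<Sum>l\<in>K. h l K)"
    by (rule sum_flags) simp
  also have "\<dots> = 0"
  proof (rule sum.neutral, clarify)
    fix K assume K: "K \<subseteq> {..<e}" "card K = Suc r"
    have "(\<Sum>l\<in>K. h l K) = lookup (z K) 0 * (\<Sum>l\<in>K. face_sgn l K * minor r m (K - {l}) * m l j)"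
      by (simp add: h_def sum_distrib_left mult_ac)
    then show "(\<Sum>l\<in>K. h l K) = 0"
      using cramer_relation[of K r j m] K assms by (simp add: finite_subset)
  qed
  finally show ?thesis .
qed

text \<open>
  For \<open>K\<close> fixed, the terms add up to Cramer's relation between the columns in \<open>K\<close>.
\<close>

lemma cramer_map_koszul:
  assumes "l < e"
  shows "cramer_map (koszul {..<e} z) l = 0"
proof -
  let ?Z = "{..<e} - {l}"
  define h where "h k K = - (\<Sum>j<r. face_sgn l K * lookup (z (insert l K)) (Poly_Mapping.single j 1) *
    (face_sgn k K * minor r m (K - {k}) * m k j))" for k K
  have "cramer_map (koszul {..<e} z) l = (\<Sum>J | J \<subseteq> ?Z \<and> card J = r. \<Sum>k\<in>?Z - J. h k (insert k J))"
    unfolding cramer_map_def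
  proof (intro sum.cong refl)
    fix J assume "J \<in> {J. J \<subseteq> ?Z \<and> card J = r}"
    then have J: "J \<subseteq> ?Z" "card J = r"
      by auto
    have eq: "{..<e} - insert l J = ?Z - J"
      by auto
    have "face_sgn l J * minor r m J * (face_sgn k (insert l J) *
        lookup (contr r (m k) (z (insert k (insert l J)))) 0) = h k (insert k J)" if k: "k \<in> ?Z - J" for k
    proof -
      have sgn: "face_sgn l J * face_sgn k (insert l J) = - (face_sgn k J * face_sgn l (insert k J) :: 'k)"
        using J k by (intro face_sgn_swap) auto
      have "insert k J - {k} = J"
        using k by auto
      then have "h k (insert k J) = - (face_sgn k J * face_sgn l (insert k J)) * minor r m J *
          (\<Sum>j<r. m k j * lookup (z (insert l (insert k J))) (Poly_Mapping.single j 1))"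
        by (simp add: h_def sum_distrib_left sum_negf[symmetric] mult_ac)
      also have "\<dots> = (face_sgn l J * face_sgn k (insert l J)) * minor r m J *
          lookup (contr r (m k) (z (insert k (insert l J)))) 0"
        unfolding sgn lookup_contr by (simp add: insert_commute)
      finally show ?thesis
        by (simp add: mult_ac)
    qed
    then show "face_sgn l J * minor r m J * lookup (koszul {..<e} z (insert l J)) 0 =
        (\<Sum>k\<in>?Z - J. h k (insert k J))"
      unfolding koszul_def lookup_sum_scaled eq sum_distrib_left by (intro sum.cong) auto
  qed
  also have "\<dots> = (\<Sum>K | K \<subseteq> ?Z \<and> card K = Suc r. \<Sum>k\<in>K. h k K)"
    by (rule sum_flags) simp
  also have "\<dots> = 0"
  proof (rule sum.neutral, clarify)
    fix K assume K: "K \<subseteq> ?Z" "card K = Suc r"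
    then have fK: "finite K"
      by (auto intro: finite_subset)
    have "(\<Sum>k\<in>K. h k K) = - (\<Sum>j<r. \<Sum>k\<in>K. face_sgn l K * lookup (z (insert l K)) (Poly_Mapping.single j 1) *
      (face_sgn k K * minor r m (K - {k}) * m k j))"
      unfolding h_def sum_negf by (subst sum.swap) simp
    also have "\<dots> = 0"
      using cramer_relation[OF fK K(2), of _ m] by (simp add: sum_distrib_left[symmetric])
    finally show "(\<Sum>k\<in>K. h k K) = 0" .
  qed
  finally show ?thesis .
qed

text \<open>
  If \<open>z\<close> lives on sets containing \<open>P\<close>, only the set \<open>P \<union> {a}\<close> contributes to the coefficient at \<open>a \<notin> P\<close>.
\<close>

lemma cramer_map_star:
  assumes P: "P \<subseteq> {..<e}" "card P = r" and a: "a < e" "a \<notin> P"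
    and z: "\<And>J. card J = Suc r \<Longrightarrow> z J \<noteq> 0 \<Longrightarrow> P \<subseteq> J"
  shows "cramer_map z a = face_sgn a P * minor r m P * lookup (z (insert a P)) 0"
proof -
  have "face_sgn a J * minor r m J * lookup (z (insert a J)) 0 =
      (if J = P then face_sgn a P * minor r m P * lookup (z (insert a P)) 0 else 0)"
    if J: "J \<subseteq> {..<e} - {a}" "card J = r" for J
  proof (cases "z (insert a J) = 0")
    case True
    then show ?thesis by auto
  next
    case False
    have fJ: "finite J"
      using J(1) finite_subset by auto
    have "P \<subseteq> insert a J"
      using False J fJ by (intro z) (auto simp: card_insert_if)
    then have "P = J"
      using a(2) fJ J P by (metis card_subset_eq subset_insert)
    then show ?thesis by simp
  qed
  then have "cramer_map z a = (\<Sum>J | J \<subseteq> {..<e} - {a} \<and> card J = r.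
      if J = P then face_sgn a P * minor r m P * lookup (z (insert a P)) 0 else 0)"
    unfolding cramer_map_def by (intro sum.cong) auto
  then show ?thesis
    using P a by (simp add: subset_Diff_insert)
qed

text \<open>
  By \<open>koszul_homology\<close> for a basis \<open>P\<close> among the columns in \<open>A\<close>, all homology is in \<open>D\<^sub>0 V\<^sup>*\<close> and is
  carried by the sets \<open>P \<union> {a}\<close>. There \<open>cramer_map\<close> is injective: its coefficient at \<open>a\<close> is a
  multiple of the minor on \<open>P\<close>.
\<close>

lemma buchsbaum_rim_exact:
  assumes A: "A \<subseteq> {..<e}" "r \<le> card A" and z: "z \<in> chain {} A q n" "\<And>J. koszul A z J = 0"
    and n: "n = 0 \<Longrightarrow> q = Suc r \<and> (\<forall>l<e. cramer_map z l = 0)"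
  shows "\<exists>y\<in>chain {} A (Suc q) (Suc n). \<forall>J. z J = koszul A y J"
proof -
  obtain P where P: "P \<subseteq> A" "card P = r"
    using A(2) by (metis obtain_subset_with_card_n)
  have finA: "finite A" and Pe: "P \<subseteq> {..<e}"
    using A P finite_subset by auto
  obtain y where y: "y \<in> chain {} A (Suc q) (Suc n)"
    and y1: "\<And>J. z J - koszul A y J \<in> kill P" and y2: "\<And>J. z J - koszul A y J \<noteq> 0 \<Longrightarrow> P \<subseteq> J"
    using koszul_homology[OF A(1) _ _ P(1) _ z] P(2) by auto
  have zy: "(\<lambda>J. z J - koszul A y J) \<in> chain {} A q n"
    by (intro chain_diff z koszul_chain[OF y] finA) auto
  have "z J - koszul A y J = 0" for J
  proof (cases n)
    case (Suc n')
    then show ?thesis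
      using kill_all[OF Pe P(2) _ y1] zy by (auto simp: chain_def)
  next
    case 0
    show ?thesis
    proof (rule ccontr)
      assume nz: "z J - koszul A y J \<noteq> 0"
      then have J: "P \<subseteq> J" "J \<subseteq> A" "card J = Suc r"
        using y2 zy n[OF 0] by (auto simp: chain_def)
      then have "card (J - P) = 1"
        using P finA by (subst card_Diff_subset) (auto intro: finite_subset)
      then obtain a where a: "J - P = {a}"
        by (auto simp: card_1_singleton_iff)
      then have Ja: "J = insert a P" "a \<notin> P" "a < e"
        using J A by auto
      have "koszul {..<e} y K = koszul A y K" for K
        using koszul_mono_support[OF y, of "{..<e}" K] A by auto
      then have "cramer_map (koszul A y) a = 0"
        using cramer_map_koszul[OF Ja(3), of y] by (simp add: cramer_map_def)
      then have "cramer_map (\<lambda>J. z J - koszul A y J) a = 0"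
        using n[OF 0] Ja(3) by (simp add: cramer_map_diff)
      then have "lookup (z J - koszul A y J) 0 = 0"
        using cramer_map_star[OF Pe P(2) Ja(3,2), of "\<lambda>J. z J - koszul A y J"] y2
          minors[OF Pe P(2)] face_sgn_nonzero[of a P, where 'k = 'k] Ja(1) by auto
      moreover have "z J - koszul A y J \<in> dp_hom r 0"
        using zy 0 by (auto simp: chain_def)
      ultimately show False
        using dp_hom_0_const nz by (metis pm.scale_zero_left)
    qed
  qed
  then show ?thesis
    using y by auto
qed

text \<open>
  Cramer's relations for the sets \<open>P \<union> {a}\<close> prescribe the coefficients outside of \<open>P\<close>; those in \<open>P\<close> are
  then forced, since the columns in \<open>P\<close> are independent.
\<close>

lemma cramer_map_onto_kernel:
  assumes A: "A \<subseteq> {..<e}" and u: "\<And>l. l \<notin> A \<Longrightarrow> u l = 0"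
    and ker: "\<And>j. j < r \<Longrightarrow> (\<Sum>l<e. u l * m l j) = 0"
  shows "\<exists>w\<in>chain {} A (Suc r) 0. \<forall>l<e. cramer_map w l = u l"
proof (cases "card A \<le> r")
  case True
  have "(\<Sum>p\<in>A. u p * m p j) = (\<Sum>l<e. u l * m l j)" for j
    using A u by (intro sum.mono_neutral_left) auto
  then have "u l = 0" for l
    using columns_independent[OF A True, of u l] u ker by fastforce
  then show ?thesis
    by (intro bexI[OF _ chain_0]) (simp add: cramer_map_def)
next
  case False
  then obtain P where P: "P \<subseteq> A" "card P = r"
    by (metis nle_le obtain_subset_with_card_n)
  have finA: "finite A" and Pe: "P \<subseteq> {..<e}"
    using A P finite_subset by auto
  define w :: "nat set \<Rightarrow> ((nat \<Rightarrow>\<^sub>0 nat) \<Rightarrow>\<^sub>0 'k)" where "w J = (if P \<subseteq> J \<and> J \<subseteq> A \<and> card J = Suc r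
    then Poly_Mapping.single 0 (u (the_elem (J - P)) / (face_sgn (the_elem (J - P)) P * minor r m P)) else 0)" for J
  have w: "w \<in> chain {} A (Suc r) 0"
    by (auto simp: chain_def w_def dp_hom_def)
  have off_P: "cramer_map w a = u a" if a: "a < e" "a \<notin> P" for a
  proof -
    have "cramer_map w a = face_sgn a P * minor r m P * lookup (w (insert a P)) 0"
      by (rule cramer_map_star[OF Pe P(2) a]) (auto simp: w_def split: if_splits)
    moreover have "insert a P - P = {a}" "card (insert a P) = Suc r"
      using a P finA by (auto simp: card_insert_if dest: finite_subset)
    ultimately show ?thesis
      using minors[OF Pe P(2)] P(1) face_sgn_nonzero[of a P, where 'k = 'k] u[of a]
      by (auto simp: w_def)
  qed
  have "cramer_map w a - u a = 0" if a: "a \<in> P" for a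
  proof (rule columns_independent[OF Pe _ _ a])
    fix j assume j: "j < r"
    have "(\<Sum>p\<in>P. (cramer_map w p - u p) * m p j) = (\<Sum>p<e. (cramer_map w p - u p) * m p j)"
      using Pe off_P by (intro sum.mono_neutral_left) auto
    also have "\<dots> = 0"
      using columns_cramer_map[OF j, of w] ker[OF j] by (simp add: left_diff_distrib sum_subtractf)
    finally show "(\<Sum>p\<in>P. (cramer_map w p - u p) * m p j) = 0" .
  qed (use P in auto)
  with off_P show ?thesis
    using w by (intro bexI[of _ w]) fastforce+
qed

end

section \<open>Multidegrees of faces\<close>

lemma mdeg_le_refl [simp]: "a \<preceq> a"
  by (simp add: mdeg_le_def)

lemma mdeg_le_trans: "a \<preceq> b \<Longrightarrow> b \<preceq> c \<Longrightarrow> a \<preceq> c"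
  unfolding mdeg_le_def using le_trans by blast

lemma mdeg_le_antisym: "a \<preceq> b \<Longrightarrow> b \<preceq> a \<Longrightarrow> a = b"
  unfolding mdeg_le_def by (intro poly_mapping_eqI le_antisym) auto

lemma lookup_lcm_deg:
  "lookup (lcm_deg (dE :: nat \<Rightarrow> 'n::finite mdegree) I) t = Max ((\<lambda>i. lookup (dE i) t) ` I)"
  unfolding lcm_deg_def by (subst lookup_Abs_poly_mapping) (auto intro: finite_subset[OF subset_UNIV])

lemma lcm_deg_le_iff:
  assumes "finite I" "I \<noteq> {}"
  shows "lcm_deg dE I \<preceq> \<alpha> \<longleftrightarrow> (\<forall>i\<in>I. dE i \<preceq> \<alpha>)"
  using assms by (auto simp: mdeg_le_def lookup_lcm_deg)

lemma lcm_deg_upper: "finite I \<Longrightarrow> i \<in> I \<Longrightarrow> dE i \<preceq> lcm_deg dE I"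
  using lcm_deg_le_iff[of I dE "lcm_deg dE I"] by auto

lemma lcm_deg_mono: "finite J \<Longrightarrow> I \<noteq> {} \<Longrightarrow> I \<subseteq> J \<Longrightarrow> lcm_deg dE I \<preceq> lcm_deg dE J"
  by (subst lcm_deg_le_iff) (auto intro: lcm_deg_upper finite_subset)

lemma lcm_deg_attained:
  fixes dE :: "nat \<Rightarrow> 'n::finite mdegree"
  assumes "finite I" "I \<noteq> {}"
  obtains i where "i \<in> I" "lookup (dE i) t = lookup (lcm_deg dE I) t"
proof -
  have "lookup (lcm_deg dE I) t \<in> (\<lambda>i. lookup (dE i) t) ` I"
    unfolding lookup_lcm_deg using assms by (intro Max_in) auto
  then show thesis
    using that by auto
qed

lemma faces_finite: "I \<in> faces e \<Longrightarrow> finite I"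
  by (auto simp: faces_def intro: finite_subset)

lemma face_below_lcm:
  assumes "I \<in> faces e"
  shows "I \<subseteq> face_below e dE (lcm_deg dE I)"
    and "face_below e dE (lcm_deg dE I) \<in> faces e"
    and "lcm_deg dE (face_below e dE (lcm_deg dE I)) = lcm_deg dE I"
proof -
  show sub: "I \<subseteq> face_below e dE (lcm_deg dE I)"
    using assms lcm_deg_upper[OF faces_finite[OF assms]] by (auto simp: face_below_def faces_def)
  then show face: "face_below e dE (lcm_deg dE I) \<in> faces e"
    using assms by (auto simp: face_below_def faces_def)
  show "lcm_deg dE (face_below e dE (lcm_deg dE I)) = lcm_deg dE I"
  proof (rule mdeg_le_antisym)
    show "lcm_deg dE (face_below e dE (lcm_deg dE I)) \<preceq> lcm_deg dE I"
      using face faces_finite[OF face] by (subst lcm_deg_le_iff) (auto simp: face_below_def faces_def)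
    show "lcm_deg dE I \<preceq> lcm_deg dE (face_below e dE (lcm_deg dE I))"
      using sub assms faces_finite[OF face] by (intro lcm_deg_mono) (auto simp: faces_def)
  qed
qed

lemma lcm_le_iff_below:
  assumes "I \<in> faces e"
  shows "lcm_deg dE I \<preceq> \<alpha> \<longleftrightarrow> I \<subseteq> face_below e dE \<alpha>"
  using assms faces_finite[OF assms]
  by (subst lcm_deg_le_iff) (auto simp: faces_def face_below_def)

lemma face_core_subset: "I \<in> faces e \<Longrightarrow> face_core e dE (lcm_deg dE I) \<subseteq> I"
  by (auto simp: face_core_def)

text \<open>
  The second assumption is the consequence of the minimality of the presentation that the proof uses.
\<close>

locale generic_system = uniform_columns e r m
  for e r :: nat and m :: "nat \<Rightarrow> nat \<Rightarrow> 'k::field" +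
  fixes dE :: "nat \<Rightarrow> 'n::finite mdegree"
  assumes comb_generic: "combinatorially_generic e dE"
    and no_maximum: "\<And>I i. I \<in> faces e \<Longrightarrow> r < card (face_below e dE (lcm_deg dE I)) \<Longrightarrow>
      i < e \<Longrightarrow> dE i \<noteq> lcm_deg dE I"
begin

abbreviation "below \<equiv> face_below e dE"
abbreviation "core \<equiv> face_core e dE"
abbreviation "upper \<equiv> face_upper e dE"
abbreviation "mdeg \<equiv> lcm_deg dE"

lemma same_exponent:
  assumes "i < e" "k < e" "lookup (dE i) t = lookup (dE k) t" "lookup (dE i) t \<noteq> 0"
  shows "i = k"
proof (rule ccontr)
  have gen: "lookup (dE a) t \<noteq> lookup (dE b) t"
    if "a < b" "b < e" "lookup (dE a) t \<noteq> 0 \<or> lookup (dE b) t \<noteq> 0" for a b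
  proof -
    have "t \<in> keys (dE a) \<union> keys (dE b)"
      using that(3) by (simp add: in_keys_iff)
    then show ?thesis
      using comb_generic that(1,2) unfolding combinatorially_generic_def by auto
  qed
  assume "i \<noteq> k"
  then show False
    using gen[of i k] gen[of k i] assms by (cases i k rule: linorder_cases) auto
qed

text \<open>
  Let the exponent of \<open>t\<close> in the multidegree be positive. By genericity a single vertex attains it, and this
  vertex belongs to every face of the multidegree, hence to the core.
\<close>

lemma mdeg_eq_if_core:
  assumes I: "I \<in> faces e" and J: "J \<in> faces e" "core (mdeg I) \<subseteq> J" "J \<subseteq> below (mdeg I)"
  shows "mdeg J = mdeg I"
proof (rule mdeg_le_antisym)
  show "mdeg J \<preceq> mdeg I"
    using J lcm_le_iff_below by blast
  show "mdeg I \<preceq> mdeg J"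
    unfolding mdeg_le_def
  proof
    fix t
    obtain i where i: "i \<in> I" "lookup (dE i) t = lookup (mdeg I) t"
      using I lcm_deg_attained[of I dE t] faces_finite[OF I] by (auto simp: faces_def)
    show "lookup (mdeg I) t \<le> lookup (mdeg J) t"
    proof (cases "lookup (mdeg I) t = 0")
      case False
      have "i \<in> K" if K: "K \<in> faces e" "mdeg K = mdeg I" for K
      proof -
        obtain k where "k \<in> K" "lookup (dE k) t = lookup (mdeg K) t"
          using K lcm_deg_attained[of K dE t] faces_finite[of K e] by (auto simp: faces_def)
        then show ?thesis
          using same_exponent[of i k t] i False K I by (auto simp: faces_def)
      qed
      then have "i \<in> J"
        using J(2) by (auto simp: face_core_def)
      then show ?thesis
        using lcm_deg_upper[OF faces_finite[OF J(1)], of i dE] i by (simp add: mdeg_le_def) metis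
    qed simp
  qed
qed

lemma mdeg_eq_iff:
  assumes "I \<in> faces e" "J \<in> faces e"
  shows "mdeg J = mdeg I \<longleftrightarrow> core (mdeg I) \<subseteq> J \<and> J \<subseteq> below (mdeg I)"
proof
  assume "mdeg J = mdeg I"
  then show "core (mdeg I) \<subseteq> J \<and> J \<subseteq> below (mdeg I)"
    using face_core_subset[OF assms(2), of dE] face_below_lcm(1)[OF assms(2), of dE] by simp
qed (use mdeg_eq_if_core assms in blast)

text \<open>
  Faces between the core and \<open>I\<^sub>\<alpha>\<close> have multidegree \<open>\<alpha>\<close>, so a core with at most one element would
  make some \<open>{i}\<close> a face of multidegree \<open>\<alpha>\<close>.
\<close>

lemma card_core:
  assumes I: "I \<in> faces e" "r < card (below (mdeg I))"
  shows "2 \<le> card (core (mdeg I))"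
proof (rule ccontr)
  assume "\<not> 2 \<le> card (core (mdeg I))"
  have "finite (core (mdeg I))" and coreI: "core (mdeg I) \<subseteq> I"
    using I face_core_subset faces_finite finite_subset by metis+
  have "\<exists>i\<in>I. core (mdeg I) \<subseteq> {i}"
  proof (cases "core (mdeg I) = {}")
    case True
    then show ?thesis
      using I by (auto simp: faces_def)
  next
    case False
    then have "card (core (mdeg I)) = 1"
      using \<open>\<not> 2 \<le> card (core (mdeg I))\<close> \<open>finite (core (mdeg I))\<close> card_0_eq[of "core (mdeg I)"]
      by linarith
    then show ?thesis
      using coreI by (auto simp: card_1_singleton_iff)
  qed
  then obtain i where i: "i \<in> I" "core (mdeg I) \<subseteq> {i}"
    by blast
  then have "i < e" "{i} \<in> faces e"
    using I by (auto simp: faces_def)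
  moreover have "{i} \<subseteq> below (mdeg I)"
    using face_below_lcm(1)[OF I(1), of dE] i by auto
  ultimately have "mdeg {i} = mdeg I"
    using i I by (intro mdeg_eq_if_core)
  moreover have "mdeg {i} = dE i"
    by (rule poly_mapping_eqI) (simp add: lookup_lcm_deg)
  ultimately show False
    using no_maximum[OF I \<open>i < e\<close>] by simp
qed

text \<open>
  These relations between \<open>\<alpha>\<close> and the multidegree of \<open>I\<^sub>\<alpha> \<setminus> l\<close> make the Scarf system closed under
  the differential (see \<open>scarf_space_contr\<close>).
\<close>

lemma remove_core_vertex:
  assumes I: "I \<in> faces e" and l: "l \<in> core (mdeg I)" and ne: "below (mdeg I) - {l} \<noteq> {}"
  defines "J \<equiv> below (mdeg I) - {l}"
  shows "J \<in> faces e" "below (mdeg J) = J" "upper (mdeg J) \<subseteq> upper (mdeg I)"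
proof -
  let ?A = "below (mdeg I)"
  have A: "?A \<in> faces e" "mdeg ?A = mdeg I"
    using face_below_lcm[OF I] by auto
  show J: "J \<in> faces e"
    using A(1) ne unfolding faces_def J_def by auto
  have "l \<in> ?A"
    using l face_core_subset[OF A(1), of dE] A(2) by auto
  have "J \<subseteq> below (mdeg J)"
    using face_below_lcm(1)[OF J] by auto
  moreover have "below (mdeg J) \<subseteq> ?A"
    using lcm_le_iff_below[OF face_below_lcm(2)[OF J, of dE], of dE "mdeg I"] face_below_lcm(3)[OF J, of dE]
      lcm_le_iff_below[OF J, of dE "mdeg I"] unfolding J_def by auto
  moreover have "below (mdeg J) \<noteq> ?A"
  proof
    assume "below (mdeg J) = ?A"
    then have "mdeg J = mdeg I"
      using face_below_lcm(3)[OF J, of dE] A(2) by metis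
    then have "l \<in> J"
      using l J by (auto simp: face_core_def)
    then show False
      by (simp add: J_def)
  qed
  ultimately show below: "below (mdeg J) = J"
    by (auto simp: J_def)
  have "core (mdeg I) - {l} \<subseteq> core (mdeg J)"
  proof
    fix j assume j: "j \<in> core (mdeg I) - {l}"
    have "j \<in> K" if K: "K \<in> faces e" "mdeg K = mdeg J" for K
    proof -
      have KJ: "K \<subseteq> J"
        using face_below_lcm(1)[OF K(1), of dE] K(2) below by simp
      have face: "insert l K \<in> faces e"
        using K \<open>l \<in> ?A\<close> by (auto simp: faces_def face_below_def)
      have "mdeg (insert l K) = mdeg I"
      proof (rule mdeg_le_antisym)
        show "mdeg (insert l K) \<preceq> mdeg I"
          using face KJ \<open>l \<in> ?A\<close> by (subst lcm_le_iff_below) (auto simp: J_def)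
        have "dE i \<preceq> mdeg (insert l K)" if "i \<in> ?A" for i
        proof (cases "i = l")
          case True
          then show ?thesis
            using lcm_deg_upper[OF faces_finite[OF face]] by blast
        next
          case False
          then have "dE i \<preceq> mdeg J"
            using that lcm_deg_upper[OF faces_finite[OF J]] by (auto simp: J_def)
          moreover have "mdeg J \<preceq> mdeg (insert l K)"
            using K faces_finite[OF face] unfolding K(2)[symmetric]
            by (intro lcm_deg_mono) (auto simp: faces_def)
          ultimately show ?thesis
            by (rule mdeg_le_trans)
        qed
        then have "mdeg ?A \<preceq> mdeg (insert l K)"
          using A(1) faces_finite[OF A(1)] by (subst lcm_deg_le_iff) (auto simp: faces_def)
        then show "mdeg I \<preceq> mdeg (insert l K)"
          using A(2) by simp
      qed
      then have "j \<in> insert l K"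
        using j face by (auto simp: face_core_def)
      then show ?thesis
        using j by auto
    qed
    then show "j \<in> core (mdeg J)"
      by (auto simp: face_core_def)
  qed
  moreover have "upper (mdeg J) = J - core (mdeg J)"
    by (simp add: face_upper_def below)
  moreover have "J \<subseteq> ?A - {l}"
    by (simp add: J_def)
  ultimately show "upper (mdeg J) \<subseteq> upper (mdeg I)"
    unfolding face_upper_def by blast
qed

section \<open>The strands of the Scarf complex\<close>

text \<open>
  A description of the Scarf system without case distinction: for a Scarf face \<open>I\<close> of multidegree
  \<open>\<alpha>\<close> one has \<open>I = I\<^sub>\<alpha> = I(\<alpha>)\<close>, so \<open>I\<^sup>\<alpha>\<close> is empty and the whole divided power survives. The
  agreement with the definition is \<open>scarf_system_eq\<close>.
\<close>

definition scarf_space :: "nat set \<Rightarrow> ((nat \<Rightarrow>\<^sub>0 nat) \<Rightarrow>\<^sub>0 'k) set" where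
  "scarf_space I = (if r < card I \<and> I = below (mdeg I)
     then dp_hom r (card I - r - 1) \<inter> kill (upper (mdeg I)) else {0})"

lemma scarf_space_0 [simp]: "0 \<in> scarf_space I"
  by (simp add: scarf_space_def kill_def)

lemma scarf_space_add: "y \<in> scarf_space I \<Longrightarrow> z \<in> scarf_space I \<Longrightarrow> y + z \<in> scarf_space I"
  by (auto simp: scarf_space_def kill_def contr_add dp_hom_add split: if_splits)

lemma scarf_space_scale: "y \<in> scarf_space I \<Longrightarrow> pm_scale c y \<in> scarf_space I"
  by (auto simp: scarf_space_def kill_def contr_scale dp_hom_scale split: if_splits)

lemma scarf_space_hom: "y \<in> scarf_space I \<Longrightarrow> y \<in> dp_hom r (card I - r - 1)"
  by (auto simp: scarf_space_def split: if_splits)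

lemma scarf_space_upper:
  assumes "y \<in> scarf_space I" "l \<in> upper (mdeg I)"
  shows "contr r (m l) y = 0"
  using assms by (auto simp: scarf_space_def kill_def split: if_splits)

lemma scarf_space_nonzero: "y \<in> scarf_space I \<Longrightarrow> y \<noteq> 0 \<Longrightarrow> r < card I \<and> I = below (mdeg I)"
  by (auto simp: scarf_space_def split: if_splits)

text \<open>The condition on a BRT system.\<close>

lemma scarf_space_contr:
  assumes I: "I \<subseteq> {..<e}" and y: "y \<in> scarf_space I" and l: "l \<in> I"
  shows "contr r (m l) y \<in> scarf_space (I - {l})"
proof (cases "y = 0 \<or> l \<in> upper (mdeg I) \<or> card I \<le> Suc r")
  case True
  moreover have "y \<in> dp_hom r 0" if "card I \<le> Suc r"
    using scarf_space_hom[OF y] that by simp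
  ultimately show ?thesis
    using scarf_space_upper[OF y] contr_dp_hom_0 by fastforce
next
  case False
  then have closed: "I = below (mdeg I)" and big: "Suc r < card I"
    using scarf_space_nonzero[OF y] by auto
  have face: "I \<in> faces e"
    using I l by (auto simp: faces_def)
  have core: "l \<in> core (mdeg I)"
    using l False closed by (auto simp: face_upper_def)
  have fin: "finite I"
    using I finite_subset by blast
  have J: "below (mdeg (I - {l})) = I - {l}" "upper (mdeg (I - {l})) \<subseteq> upper (mdeg I)"
  proof -
    have "I - {l} \<noteq> {}"
      using big l fin by (metis card.empty card_Suc_Diff1 not_less_eq not_less_zero)
    then show "below (mdeg (I - {l})) = I - {l}" "upper (mdeg (I - {l})) \<subseteq> upper (mdeg I)"
      using remove_core_vertex[OF face core] closed by auto
  qed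
  have card: "card (I - {l}) = card I - 1"
    using l fin by simp
  have "y \<in> dp_hom r (Suc (card (I - {l}) - r - 1))"
    using scarf_space_hom[OF y] big card by (simp add: Suc_diff_Suc)
  then have "contr r (m l) y \<in> dp_hom r (card (I - {l}) - r - 1)"
    by (rule dp_hom_contr)
  moreover have "contr r (m l) y \<in> kill (upper (mdeg (I - {l})))"
    using scarf_space_upper[OF y] J(2) by (intro kill_contr) (auto simp: kill_def)
  ultimately show ?thesis
    using J(1) big card by (simp add: scarf_space_def)
qed

text \<open>
  The faces whose coefficient is not in the Scarf system have their multidegrees in a set \<open>\<Gamma>\<close>
  that is closed downwards, and \<open>\<Gamma>\<close> is emptied one maximal element \<open>\<beta>\<close> at a time. Above \<open>\<beta>\<close> the chain
  is already in the Scarf complex, so its part of multidegree \<open>\<beta>\<close> is a cycle of the Koszul complex on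
  \<open>I\<^sup>\<beta>\<close>. Subtracting a boundary moves this part into the Scarf system, and it changes only coefficients in
  multidegrees \<open>\<preceq> \<beta>\<close>.
\<close>

lemma reduce_to_scarf:
  assumes w: "w \<in> chain {} (below \<alpha>) (Suc (n + r)) n"
    and dw: "\<And>J. koszul (below \<alpha>) w J \<in> scarf_space J"
  shows "\<exists>v\<in>chain {} (below \<alpha>) (Suc (Suc (n + r))) (Suc n).
    \<forall>J. w J - koszul (below \<alpha>) v J \<in> scarf_space J"
proof -
  let ?A = "below \<alpha>"
  have A: "?A \<subseteq> {..<e}" "finite ?A"
    by (auto simp: face_below_def)
  have facesA: "J \<in> faces e" if "J \<subseteq> ?A" "J \<noteq> {}" for J
    using that A by (auto simp: faces_def)
  have finA: "finite J" if "J \<subseteq> ?A" for J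
    using that A finite_subset by blast
  define down where "down \<Gamma> \<longleftrightarrow> \<Gamma> \<subseteq> mdeg ` {J. J \<subseteq> ?A \<and> J \<noteq> {}} \<and>
    (\<forall>\<beta>\<in>\<Gamma>. \<forall>J. J \<subseteq> ?A \<and> J \<noteq> {} \<and> mdeg J \<preceq> \<beta> \<longrightarrow> mdeg J \<in> \<Gamma>)" for \<Gamma>
  have fin_down: "finite \<Gamma>" if "down \<Gamma>" for \<Gamma>
  proof -
    have "finite (mdeg ` {J. J \<subseteq> ?A \<and> J \<noteq> {}})"
      using A(2) by auto
    then show ?thesis
      using that finite_subset unfolding down_def by blast
  qed
  have "\<exists>v\<in>chain {} ?A (Suc (Suc (n + r))) (Suc n). \<forall>J. w J - koszul ?A v J \<in> scarf_space J"
    if "down \<Gamma>" "\<And>J. w J \<notin> scarf_space J \<Longrightarrow> mdeg J \<in> \<Gamma>" for \<Gamma>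
    using that w dw
  proof (induction "card \<Gamma>" arbitrary: \<Gamma> w)
    case 0
    then have "\<Gamma> = {}"
      using fin_down by auto
    then have "w J \<in> scarf_space J" for J
      using 0 by blast
    then show ?case
      by (intro bexI[of _ "\<lambda>_. 0"]) (simp_all add: chain_0 koszul_zero)
  next
    case (Suc k)
    note w = Suc.prems(3)
    \<comment> \<open>A multidegree of maximal total degree in \<open>\<Gamma>\<close> is maximal for the componentwise order.\<close>
    define height :: "'n mdegree \<Rightarrow> nat" where "height \<beta> = (\<Sum>t\<in>UNIV. lookup \<beta> t)" for \<beta>
    have height: "\<beta> = \<gamma>" if "\<beta> \<preceq> \<gamma>" "height \<gamma> \<le> height \<beta>" for \<beta> \<gamma>
    proof (rule ccontr)
      assume "\<beta> \<noteq> \<gamma>"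
      then obtain t where "lookup \<beta> t \<noteq> lookup \<gamma> t"
        by (metis poly_mapping_eqI)
      then have "lookup \<beta> t < lookup \<gamma> t"
        using that(1) by (simp add: mdeg_le_def le_neq_implies_less)
      then have "height \<beta> < height \<gamma>"
        unfolding height_def using that(1)
        by (intro sum_strict_mono_ex1) (auto simp: mdeg_le_def)
      with that(2) show False by simp
    qed
    have \<Gamma>: "finite \<Gamma>" "\<Gamma> \<noteq> {}"
      using fin_down[OF Suc.prems(1)] Suc.hyps(2) by auto
    obtain \<beta> where \<beta>: "\<beta> \<in> \<Gamma>" "\<And>\<gamma>. \<gamma> \<in> \<Gamma> \<Longrightarrow> height \<gamma> \<le> height \<beta>"
    proof -
      have "Max (height ` \<Gamma>) \<in> height ` \<Gamma>"
        using \<Gamma> by (intro Max_in) auto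
      then obtain \<beta> where "\<beta> \<in> \<Gamma>" "height \<beta> = Max (height ` \<Gamma>)"
        by (metis imageE)
      then show thesis
        using that[of \<beta>] \<Gamma> by simp
    qed
    then have max: "\<gamma> = \<beta>" if "\<gamma> \<in> \<Gamma>" "\<beta> \<preceq> \<gamma>" for \<gamma>
      using height that by metis
    obtain I where I: "I \<subseteq> ?A" "I \<noteq> {}" "mdeg I = \<beta>"
      using Suc.prems(1) \<beta>(1) by (auto simp: down_def)
    define B M X where "B = below \<beta>" and "M = core \<beta>" and "X = upper \<beta>"
    have faceI: "I \<in> faces e"
      using facesA I by blast
    have B: "B \<in> faces e" "mdeg B = \<beta>" "B \<subseteq> ?A"
    proof -
      show "B \<in> faces e" "mdeg B = \<beta>"
        using face_below_lcm[OF faceI, of dE] I by (auto simp: B_def)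
      have "\<beta> \<preceq> \<alpha>"
        using lcm_le_iff_below[OF faceI, of dE \<alpha>] I by simp
      then show "B \<subseteq> ?A"
        unfolding B_def face_below_def using mdeg_le_trans by auto
    qed
    have MB: "M \<subseteq> B" and X: "X = B - M"
      using face_core_subset[OF B(1), of dE] B(2) by (auto simp: M_def X_def B_def face_upper_def)
    have finB: "finite B" "finite M" "finite X"
      using finA[OF B(3)] MB X finite_subset by auto
    have interval: "mdeg J = \<beta> \<longleftrightarrow> M \<subseteq> J \<and> J \<subseteq> B" if "J \<in> faces e" for J
      using mdeg_eq_iff[OF faceI that] I by (simp add: M_def B_def)
    have down': "down (\<Gamma> - {\<beta>})"
      unfolding down_def
    proof (intro conjI ballI allI impI)
      show "\<Gamma> - {\<beta>} \<subseteq> mdeg ` {J. J \<subseteq> ?A \<and> J \<noteq> {}}"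
        using Suc.prems(1) by (auto simp: down_def)
      fix \<gamma> J assume *: "\<gamma> \<in> \<Gamma> - {\<beta>}" "J \<subseteq> ?A \<and> J \<noteq> {} \<and> mdeg J \<preceq> \<gamma>"
      then have "mdeg J \<in> \<Gamma>"
        using Suc.prems(1) unfolding down_def by blast
      moreover have "mdeg J \<noteq> \<beta>"
        using * max by auto
      ultimately show "mdeg J \<in> \<Gamma> - {\<beta>}"
        by blast
    qed
    have "k = card (\<Gamma> - {\<beta>})"
      using Suc.hyps(2) \<beta>(1) \<Gamma>(1) by simp
    note IH = Suc.hyps(1)[OF this down']
    have "\<exists>y\<in>chain {} ?A (Suc (Suc (n + r))) (Suc n).
      \<forall>J. w J - koszul ?A y J \<notin> scarf_space J \<longrightarrow> mdeg J \<in> \<Gamma> - {\<beta>}"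
    proof (cases "r < card B")
      case False
      have "mdeg J \<noteq> \<beta>" if "w J \<notin> scarf_space J" for J
      proof
        assume "mdeg J = \<beta>"
        have "w J \<noteq> 0"
          using that by auto
        then have J: "J \<subseteq> ?A" "card J = Suc (n + r)"
          using chain_support[OF w] by auto
        then have "J \<in> faces e"
          by (intro facesA) auto
        then have "J \<subseteq> B"
          using interval \<open>mdeg J = \<beta>\<close> by blast
        then show False
          using False J(2) card_mono[OF finB(1) \<open>J \<subseteq> B\<close>] by simp
      qed
      then show ?thesis
        using Suc.prems(2) by (intro bexI[OF _ chain_0]) (auto simp: koszul_zero)
    next
      case True
      have cardM: "2 \<le> card M"
        using card_core[OF faceI] True I by (simp add: M_def B_def)
      have facesM: "J \<in> faces e" if "M \<subseteq> J" "J \<subseteq> ?A" for J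
        using that cardM by (intro facesA) auto
      define wB where "wB J = (if M \<subseteq> J \<and> J \<subseteq> B then w J else 0)" for J
      have wB: "wB \<in> chain M X (Suc (n + r)) n"
        using w MB unfolding chain_def wB_def X by auto
      \<comment> \<open>Between \<open>M\<close> and \<open>B\<close>, excluding \<open>B\<close>, the Scarf system is zero; and adding a vertex outside of \<open>B\<close>
        leads to multidegrees above \<open>\<beta>\<close>, where the chain is already in the Scarf complex.\<close>
      have "koszul X wB J = 0" for J
      proof (cases "M \<subseteq> J \<and> J \<subseteq> B \<and> J \<noteq> B")
        case False
        have "wB (insert l J) = 0" if "l \<in> X - J" for l
          using False that MB by (auto simp: wB_def X)
        then show ?thesis
          by (simp add: koszul_def)
      next
        case J: True
        then have faceJ: "J \<in> faces e"
          using facesM B(3) by blast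
        then have degJ: "mdeg J = \<beta>"
          using interval J by blast
        then have spaceJ: "scarf_space J = {0}"
          using J unfolding scarf_space_def B_def by auto
        have split: "?A - J = (X - J) \<union> (?A - B)" "(X - J) \<inter> (?A - B) = {}"
          using J B(3) X MB by auto
        have "pm_scale (face_sgn l J) (contr r (m l) (w (insert l J))) = 0" if l: "l \<in> ?A - B" for l
        proof -
          have K: "insert l J \<subseteq> ?A" "l \<notin> J"
            using J B(3) l by auto
          then have Kf: "insert l J \<in> faces e"
            using J by (intro facesM) auto
          have "\<not> insert l J \<subseteq> B"
            using l by auto
          then have "mdeg (insert l J) \<noteq> \<beta>"
            using interval[OF Kf] by auto
          moreover have "\<beta> \<preceq> mdeg (insert l J)"
            unfolding degJ[symmetric] using faces_finite[OF Kf] faceJ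
            by (intro lcm_deg_mono) (auto simp: faces_def)
          ultimately have "w (insert l J) \<in> scarf_space (insert l J)"
            using max Suc.prems(2) by blast
          then have "contr r (m l) (w (insert l J)) \<in> scarf_space (insert l J - {l})"
            using K(1) A(1) by (intro scarf_space_contr) auto
          then show ?thesis
            using spaceJ K(2) by simp
        qed
        then have "koszul ?A w J = (\<Sum>l\<in>X - J. pm_scale (face_sgn l J) (contr r (m l) (w (insert l J))))"
          unfolding koszul_def split(1) using A(2) finB(3) split(2)
          by (subst sum.union_disjoint) auto
        also have "\<dots> = koszul X wB J"
          unfolding koszul_def using J X MB by (intro sum.cong) (auto simp: wB_def)
        finally show ?thesis
          using Suc.prems(4)[of J] spaceJ by simp
      qed
      note cycle = this
      \<comment> \<open>A maximal independent set of columns in \<open>X\<close>.\<close>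
      obtain P where P: "P \<subseteq> X" "card P \<le> r" "P = X \<or> card P = r"
      proof (cases "card X \<le> r")
        case False
        then show ?thesis
          using that by (metis nle_le obtain_subset_with_card_n)
      qed (use that in blast)
      have disj: "M \<inter> X = {}" and XA: "M \<union> X = B" "X \<subseteq> {..<e}"
        using X MB B(3) A(1) by auto
      obtain y where y: "y \<in> chain M X (Suc (Suc (n + r))) (Suc n)"
        and y1: "\<And>J. wB J - koszul X y J \<in> kill P"
        and y2: "\<And>J. wB J - koszul X y J \<noteq> 0 \<Longrightarrow> P \<subseteq> J"
        using koszul_homology[OF XA(2) finB(2) disj P(1,2) wB cycle] by blast
      have yA: "y \<in> chain {} ?A (Suc (Suc (n + r))) (Suc n)"
        using y XA(1) B(3) unfolding chain_def by blast
      have "mdeg J \<in> \<Gamma> - {\<beta>}" if bad: "w J - koszul ?A y J \<notin> scarf_space J" for J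
      proof
        show "mdeg J \<in> \<Gamma>"
        proof (cases "w J \<in> scarf_space J")
          case False
          then show ?thesis by (rule Suc.prems(2))
        next
          case True
          then have "koszul ?A y J \<noteq> 0"
            using bad by auto
          then obtain l where l: "l \<in> ?A - J" "y (insert l J) \<noteq> 0"
            unfolding koszul_def by (metis (no_types, lifting) contr_zero pm.scale_zero_right sum.neutral)
          then have "insert l J \<subseteq> B" "card (insert l J) = Suc (Suc (n + r))"
            using chain_support[OF y] XA(1) by auto
          then have J: "J \<subseteq> B" "J \<noteq> {}"
            by auto
          then have "mdeg J \<preceq> mdeg B"
            using finB by (intro lcm_deg_mono) auto
          then show ?thesis
            using J B(2,3) Suc.prems(1) \<beta>(1) unfolding down_def by blast
        qed
        show "mdeg J \<notin> {\<beta>}"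
        proof
          assume "mdeg J \<in> {\<beta>}"
          have "(\<lambda>J. w J - koszul ?A y J) \<in> chain {} ?A (Suc (n + r)) n"
            by (intro chain_diff w koszul_chain[OF yA] A) auto
          from chain_support[OF this, of J] bad have JA: "J \<subseteq> ?A" and cardJ: "card J = Suc (n + r)"
            by force+
          have "J \<in> faces e"
            using JA cardJ by (intro facesA) auto
          then have J: "M \<subseteq> J" "J \<subseteq> B"
            using interval \<open>mdeg J \<in> {\<beta>}\<close> by auto
          have eq: "w J - koszul ?A y J = wB J - koszul X y J"
            using koszul_mono_support[OF y, of ?A J] XA B(3) A disj J by (simp add: wB_def)
          define d where "d = wB J - koszul X y J"
          have "d \<noteq> 0"
            using bad unfolding eq d_def by (metis scarf_space_0)
          then have d: "d \<in> dp_hom r n" "d \<in> kill P" "d \<noteq> 0" "P \<subseteq> J"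
            using chain_hom[OF chain_diff[OF wB koszul_chain[OF y disj finB(2,3)]]] y1 y2
            by (simp_all add: d_def)
          from P(3) show False
          proof
            assume "P = X"
            then have "J = B"
              using d(4) J XA(1) by auto
            then have "d \<in> scarf_space J"
              using d(1,2) \<open>P = X\<close> cardJ B(2) by (simp add: scarf_space_def B_def X_def)
            then show False
              using bad eq by (simp add: d_def)
          next
            assume "card P = r"
            show False
            proof (cases n)
              case 0
              \<comment> \<open>This is where \<open>2 \<le> card M\<close> is needed: it makes \<open>M \<union> P\<close> larger than \<open>J\<close>, which has \<open>r + 1\<close> elements.\<close>
              have "card (M \<union> P) = card M + card P"
                using finB disj P(1) by (intro card_Un_disjoint) (auto intro: finite_subset)
              moreover have "card (M \<union> P) \<le> card J"
                using J d(4) finA[OF JA] by (intro card_mono) auto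
              ultimately show False
                using cardM cardJ 0 \<open>card P = r\<close> by simp
            next
              case (Suc n')
              then show False
                using kill_all[of P d n'] d P(1) XA(2) \<open>card P = r\<close> by auto
            qed
          qed
        qed
      qed
      with yA show ?thesis by blast
    qed
    then obtain y where y: "y \<in> chain {} ?A (Suc (Suc (n + r))) (Suc n)"
      "\<And>J. w J - koszul ?A y J \<notin> scarf_space J \<Longrightarrow> mdeg J \<in> \<Gamma> - {\<beta>}"
      by blast
    have "(\<lambda>J. w J - koszul ?A y J) \<in> chain {} ?A (Suc (n + r)) n"
      by (intro chain_diff w koszul_chain[OF y(1)] A) auto
    moreover have "koszul ?A (\<lambda>J. w J - koszul ?A y J) J \<in> scarf_space J" for J
      unfolding koszul_diff koszul_koszul[OF A(2)] using Suc.prems(4) by simp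
    ultimately have "\<exists>v\<in>chain {} ?A (Suc (Suc (n + r))) (Suc n).
      \<forall>J. (w J - koszul ?A y J) - koszul ?A v J \<in> scarf_space J"
      using y(2) by (intro IH[where w = "\<lambda>J. w J - koszul ?A y J"])
    then obtain v where v: "v \<in> chain {} ?A (Suc (Suc (n + r))) (Suc n)"
      "\<And>J. (w J - koszul ?A y J) - koszul ?A v J \<in> scarf_space J"
      by blast
    then show ?case
      by (intro bexI[OF _ chain_add[OF y(1) v(1)]] allI) (simp add: koszul_add diff_diff_eq)
  qed
  moreover have "down (mdeg ` {J. J \<subseteq> ?A \<and> J \<noteq> {}})"
    by (auto simp: down_def)
  moreover have "mdeg J \<in> mdeg ` {J. J \<subseteq> ?A \<and> J \<noteq> {}}" if "w J \<notin> scarf_space J" for J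
  proof -
    have "w J \<noteq> 0"
      using that by auto
    then show ?thesis
      using chain_support[OF w, of J] by auto
  qed
  ultimately show ?thesis
    by blast
qed

text \<open>
  A cycle of the Scarf complex bounds in the Buchsbaum--Rim complex, and \<open>reduce_to_scarf\<close> replaces
  the bounding chain.
\<close>

lemma scarf_strand_exact:
  assumes z: "z \<in> chain {} (below \<alpha>) (Suc (n + r)) n" "\<And>J. z J \<in> scarf_space J"
    and cycle: "n = 0 \<Longrightarrow> \<forall>l<e. cramer_map z l = 0" "n \<noteq> 0 \<Longrightarrow> \<forall>J. koszul (below \<alpha>) z J = 0"
  shows "\<exists>w\<in>chain {} (below \<alpha>) (Suc (Suc (n + r))) (Suc n).
    (\<forall>J. w J \<in> scarf_space J) \<and> (\<forall>J. koszul (below \<alpha>) w J = z J)"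
proof (cases "r \<le> card (below \<alpha>)")
  case False
  have "z J = 0" for J
  proof (rule ccontr)
    assume "z J \<noteq> 0"
    then have "J \<subseteq> below \<alpha>" "card J = Suc (n + r)"
      using chain_support[OF z(1)] by auto
    then show False
      using False card_mono[of "below \<alpha>" J] by (simp add: face_below_def)
  qed
  then show ?thesis
    by (intro bexI[OF _ chain_0]) (simp add: koszul_zero)
next
  case True
  have A: "below \<alpha> \<subseteq> {..<e}" "finite (below \<alpha>)"
    by (auto simp: face_below_def)
  have "koszul (below \<alpha>) z J = 0" for J
  proof (cases n)
    case 0
    then show ?thesis
      using contr_dp_hom_0[OF chain_hom[OF z(1)[unfolded 0]]] by (simp add: koszul_def)
  qed (use cycle in auto)
  then obtain w where w: "w \<in> chain {} (below \<alpha>) (Suc (Suc (n + r))) (Suc n)"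
    "\<And>J. z J = koszul (below \<alpha>) w J"
    using buchsbaum_rim_exact[OF A(1) True z(1)] cycle(1) by auto
  have w': "w \<in> chain {} (below \<alpha>) (Suc (Suc n + r)) (Suc n)"
    using w(1) by simp
  obtain v where v: "v \<in> chain {} (below \<alpha>) (Suc (Suc (Suc n + r))) (Suc (Suc n))"
    "\<And>J. w J - koszul (below \<alpha>) v J \<in> scarf_space J"
    using reduce_to_scarf[OF w'] w(2) z(2) by metis
  have "(\<lambda>J. w J - koszul (below \<alpha>) v J) \<in> chain {} (below \<alpha>) (Suc (Suc n + r)) (Suc n)"
    by (intro chain_diff w' koszul_chain[OF v(1)] A) auto
  moreover have "koszul (below \<alpha>) (\<lambda>J. w J - koszul (below \<alpha>) v J) J = z J" for J
    unfolding koszul_diff koszul_koszul[OF A(2)] w(2) by simp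
  ultimately show ?thesis
    using v(2) by (intro bexI[of _ "\<lambda>J. w J - koszul (below \<alpha>) v J"]) auto
qed

lemma scarf_strand_onto_kernel:
  assumes u: "\<And>l. l \<notin> below \<alpha> \<Longrightarrow> u l = 0" and ker: "\<And>j. j < r \<Longrightarrow> (\<Sum>l<e. u l * m l j) = 0"
  shows "\<exists>w\<in>chain {} (below \<alpha>) (Suc r) 0. (\<forall>J. w J \<in> scarf_space J) \<and> (\<forall>l<e. cramer_map w l = u l)"
proof -
  have A: "below \<alpha> \<subseteq> {..<e}" "finite (below \<alpha>)"
    by (auto simp: face_below_def)
  obtain w where w: "w \<in> chain {} (below \<alpha>) (Suc r) 0" "\<And>l. l < e \<Longrightarrow> cramer_map w l = u l"
    using cramer_map_onto_kernel[OF A(1) u ker] by blast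
  have "koszul (below \<alpha>) w J \<in> scarf_space J" for J
    using contr_dp_hom_0[OF chain_hom[OF w(1)]] by (simp add: koszul_def)
  then obtain v where v: "v \<in> chain {} (below \<alpha>) (Suc (Suc r)) (Suc 0)"
    "\<And>J. w J - koszul (below \<alpha>) v J \<in> scarf_space J"
    using reduce_to_scarf[of w \<alpha> 0] w(1) by auto
  have "(\<lambda>J. w J - koszul (below \<alpha>) v J) \<in> chain {} (below \<alpha>) (Suc r) 0"
    by (intro chain_diff w koszul_chain[OF v(1)] A) auto
  moreover have "cramer_map (\<lambda>J. w J - koszul (below \<alpha>) v J) l = u l" if "l < e" for l
  proof -
    have "koszul (below \<alpha>) v = koszul {..<e} v"
      using koszul_mono_support[OF v(1), of "{..<e}"] A by auto
    then show ?thesis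
      using that w(2) cramer_map_koszul by (simp add: cramer_map_diff)
  qed
  ultimately show ?thesis
    using v(2) by (intro bexI[of _ "\<lambda>J. w J - koszul (below \<alpha>) v J"]) auto
qed

end

section \<open>The image of the coefficient matrix and its dual\<close>

lemma im_sub_closed:
  fixes C :: "'k::field mat"
  shows "0\<^sub>v (dim_row C) \<in> im_sub C J"
    "v \<in> im_sub C J \<Longrightarrow> w \<in> im_sub C J \<Longrightarrow> v + w \<in> im_sub C J"
    "v \<in> im_sub C J \<Longrightarrow> c \<cdot>\<^sub>v v \<in> im_sub C J"
proof -
  have C: "C \<in> carrier_mat (dim_row C) (dim_col C)" by simp
  have "C *\<^sub>v 0\<^sub>v (dim_col C) = 0\<^sub>v (dim_row C)"
    by (intro eq_vecI) auto
  then show "0\<^sub>v (dim_row C) \<in> im_sub C J"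
    unfolding im_sub_def by (intro CollectI exI[of _ "0\<^sub>v (dim_col C)"]) auto
  show "v + w \<in> im_sub C J" if vw: "v \<in> im_sub C J" "w \<in> im_sub C J"
  proof -
    obtain a b where "v = C *\<^sub>v a" "w = C *\<^sub>v b" "a \<in> carrier_vec (dim_col C)" "b \<in> carrier_vec (dim_col C)"
      "\<forall>j<dim_col C. j \<notin> J \<longrightarrow> a $ j = 0" "\<forall>j<dim_col C. j \<notin> J \<longrightarrow> b $ j = 0"
      using vw unfolding im_sub_def by blast
    then show ?thesis
      unfolding im_sub_def
      by (intro CollectI exI[of _ "a + b"]) (auto simp: mult_add_distrib_mat_vec[OF C])
  qed
  show "c \<cdot>\<^sub>v v \<in> im_sub C J" if v: "v \<in> im_sub C J"
  proof -
    obtain a where "v = C *\<^sub>v a" "a \<in> carrier_vec (dim_col C)" "\<forall>j<dim_col C. j \<notin> J \<longrightarrow> a $ j = 0"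
      using v unfolding im_sub_def by blast
    then show ?thesis
      unfolding im_sub_def
      by (intro CollectI exI[of _ "c \<cdot>\<^sub>v a"]) (auto simp: mult_mat_vec[OF C])
  qed
qed

lemma im_space_eq_im_sub: "im_space C = im_sub C UNIV"
  by (auto simp: im_space_def im_sub_def)

lemmas im_space_closed = im_sub_closed[where J = UNIV, folded im_space_eq_im_sub]

lemma col_eq_mult_unit: "l < dim_col C \<Longrightarrow> col C l = C *\<^sub>v unit_vec (dim_col C) (l :: nat)"
  for C :: "'k::field mat"
  by (intro eq_vecI) auto

lemma col_in_im_space: "l < dim_col C \<Longrightarrow> col C l \<in> im_space C"
  by (simp add: im_space_def col_eq_mult_unit)

text \<open>
  The image vector \<open>C u\<close> is assembled from the columns one at a time; \<open>k\<close> counts the columns used.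
\<close>

lemma mat_vec_induct [consumes 1, case_names zero step]:
  fixes C :: "'k::field mat"
  assumes u: "u \<in> carrier_vec (dim_col C)"
    and zero: "P 0 (0\<^sub>v (dim_row C))"
    and step: "\<And>k v. k < dim_col C \<Longrightarrow> v \<in> im_space C \<Longrightarrow> P k v \<Longrightarrow> P (Suc k) (v + u $ k \<cdot>\<^sub>v col C k)"
  shows "P (dim_col C) (C *\<^sub>v u)"
proof -
  have C: "C \<in> carrier_mat (dim_row C) (dim_col C)" by simp
  define trunc where "trunc k = vec (dim_col C) (\<lambda>l. if l < k then u $ l else 0)" for k
  have "P k (C *\<^sub>v trunc k)" if "k \<le> dim_col C" for k
    using that
  proof (induction k)
    case 0
    have "C *\<^sub>v trunc 0 = 0\<^sub>v (dim_row C)"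
      by (intro eq_vecI) (auto simp: trunc_def scalar_prod_def)
    then show ?case
      using zero by simp
  next
    case (Suc k)
    have "trunc (Suc k) = trunc k + u $ k \<cdot>\<^sub>v unit_vec (dim_col C) k"
      using Suc.prems by (intro eq_vecI) (auto simp: trunc_def less_Suc_eq unit_vec_def)
    then have "C *\<^sub>v trunc (Suc k) = C *\<^sub>v trunc k + u $ k \<cdot>\<^sub>v col C k"
      using Suc.prems by (simp add: mult_add_distrib_mat_vec[OF C] mult_mat_vec[OF C] trunc_def col_eq_mult_unit)
    moreover have "C *\<^sub>v trunc k \<in> im_space C"
      by (simp add: im_space_def trunc_def)
    ultimately show ?case
      using Suc.IH Suc.prems step[of k "C *\<^sub>v trunc k"] by simp
  qed
  moreover have "trunc (dim_col C) = u"
    using u by (intro eq_vecI) (auto simp: trunc_def)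
  ultimately show ?thesis
    using \<open>\<And>k. k \<le> dim_col C \<Longrightarrow> P k (C *\<^sub>v trunc k)\<close>[of "dim_col C"] by simp
qed

lemma dual_zero: "f \<in> dual_space C \<Longrightarrow> f (0\<^sub>v (dim_row C)) = 0"
proof -
  assume f: "f \<in> dual_space C"
  have "0 \<cdot>\<^sub>v 0\<^sub>v (dim_row C) = (0\<^sub>v (dim_row C) :: 'a vec)"
    by (intro eq_vecI) auto
  moreover have "f (0 \<cdot>\<^sub>v 0\<^sub>v (dim_row C)) = 0 * f (0\<^sub>v (dim_row C))"
    using f im_space_closed(1)[of C] unfolding dual_space_def by blast
  ultimately show ?thesis
    by simp
qed

text \<open>
  A linear form is only assumed to be additive on vectors of the image, which holds for the partial sums.
\<close>

lemma dual_apply: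
  assumes f: "f \<in> dual_space C" and u: "u \<in> carrier_vec (dim_col C)"
  shows "f (C *\<^sub>v u) = (\<Sum>l<dim_col C. u $ l * f (col C l))"
  using u
proof (induction rule: mat_vec_induct)
  case zero
  show ?case
    using dual_zero[OF f] by simp
next
  case (step k v)
  have add: "\<forall>v\<in>im_space C. \<forall>w\<in>im_space C. f (v + w) = f v + f w"
    and smult: "\<forall>c. \<forall>v\<in>im_space C. f (c \<cdot>\<^sub>v v) = c * f v"
    using f unfolding dual_space_def by blast+
  have c: "col C k \<in> im_space C" "u $ k \<cdot>\<^sub>v col C k \<in> im_space C"
    using col_in_im_space[OF step(1)] im_space_closed(3) by blast+
  have "f (v + u $ k \<cdot>\<^sub>v col C k) = f v + u $ k * f (col C k)"
    using add[rule_format, OF step(2) c(2)] smult[rule_format, OF c(1)] by simp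
  with step show ?case
    by simp
qed

lemma dual_combination:
  assumes "\<And>j. j < n \<Longrightarrow> \<upsilon> j \<in> dual_space C"
  shows "(\<lambda>v. \<Sum>j<n. c j * \<upsilon> j v) \<in> dual_space C"
  using assms by (simp add: dual_space_def algebra_simps sum.distrib sum_distrib_left)

lemma col_in_im_sub: "l < dim_col C \<Longrightarrow> l \<in> J \<Longrightarrow> col C l \<in> im_sub C J"
  unfolding im_sub_def
  by (intro CollectI exI[of _ "unit_vec (dim_col C) l"] conjI col_eq_mult_unit) auto

text \<open>
  A maximal independent subset of the columns in \<open>J\<close> has as many elements as the rank of \<open>C\<close>,
  so it is also maximal among all columns.
\<close>

lemma im_sub_eq_im_space:
  fixes C :: "'k::field mat"
  assumes J: "J \<subseteq> {..<dim_col C}" and rank: "mat_rank (submatrix C UNIV J) = mat_rank C"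
  shows "im_space C \<subseteq> im_sub C J"
proof -
  interpret vec_space "TYPE('k)" "dim_row C" .
  let ?D = "submatrix C UNIV J"
  have C: "C \<in> carrier_mat (dim_row C) (dim_col C)" by simp
  have D: "?D \<in> carrier_mat (dim_row C) (dim_col ?D)" and dimD: "dim_col ?D = card J"
  proof -
    have "{j. j < dim_col C \<and> j \<in> J} = J"
      using J by auto
    then show "dim_col ?D = card J"
      by (simp add: dim_submatrix)
    show "?D \<in> carrier_mat (dim_row C) (dim_col ?D)"
      by (intro carrier_matI) (simp_all add: dim_submatrix)
  qed
  have pick: "pick J k \<in> J" if "k < card J" for k
    using pick_in_set_le[OF that] .
  have colD: "col ?D k = col C (pick J k)" if k: "k < card J" for k
  proof (rule eq_vecI)
    have "pick J k < dim_col C"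
      using pick[OF k] J by auto
    then show "dim_vec (col ?D k) = dim_vec (col C (pick J k))"
      using D by auto
    fix i assume "i < dim_vec (col C (pick J k))"
    then have "i < dim_row C"
      by simp
    then show "col ?D k $ i = col C (pick J k) $ i"
      using k dimD D \<open>pick J k < dim_col C\<close> submatrix_index[of i C UNIV k J] dim_submatrix[of C UNIV J]
      by (simp add: pick_UNIV)
  qed
  have colsD: "set (cols ?D) \<subseteq> col C ` J"
    using colD pick dimD by (auto simp: cols_def)
  have setC: "set (cols C) = col C ` {..<dim_col C}"
    by (auto simp: cols_def)
  have colsC: "set (cols C) \<subseteq> carrier_vec (dim_row C)"
    using cols_dim[of C] by simp
  have DC: "set (cols ?D) \<subseteq> set (cols C)"
    using colsD J unfolding setC by blast
  have "lin_indpt {}"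
    by (meson finite_lin_indpt2 finite.emptyI empty_subsetI empty_iff)
  then obtain S where S: "maximal S (\<lambda>T. T \<subseteq> set (cols ?D) \<and> lin_indpt T)"
    using maximal_exists_superset[of "set (cols ?D)" "\<lambda>T. T \<subseteq> set (cols ?D) \<and> lin_indpt T" "{}"]
    by auto
  then have SD: "S \<subseteq> set (cols ?D)" and li: "lin_indpt S"
    by (auto simp: maximal_def)
  have "card S = rank C"
    using rank_card_indpt[OF D S] rank D by auto
  have span: "v \<in> span S" if v: "v \<in> set (cols C)" for v
  proof (cases "v \<in> S")
    case True
    then show ?thesis
      using SD DC colsC by (meson in_own_span subset_trans subsetD)
  next
    case False
    have fin: "finite S"
      using SD finite_subset by auto
    have "\<not> lin_indpt (S \<union> {v})"
    proof
      assume "lin_indpt (S \<union> {v})"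
      then have "card (S \<union> {v}) \<le> rank C"
        using SD DC v by (intro rank_ge_card_indpt[OF C]) auto
      then show False
        using \<open>card S = rank C\<close> False fin by simp
    qed
    then show ?thesis
      using lin_dep_iff_in_span[OF _ li _ False] SD DC colsC v by (simp add: subset_iff)
  qed
  have "submodule class_ring (im_sub C J) V"
    unfolding submodule_def
  proof (intro conjI ballI impI allI)
    show "im_sub C J \<subseteq> carrier V"
      using mult_mat_vec_carrier[OF C] by (auto simp: im_sub_def simp del: mult_mat_vec_carrier)
  qed (simp_all add: im_sub_closed class_ring_simps vec_module)
  moreover have "S \<subseteq> im_sub C J"
    using SD colsD J col_in_im_sub by blast
  ultimately have "span S \<subseteq> im_sub C J"
    using span_is_subset by blast
  then have cols: "col C l \<in> im_sub C J" if "l < dim_col C" for l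
    using span that unfolding setC by blast
  show ?thesis
  proof
    fix v assume "v \<in> im_space C"
    then obtain u where u: "u \<in> carrier_vec (dim_col C)" "v = C *\<^sub>v u"
      by (auto simp: im_space_def)
    have "C *\<^sub>v u \<in> im_sub C J"
      using u(1)
    proof (induction rule: mat_vec_induct)
      case zero
      show ?case by (rule im_sub_closed)
    next
      case (step k v)
      then show ?case
        using cols im_sub_closed(2,3)[of _ C J] by blast
    qed
    with u show "v \<in> im_sub C J" by simp
  qed
qed

text \<open>
  A vanishing minor would give a nonzero combination of the \<open>\<upsilon>\<^sub>j\<close> that vanishes on the columns in \<open>J\<close>,
  hence on \<open>V\<close>, against the uniqueness of coordinates in the dual basis.
\<close>

lemma uniform_columns_dual_basis:
  fixes C :: "'k::field mat"
  assumes unif: "uniform_rank C" and basis: "dual_basis C \<upsilon>"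
  shows "uniform_columns (dim_col C) (mat_rank C) (\<lambda>l j. \<upsilon> j (col C l))"
proof
  let ?r = "mat_rank C"
  show "?r \<le> dim_col C"
    by (rule vec_space.rank_le_nc[of C "dim_row C"]) simp
  fix J assume J: "J \<subseteq> {..<dim_col C}" "card J = ?r"
  let ?xs = "sorted_list_of_set J"
  define M where "M = mat ?r ?r (\<lambda>(j, k). \<upsilon> j (col C (?xs ! k)))"
  have fin: "finite J"
    using J finite_subset by blast
  show "minor ?r (\<lambda>l j. \<upsilon> j (col C l)) J \<noteq> 0"
  proof
    assume "minor ?r (\<lambda>l j. \<upsilon> j (col C l)) J = 0"
    then have "det M = 0"
      by (simp add: minor_def M_def)
    then have "det (transpose_mat M) = 0"
      by (subst det_transpose[of _ ?r]) (auto simp: M_def)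
    then obtain v where v: "v \<in> carrier_vec ?r" "v \<noteq> 0\<^sub>v ?r" "transpose_mat M *\<^sub>v v = 0\<^sub>v ?r"
      using det_0_iff_vec_prod_zero_field[of "transpose_mat M" ?r] by (auto simp: M_def)
    define f where "f w = (\<Sum>j<?r. v $ j * \<upsilon> j w)" for w
    have f: "f \<in> dual_space C"
      unfolding f_def using basis by (intro dual_combination) (auto simp: dual_basis_def)
    have "f (col C l) = 0" if "l \<in> J" for l
    proof -
      have "l \<in> set ?xs" "length ?xs = ?r"
        using that fin J(2) by auto
      then obtain k where k: "k < ?r" "l = ?xs ! k"
        by (metis in_set_conv_nth)
      have "f (col C l) = (transpose_mat M *\<^sub>v v) $ k"
        using k v(1) by (simp add: f_def M_def scalar_prod_def atLeast0LessThan mult.commute)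
      then show ?thesis
        using v(3) k by simp
    qed
    moreover have "im_space C \<subseteq> im_sub C J"
      using unif J by (intro im_sub_eq_im_space) (auto simp: uniform_rank_def)
    ultimately have "f w = 0" for w
    proof (cases "w \<in> im_space C")
      case True
      then obtain u where "u \<in> carrier_vec (dim_col C)" "w = C *\<^sub>v u"
        "\<forall>j<dim_col C. j \<notin> J \<longrightarrow> u $ j = 0"
        using \<open>im_space C \<subseteq> im_sub C J\<close> unfolding im_sub_def by blast
      then show ?thesis
        using dual_apply[OF f, of u] \<open>\<And>l. l \<in> J \<Longrightarrow> f (col C l) = 0\<close>
        by (auto intro!: sum.neutral)
    next
      case False
      then show ?thesis
        using f by (simp add: dual_space_def)
    qed
    then have f0: "f = (\<lambda>w. 0)"
      by auto
    define c where "c j = (if j < ?r then v $ j else 0)" for j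
    have "\<exists>!c. (\<forall>j\<ge>?r. c j = 0) \<and> f = (\<lambda>v. \<Sum>j<?r. c j * \<upsilon> j v)"
      using basis f by (simp add: dual_basis_def)
    then obtain c0 where c0: "\<And>c. (\<forall>j\<ge>?r. c j = 0) \<and> f = (\<lambda>v. \<Sum>j<?r. c j * \<upsilon> j v) \<Longrightarrow> c = c0"
      by (elim ex1E) blast
    have "c = c0"
      by (intro c0) (simp add: c_def f_def fun_eq_iff)
    moreover have "(\<lambda>_. 0) = c0"
      by (intro c0) (simp add: f0)
    ultimately have "c j = 0" for j
      by (simp add: fun_eq_iff)
    then have "v $ j = 0" if "j < ?r" for j
      using that unfolding c_def by (metis (full_types))
    then have "v = 0\<^sub>v ?r"
      using v(1) by (intro eq_vecI) auto
    with v(2) show False by simp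
  qed
qed

text \<open>
  Forms in the dual basis separate the points of \<open>V\<close>: a vector of \<open>V\<close> is a combination of \<open>r\<close>
  columns, whose coefficients are determined by the values of the forms because the minor is not zero.
\<close>

lemma kernel_iff_dual:
  fixes C :: "'k::field mat"
  assumes unif: "uniform_rank C" and basis: "dual_basis C \<upsilon>" and u: "u \<in> carrier_vec (dim_col C)"
  shows "C *\<^sub>v u = 0\<^sub>v (dim_row C) \<longleftrightarrow>
    (\<forall>j<mat_rank C. (\<Sum>l<dim_col C. u $ l * \<upsilon> j (col C l)) = 0)"
proof -
  interpret uniform_columns "dim_col C" "mat_rank C" "\<lambda>l j. \<upsilon> j (col C l)"
    by (rule uniform_columns_dual_basis[OF unif basis])
  have dual: "\<upsilon> j \<in> dual_space C" if "j < mat_rank C" for j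
    using basis that by (simp add: dual_basis_def)
  show ?thesis
  proof
    assume "C *\<^sub>v u = 0\<^sub>v (dim_row C)"
    then show "\<forall>j<mat_rank C. (\<Sum>l<dim_col C. u $ l * \<upsilon> j (col C l)) = 0"
      using dual_apply[OF dual u] dual_zero[OF dual] by simp
  next
    assume ker: "\<forall>j<mat_rank C. (\<Sum>l<dim_col C. u $ l * \<upsilon> j (col C l)) = 0"
    obtain J where J: "J \<subseteq> {..<dim_col C}" "card J = mat_rank C"
      using extend_face[of "{}"] by auto
    have "im_space C \<subseteq> im_sub C J"
      using unif J by (intro im_sub_eq_im_space) (auto simp: uniform_rank_def)
    moreover have "C *\<^sub>v u \<in> im_space C"
      using u by (simp add: im_space_def)
    ultimately obtain x where x: "x \<in> carrier_vec (dim_col C)" "C *\<^sub>v u = C *\<^sub>v x"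
      "\<forall>j<dim_col C. j \<notin> J \<longrightarrow> x $ j = 0"
      unfolding im_sub_def by blast
    have "(\<Sum>p\<in>J. x $ p * \<upsilon> j (col C p)) = 0" if j: "j < mat_rank C" for j
    proof -
      have "(\<Sum>p\<in>J. x $ p * \<upsilon> j (col C p)) = (\<Sum>p<dim_col C. x $ p * \<upsilon> j (col C p))"
        using J(1) x(3) by (intro sum.mono_neutral_left) auto
      also have "\<dots> = \<upsilon> j (C *\<^sub>v u)"
        using dual_apply[OF dual[OF j] x(1)] x(2) by simp
      also have "\<dots> = 0"
        using dual_apply[OF dual[OF j] u] ker j by simp
      finally show ?thesis .
    qed
    then have x0: "x $ p = 0" if "p \<in> J" for p
      using J that by (intro columns_independent[of J "\<lambda>p. x $ p"]) auto
    then have "x = 0\<^sub>v (dim_col C)"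
    proof (intro eq_vecI)
      fix i assume "i < dim_vec (0\<^sub>v (dim_col C))"
      then show "x $ i = 0\<^sub>v (dim_col C) $ i"
        using x(3) x0 by (cases "i \<in> J") auto
    qed (use x(1) in auto)
    then show "C *\<^sub>v u = 0\<^sub>v (dim_row C)"
      using x(2) by (intro eq_vecI) auto
  qed
qed

lemma annihilator_iff:
  fixes C :: "'k::field mat"
  assumes basis: "dual_basis C \<upsilon>" and X: "X \<subseteq> {..<dim_col C}"
  shows "(\<lambda>v. \<Sum>j<mat_rank C. c j * \<upsilon> j v) \<in> annihilator C X \<longleftrightarrow>
    (\<forall>l\<in>X. (\<Sum>j<mat_rank C. \<upsilon> j (col C l) * c j) = 0)"
proof -
  let ?f = "\<lambda>v. \<Sum>j<mat_rank C. c j * \<upsilon> j v"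
  have f: "?f \<in> dual_space C"
    using basis by (intro dual_combination) (auto simp: dual_basis_def)
  have "(\<forall>v\<in>im_sub C X. ?f v = 0) \<longleftrightarrow> (\<forall>l\<in>X. ?f (col C l) = 0)"
  proof
    assume "\<forall>v\<in>im_sub C X. ?f v = 0"
    then show "\<forall>l\<in>X. ?f (col C l) = 0"
      using col_in_im_sub X by blast
  next
    assume *: "\<forall>l\<in>X. ?f (col C l) = 0"
    show "\<forall>v\<in>im_sub C X. ?f v = 0"
    proof
      fix v assume "v \<in> im_sub C X"
      then obtain u where u: "u \<in> carrier_vec (dim_col C)" "v = C *\<^sub>v u"
        "\<forall>j<dim_col C. j \<notin> X \<longrightarrow> u $ j = 0"
        unfolding im_sub_def by blast
      have "u $ l * ?f (col C l) = 0" if "l < dim_col C" for l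
        using * u(3) that by (cases "l \<in> X") auto
      then show "?f v = 0"
        unfolding u(2) dual_apply[OF f u(1)] by (intro sum.neutral) auto
    qed
  qed
  with f show ?thesis
    by (simp add: annihilator_def mult.commute)
qed

lemma dual_space_eq_annihilator: "dual_space C = annihilator C {}"
proof -
  have "f v = 0" if f: "f \<in> dual_space C" and v: "v \<in> im_sub C {}" for f v
  proof -
    obtain u where "v = C *\<^sub>v u" "u \<in> carrier_vec (dim_col C)" "\<forall>j<dim_col C. u $ j = 0"
      using v unfolding im_sub_def by blast
    then have "v = 0\<^sub>v (dim_row C)"
      by (intro eq_vecI) (auto simp: scalar_prod_def)
    then show ?thesis
      using dual_zero[OF f] by simp
  qed
  then show ?thesis
    by (auto simp: annihilator_def)
qed

lemma scarf_face_iff: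
  assumes I: "I \<in> scarf_faces e dE"
  shows "I \<in> faces e" "face_below e dE (lcm_deg dE I) = I" "face_core e dE (lcm_deg dE I) = I"
proof -
  show face: "I \<in> faces e"
    using I by (simp add: scarf_faces_def)
  have unique: "J = I" if "J \<in> faces e" "lcm_deg dE J = lcm_deg dE I" for J
    using I that unfolding scarf_faces_def by force
  show "face_below e dE (lcm_deg dE I) = I"
    using unique face_below_lcm(2,3)[OF face] by metis
  have "{J \<in> faces e. lcm_deg dE J = lcm_deg dE I} = {I}"
    using unique face by blast
  then show "face_core e dE (lcm_deg dE I) = I"
    by (simp add: face_core_def)
qed

text \<open>
  Every face that carries a nonzero space has the form \<open>I\<^sub>\<alpha>\<close>; if \<open>\<alpha>\<close> is the multidegree of a
  Scarf face, then \<open>I\<^sub>\<alpha>\<close> is this face.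
\<close>

lemma scarf_system_eq:
  fixes C :: "'k::field mat" and dE :: "nat \<Rightarrow> 'n::finite mdegree"
  assumes basis: "dual_basis C \<upsilon>"
    and sys: "generic_system (dim_col C) (mat_rank C) (\<lambda>l j. \<upsilon> j (col C l)) dE"
    and I: "I \<subseteq> {..<dim_col C}"
  shows "scarf_system dE C \<upsilon> I =
    generic_system.scarf_space (dim_col C) (mat_rank C) (\<lambda>l j. \<upsilon> j (col C l)) dE I"
proof -
  interpret generic_system "dim_col C" "mat_rank C" "\<lambda>l j. \<upsilon> j (col C l)" dE
    by (rule sys)
  let ?r = "mat_rank C" and ?e = "dim_col C"
  have dpow: "dpow C \<upsilon> n (annihilator C X) = dp_hom ?r n \<inter> kill X" if "X \<subseteq> {..<?e}" for n X
    using that annihilator_iff[OF basis that] by (intro dpow_eq_kill) auto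
  show ?thesis
  proof (cases "card I \<le> ?r")
    case True
    then show ?thesis
      by (simp add: scarf_system_def scarf_space_def Let_def)
  next
    case False
    then have face: "I \<in> faces ?e"
      using I by (auto simp: faces_def)
    show ?thesis
    proof (cases "I \<in> scarf_faces ?e dE")
      case True
      have "upper (mdeg I) = {}"
        using scarf_face_iff[OF True] by (simp add: face_upper_def)
      then show ?thesis
        using False True dpow[of "{}"] scarf_face_iff(2)[OF True]
        by (simp add: scarf_system_def scarf_space_def Let_def dual_space_eq_annihilator)
    next
      case nonscarf: False
      have eq: "\<alpha> = mdeg I" if \<alpha>: "\<alpha> \<in> non_scarf_degs ?e dE" "I = below \<alpha>" for \<alpha>
      proof -
        obtain K where "K \<in> faces ?e" "\<alpha> = mdeg K"
          using \<alpha>(1) by (auto simp: non_scarf_degs_def lcm_lattice_def)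
        then show ?thesis
          using \<alpha>(2) face_below_lcm(3)[of K ?e dE] by simp
      qed
      show ?thesis
      proof (cases "\<exists>\<alpha>\<in>non_scarf_degs ?e dE. I = below \<alpha>")
        case True
        then have \<alpha>: "mdeg I \<in> non_scarf_degs ?e dE" "I = below (mdeg I)"
          using eq by auto
        have "(THE \<alpha>. \<alpha> \<in> non_scarf_degs ?e dE \<and> I = below \<alpha>) = mdeg I"
          using \<alpha> eq by (intro the_equality) auto
        moreover have "upper (mdeg I) \<subseteq> {..<?e}"
          by (auto simp: face_upper_def face_below_def)
        ultimately show ?thesis
          using False nonscarf True \<alpha>(2) dpow
          by (simp add: scarf_system_def scarf_space_def Let_def)
      next
        case none: False
        have "I \<noteq> below (mdeg I)"
        proof
          assume closed: "I = below (mdeg I)"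
          have "mdeg I \<notin> mdeg ` scarf_faces ?e dE"
          proof
            assume "mdeg I \<in> mdeg ` scarf_faces ?e dE"
            then obtain K where "K \<in> scarf_faces ?e dE" "mdeg K = mdeg I"
              by auto
            then have "I = K"
              using face unfolding scarf_faces_def by force
            then show False
              using nonscarf \<open>K \<in> scarf_faces ?e dE\<close> by simp
          qed
          then show False
            using none closed face by (auto simp: non_scarf_degs_def lcm_lattice_def)
        qed
        then show ?thesis
          using False nonscarf none by (simp add: scarf_system_def scarf_space_def Let_def)
      qed
    qed
  qed
qed

section \<open>Graded modules over the polynomial ring\<close>

lemma mdeg_diff_add: "a \<preceq> b \<Longrightarrow> b - a + a = b"
  unfolding mdeg_le_def by (intro poly_mapping_eqI) (simp add: lookup_minus lookup_add)

lemma mdeg_add_le [simp]: "a \<preceq> b + a"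
  by (simp add: mdeg_le_def lookup_add)

lemma mdeg_zero_le [simp]: "0 \<preceq> k"
  by (simp add: mdeg_le_def)

lemma lookup_mult_single:
  fixes q :: "('n, 'k::comm_ring_1) mpolys"
  shows "lookup (q * Poly_Mapping.single n s) k = (if n \<preceq> k then lookup q (k - n) * s else 0)"
proof -
  have eq: "b + n = k \<longleftrightarrow> n \<preceq> k \<and> b = k - n" for b
  proof
    assume "b + n = k"
    then show "n \<preceq> k \<and> b = k - n"
      using mdeg_add_le[of n b] by auto
  qed (auto simp: mdeg_diff_add)
  have "q * Poly_Mapping.single n s = (\<Sum>b\<in>keys q. Poly_Mapping.single (b + n) (lookup q b * s))"
  proof -
    have "(\<Sum>b\<in>keys q. Poly_Mapping.single b (lookup q b)) * Poly_Mapping.single n s =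
        (\<Sum>b\<in>keys q. Poly_Mapping.single (b + n) (lookup q b * s))"
      by (simp add: sum_distrib_right mult_single)
    then show ?thesis
      by (simp only: sum_singles)
  qed
  then have "lookup (q * Poly_Mapping.single n s) k =
      (\<Sum>b\<in>keys q. if n \<preceq> k \<and> b = k - n then lookup q b * s else 0)"
    by (simp add: lookup_sum lookup_single when_def eq)
  also have "\<dots> = (if n \<preceq> k then lookup q (k - n) * s else 0)"
    by (cases "n \<preceq> k") (auto simp: in_keys_iff)
  finally show ?thesis .
qed

lemma single_sum: "(\<Sum>i\<in>S. Poly_Mapping.single k (f i)) = Poly_Mapping.single k (\<Sum>i\<in>S. f i)"
  by (induction S rule: infinite_finite_induct) (auto simp: single_add)

text \<open>
  Subtraction of multidegrees is truncated, which is harmless above \<open>a\<close>.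
\<close>

lemma mdeg_diff_le:
  assumes "a \<preceq> b" "a \<preceq> c"
  shows "b - a \<preceq> c - a \<longleftrightarrow> b \<preceq> c" "b \<preceq> c \<Longrightarrow> c - a - (b - a) = c - b"
proof -
  show "b - a \<preceq> c - a \<longleftrightarrow> b \<preceq> c"
    using assms unfolding mdeg_le_def lookup_minus by (metis diff_le_mono le_diff_iff)
  show "c - a - (b - a) = c - b"
    using assms unfolding mdeg_le_def by (intro poly_mapping_eqI) (simp add: lookup_minus)
qed

subsection \<open>Free modules\<close>

lemma sum_scaled_singles: "(\<Sum>u\<in>keys x. pm_scale (lookup x u) (Poly_Mapping.single u 1)) = x"
  using sum_singles[of x] by simp

lemma pm_free_iff: "x \<in> pm_free S \<longleftrightarrow> keys x \<subseteq> S"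
proof
  assume "x \<in> pm_free S"
  then show "keys x \<subseteq> S"
    unfolding pm_free_def
  proof (induction rule: pm.span_induct_alt)
    case (step c y z)
    have "keys (pm_scale c y + z) \<subseteq> keys (pm_scale c y) \<union> keys z"
      by (rule Poly_Mapping.keys_add)
    with step show ?case
      by (auto simp: in_keys_iff lookup_pm_scale lookup_single when_def split: if_splits)
  qed simp
next
  assume "keys x \<subseteq> S"
  then have "(\<Sum>u\<in>keys x. pm_scale (lookup x u) (Poly_Mapping.single u 1)) \<in> pm_free S"
    unfolding pm_free_def by (intro pm.span_sum pm.span_scale pm.span_base) auto
  then show "x \<in> pm_free S"
    by (simp only: sum_scaled_singles)
qed

lemma finite_free_pm_free:
  fixes deg :: "'b \<Rightarrow> 'n mdegree"
  assumes "finite S"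
  shows "finite_free_multigraded deg (pm_free S :: ('b \<Rightarrow>\<^sub>0 ('n, 'k::comm_ring_1) mpolys) set)"
proof -
  let ?B = "(\<lambda>u. Poly_Mapping.single u (1 :: ('n, 'k) mpolys)) ` S"
  show ?thesis
    unfolding finite_free_multigraded_def
  proof (rule exI[of _ ?B], intro conjI ballI)
  show "finite ?B"
    using assms by simp
  show "pm.span ?B = pm_free S"
    by (simp add: pm_free_def)
  show "pm.independent ?B"
    unfolding pm.independent_explicit_module
  proof (intro allI impI)
    fix t u v
    assume t: "finite t" "t \<subseteq> ?B" and sum: "(\<Sum>v\<in>t. pm_scale (u v) v) = 0" and v: "v \<in> t"
    obtain w where w: "v = Poly_Mapping.single w 1"
      using t v by auto
    have "lookup (pm_scale (u x) x) w = (if x = v then u v else 0)" if "x \<in> t" for x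
      using t(2) that w by (auto simp: lookup_pm_scale lookup_single when_def)
    then have "lookup (\<Sum>v\<in>t. pm_scale (u v) v) w = u v"
      using t(1) v by (simp add: lookup_sum)
    with sum show "u v = 0" by simp
  qed
  fix x assume "x \<in> ?B"
  then show "\<exists>a. x \<in> hcomp deg a"
    by (auto simp: hcomp_def)
  qed
qed

subsection \<open>The irrelevant ideal\<close>

interpretation ring_module: Modules.module "(*) :: 'r::comm_ring_1 \<Rightarrow> 'r \<Rightarrow> 'r"
  by unfold_locales (simp_all add: algebra_simps)

text \<open>Split off one variable that occurs in the monomial.\<close>

lemma single_in_max_ideal:
  fixes c :: "'k::comm_ring_1"
  assumes "n \<noteq> 0"
  shows "Poly_Mapping.single n c \<in> max_ideal"
proof -
  obtain t where t: "lookup n t \<noteq> 0"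
    using assms by (metis poly_mapping_eqI lookup_zero)
  let ?x = "Poly_Mapping.single t (1::nat)"
  have "n - ?x + ?x = n"
    using t by (intro mdeg_diff_add) (auto simp: mdeg_le_def lookup_single when_def)
  then have "Poly_Mapping.single n c = Poly_Mapping.single (n - ?x) c * Poly_Mapping.single ?x 1"
    by (simp only: mult_single mult_1_right)
  then show ?thesis
    unfolding max_ideal_def by (metis ring_module.span_base ring_module.span_scale rangeI)
qed

lemma lookup_mult_0:
  fixes p q :: "('n, 'k::comm_ring_1) mpolys"
  assumes "lookup q 0 = 0"
  shows "lookup (p * q) 0 = 0"
proof -
  have "lookup (\<Sum>b\<in>keys q. p * Poly_Mapping.single b (lookup q b)) 0 = 0"
    unfolding lookup_sum lookup_mult_single
  proof (intro sum.neutral ballI)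
    fix b assume "b \<in> keys q"
    then have "b \<noteq> 0"
      using assms by (metis in_keys_iff)
    then have "\<not> b \<preceq> 0"
      by (auto simp: mdeg_le_def poly_mapping_eq_iff fun_eq_iff)
    then show "(if b \<preceq> 0 then lookup p (0 - b) * lookup q b else 0) = 0"
      by simp
  qed
  then show ?thesis
    by (simp only: sum_distrib_left[symmetric] sum_singles)
qed

lemma max_ideal_lookup_0:
  assumes "q \<in> (max_ideal :: ('n, 'k::comm_ring_1) mpolys set)"
  shows "lookup q 0 = 0"
  using assms unfolding max_ideal_def
proof (induction rule: ring_module.span_induct_alt)
  case (step c x y)
  then obtain t where "x = Poly_Mapping.single (Poly_Mapping.single t 1) 1"
    by auto
  moreover have "Poly_Mapping.single t (1::nat) \<noteq> 0"
    by (metis lookup_single_eq lookup_zero zero_neq_one)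
  ultimately have "lookup x 0 = 0"
    by (simp add: lookup_single when_def)
  with step show ?case
    by (simp add: lookup_add lookup_mult_0)
qed simp

lemma max_ideal_times_lookup_0:
  assumes "x \<in> max_ideal_times N"
  shows "lookup (lookup x u) 0 = 0"
  using assms unfolding max_ideal_times_def
proof (induction rule: pm.span_induct_alt)
  case (step c x y)
  then obtain q z where "x = pm_scale q z" "q \<in> max_ideal"
    by auto
  then have "lookup (lookup x u) 0 = 0"
    by (simp add: lookup_pm_scale mult.commute[of q] lookup_mult_0 max_ideal_lookup_0)
  with step show ?case
    by (simp add: lookup_add lookup_pm_scale lookup_mult_0)
qed simp

lemma max_ideal_times_subset:
  assumes "pm.subspace N"
  shows "max_ideal_times N \<subseteq> N"
  unfolding max_ideal_times_def
  using assms by (intro pm.span_minimal) (auto simp: pm.subspace_def)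

subsection \<open>Homogenization\<close>

text \<open>
  Stated for any finite \<open>S\<close> containing the support, so that it also shows linearity.
\<close>

lemma lookup_homogenization:
  fixes x :: "'b \<Rightarrow>\<^sub>0 ('n, 'k::field) mpolys"
  assumes "finite S" "keys x \<subseteq> S"
  shows "lookup (homogenization deg f x) v =
    (\<Sum>u\<in>S. lookup x u * Poly_Mapping.single (deg u - deg v) (lookup (f u) v))"
proof -
  have "lookup (homogenization deg f x) v = (\<Sum>u\<in>keys x. \<Sum>w\<in>keys (f u).
      if w = v then lookup x u * Poly_Mapping.single (deg u - deg v) (lookup (f u) v) else 0)"
    unfolding homogenization_def lookup_sum lookup_single when_def by (intro sum.cong) auto
  also have "\<dots> = (\<Sum>u\<in>keys x. lookup x u * Poly_Mapping.single (deg u - deg v) (lookup (f u) v))"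
    by (intro sum.cong) (auto simp: in_keys_iff)
  also have "\<dots> = (\<Sum>u\<in>S. lookup x u * Poly_Mapping.single (deg u - deg v) (lookup (f u) v))"
    using assms by (intro sum.mono_neutral_left) (auto simp: in_keys_iff)
  finally show ?thesis .
qed

lemma homogenization_add:
  "homogenization deg f (x + y) = homogenization deg f x + homogenization deg f y"
proof (rule poly_mapping_eqI)
  fix v
  have "keys (x + y) \<subseteq> keys x \<union> keys y"
    by (rule Poly_Mapping.keys_add)
  then show "lookup (homogenization deg f (x + y)) v =
      lookup (homogenization deg f x + homogenization deg f y) v"
    using lookup_homogenization[of "keys x \<union> keys y" x deg f v]
      lookup_homogenization[of "keys x \<union> keys y" y deg f v]
      lookup_homogenization[of "keys x \<union> keys y" "x + y" deg f v]
    by (simp add: lookup_add distrib_right sum.distrib)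
qed

lemma homogenization_scale: "homogenization deg f (pm_scale q x) = pm_scale q (homogenization deg f x)"
proof (rule poly_mapping_eqI)
  fix v
  show "lookup (homogenization deg f (pm_scale q x)) v = lookup (pm_scale q (homogenization deg f x)) v"
    unfolding lookup_homogenization[OF finite_keys keys_pm_scale[of q x]] lookup_pm_scale
      lookup_homogenization[OF finite_keys subset_refl[of "keys x"]] sum_distrib_left
    by (simp only: mult.assoc)
qed

lemma homogenization_0: "homogenization deg f 0 = 0"
  by (simp add: homogenization_def)

lemma lookup_ups_elem:
  "lookup (ups_elem I y) (Ups b J) = (if J = I then Poly_Mapping.single 0 (lookup y b) else 0)"
  "lookup (ups_elem I y) (Eps l) = 0" "lookup (ups_elem I y) (Gam i) = 0"
proof -
  have "lookup (ups_elem I y) (Ups b J) =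
      (\<Sum>c\<in>keys y. if c = b then (if J = I then Poly_Mapping.single 0 (lookup y b) else 0) else 0)"
    unfolding ups_elem_def lookup_sum by (intro sum.cong) (auto simp: lookup_single when_def)
  also have "\<dots> = (if b \<in> keys y then (if J = I then Poly_Mapping.single 0 (lookup y b) else 0) else 0)"
    by (subst sum.delta) auto
  also have "\<dots> = (if J = I then Poly_Mapping.single 0 (lookup y b) else 0)"
    by (simp add: in_keys_iff)
  finally show "lookup (ups_elem I y) (Ups b J) = (if J = I then Poly_Mapping.single 0 (lookup y b) else 0)" .
qed (simp_all add: ups_elem_def lookup_sum lookup_single)

lemma ups_elem_0 [simp]: "ups_elem I 0 = 0"
  by (simp add: ups_elem_def)

lemma keys_ups_elem: "keys (ups_elem I y) \<subseteq> (\<lambda>b. Ups b I) ` keys y"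
proof
  fix u assume "u \<in> keys (ups_elem I y)"
  then show "u \<in> (\<lambda>b. Ups b I) ` keys y"
  proof (cases u)
    case (Ups b J)
    then have "J = I" "lookup y b \<noteq> 0"
      using \<open>u \<in> keys (ups_elem I y)\<close> by (auto simp: in_keys_iff lookup_ups_elem split: if_splits)
    then show ?thesis
      using Ups by (simp add: in_keys_iff)
  qed (use \<open>u \<in> keys (ups_elem I y)\<close> in \<open>simp_all add: in_keys_iff lookup_ups_elem\<close>)
qed

lemma lookup_homogenization_ups_elem:
  fixes y :: "(nat \<Rightarrow>\<^sub>0 nat) \<Rightarrow>\<^sub>0 'k::field"
  shows "lookup (homogenization deg f (ups_elem I y)) v =
    (\<Sum>b\<in>keys y. Poly_Mapping.single (deg (Ups b I) - deg v) (lookup y b * lookup (f (Ups b I)) v))"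
proof -
  have "lookup (homogenization deg f (ups_elem I y)) v = (\<Sum>u\<in>(\<lambda>b. Ups b I) ` keys y.
      lookup (ups_elem I y) u * Poly_Mapping.single (deg u - deg v) (lookup (f u) v))"
    using keys_ups_elem by (intro lookup_homogenization) auto
  then show ?thesis
    by (simp add: sum.reindex inj_on_def lookup_ups_elem mult_single)
qed

text \<open>
  On an element \<open>y \<otimes> \<epsilon>\<^sub>I\<close> the homogenized differential is the Koszul differential with monomial
  coefficients.
\<close>

lemma homogenization_br_map_ge3:
  fixes y :: "(nat \<Rightarrow>\<^sub>0 nat) \<Rightarrow>\<^sub>0 'k::field" and dE :: "nat \<Rightarrow> 'n::finite mdegree"
  assumes i: "3 \<le> i" and I: "finite I"
  shows "homogenization (br_deg dE dG) (br_map C \<upsilon> i) (ups_elem I y) =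
    (\<Sum>l\<in>I. pm_scale (Poly_Mapping.single (lcm_deg dE I - lcm_deg dE (I - {l})) (face_sgn l I))
      (ups_elem (I - {l}) (contr (mat_rank C) (\<lambda>j. \<upsilon> j (col C l)) y)))"
    (is "?L = ?R")
proof (rule poly_mapping_eqI)
  fix v
  let ?r = "mat_rank C"
  have i2: "i \<noteq> 2"
    using i by simp
  show "lookup ?L v = lookup ?R v"
  proof (cases v)
    case (Ups c J)
    have exponent: "lookup b j \<noteq> 0 \<and> b - Poly_Mapping.single j 1 = c \<longleftrightarrow> b = c + Poly_Mapping.single j (1::nat)"
      for b j
      by (auto simp: poly_mapping_eq_iff fun_eq_iff lookup_add lookup_minus lookup_single when_def)
    have br: "lookup (br_map C \<upsilon> i (Ups b I)) v = (\<Sum>l\<in>I. \<Sum>j<?r.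
        if I - {l} = J then face_sgn l I * (\<upsilon> j (col C l) * (if b = c + Poly_Mapping.single j 1 then 1 else 0)) else 0)" for b
    proof -
      have "lookup (br_map C \<upsilon> i (Ups b I)) v = (\<Sum>j<?r. \<Sum>l\<in>I.
          if I - {l} = J then face_sgn l I * (\<upsilon> j (col C l) * (if b = c + Poly_Mapping.single j 1 then 1 else 0)) else 0)"
        using i unfolding Ups exponent[symmetric] br_map.simps if_P[OF i] lookup_sum
        by (intro sum.cong refl) (auto simp: lookup_single when_def)
      then show ?thesis
        by (simp only: sum.swap[of _ I])
    qed
    have pick: "(\<Sum>b\<in>keys y. lookup y b * (if b = d then 1 else 0)) = lookup y d" for d
    proof -
      have "(\<Sum>b\<in>keys y. lookup y b * (if b = d then 1 else 0)) = (\<Sum>b\<in>keys y. if b = d then lookup y d else 0)"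
        by (intro sum.cong) auto
      then show ?thesis
        by (simp add: in_keys_iff)
    qed
    have "(\<Sum>b\<in>keys y. lookup y b * lookup (br_map C \<upsilon> i (Ups b I)) v) =
        (\<Sum>l\<in>I. if I - {l} = J then face_sgn l I * (\<Sum>j<?r. \<upsilon> j (col C l) *
          (\<Sum>b\<in>keys y. lookup y b * (if b = c + Poly_Mapping.single j 1 then 1 else 0))) else 0)"
    proof -
      have "(\<Sum>b\<in>keys y. lookup y b * lookup (br_map C \<upsilon> i (Ups b I)) v) =
        (\<Sum>l\<in>I. \<Sum>j<?r. \<Sum>b\<in>keys y. lookup y b *
          (if I - {l} = J then face_sgn l I * (\<upsilon> j (col C l) * (if b = c + Poly_Mapping.single j 1 then 1 else 0)) else 0))"
        unfolding br sum_distrib_left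
        by (subst sum.swap, intro sum.cong refl, rule sum.swap)
      also have "\<dots> = (\<Sum>l\<in>I. if I - {l} = J then face_sgn l I * (\<Sum>j<?r. \<upsilon> j (col C l) *
          (\<Sum>b\<in>keys y. lookup y b * (if b = c + Poly_Mapping.single j 1 then 1 else 0))) else 0)"
      proof (intro sum.cong refl)
        fix l
        show "(\<Sum>j<?r. \<Sum>b\<in>keys y. lookup y b * (if I - {l} = J then face_sgn l I *
            (\<upsilon> j (col C l) * (if b = c + Poly_Mapping.single j 1 then 1 else 0)) else 0)) =
          (if I - {l} = J then face_sgn l I * (\<Sum>j<?r. \<upsilon> j (col C l) *
            (\<Sum>b\<in>keys y. lookup y b * (if b = c + Poly_Mapping.single j 1 then 1 else 0))) else 0)"
          by (cases "I - {l} = J") (simp_all only: simp_thms if_True if_False mult_zero_right sum.neutral_const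
              sum_distrib_left mult.left_commute)
      qed
      finally show ?thesis .
    qed
    also have "\<dots> = (\<Sum>l\<in>I. if I - {l} = J then face_sgn l I *
        lookup (contr ?r (\<lambda>j. \<upsilon> j (col C l)) y) c else 0)"
      by (simp only: pick lookup_contr)
    finally have sum: "(\<Sum>b\<in>keys y. lookup y b * lookup (br_map C \<upsilon> i (Ups b I)) v) = \<dots>" .
    have "lookup ?L v = Poly_Mapping.single (lcm_deg dE I - lcm_deg dE J)
        (\<Sum>l\<in>I. if I - {l} = J then face_sgn l I * lookup (contr ?r (\<lambda>j. \<upsilon> j (col C l)) y) c else 0)"
      unfolding lookup_homogenization_ups_elem sum[symmetric] single_sum[symmetric] by (simp add: Ups)
    also have "\<dots> = lookup ?R v"
      unfolding lookup_sum Ups lookup_pm_scale lookup_ups_elem single_sum[symmetric]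
      by (intro sum.cong refl) (auto simp: mult_single)
    finally show ?thesis .
  qed (use i i2 in \<open>simp_all add: lookup_homogenization_ups_elem lookup_sum lookup_pm_scale lookup_ups_elem
      lookup_single when_def if_distrib[of "\<lambda>p. lookup p _"] cong: if_cong\<close>)
qed

lemma homogenization_br_map_2:
  fixes y :: "(nat \<Rightarrow>\<^sub>0 nat) \<Rightarrow>\<^sub>0 'k::field" and dE :: "nat \<Rightarrow> 'n::finite mdegree"
  assumes I: "finite I" and y: "y \<in> dp_hom r 0"
  shows "homogenization (br_deg dE dG) (br_map C \<upsilon> 2) (ups_elem I y) =
    (\<Sum>l\<in>I. pm_scale (Poly_Mapping.single (lcm_deg dE I - dE l)
      (face_sgn l I * minor (mat_rank C) (\<lambda>l j. \<upsilon> j (col C l)) (I - {l}) * lookup y 0))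
      (Poly_Mapping.single (Eps l) 1))"
    (is "?L = ?R")
proof (rule poly_mapping_eqI)
  fix v
  let ?c = "\<lambda>l. face_sgn l I * minor (mat_rank C) (\<lambda>l j. \<upsilon> j (col C l)) (I - {l})"
  have br: "lookup (br_map C \<upsilon> 2 (Ups b I)) v = (\<Sum>l\<in>I. if v = Eps l then ?c l else 0)" for b
    by (auto simp: lookup_sum lookup_single when_def minor_def intro!: sum.cong)
  have "keys y \<subseteq> {0}"
    using dp_hom_0_const[OF y] by (metis keys_pm_scale keys_single order_trans subset_refl single_one keys_one)
  then have pick: "(\<Sum>b\<in>keys y. lookup y b * k) = lookup y 0 * k" for k
    by (cases "0 \<in> keys y") (auto simp: in_keys_iff subset_singleton_iff)
  have "lookup ?L v = Poly_Mapping.single (lcm_deg dE I - br_deg dE dG v)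
      (\<Sum>b\<in>keys y. lookup y b * (\<Sum>l\<in>I. if v = Eps l then ?c l else 0))"
    unfolding lookup_homogenization_ups_elem br by (simp add: single_sum)
  also have "\<dots> = (\<Sum>l\<in>I. if v = Eps l then Poly_Mapping.single (lcm_deg dE I - dE l) (?c l * lookup y 0) else 0)"
  proof -
    have "lookup y 0 * (\<Sum>l\<in>I. if v = Eps l then ?c l else 0) =
        (\<Sum>l\<in>I. if v = Eps l then ?c l * lookup y 0 else 0)"
      unfolding sum_distrib_left by (intro sum.cong) (auto simp: mult.commute)
    then show ?thesis
      unfolding pick by (simp only:) (auto simp: single_sum[symmetric] intro!: sum.cong)
  qed
  also have "\<dots> = lookup ?R v"
    unfolding lookup_sum lookup_pm_scale lookup_single when_def by (intro sum.cong) auto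
  finally show "lookup ?L v = lookup ?R v" .
qed

subsection \<open>Multigraded components\<close>

text \<open>
  The part of \<open>x\<close> of multidegree \<open>\<alpha>\<close> is determined by its coefficients in the divided powers at the faces
  (\<open>dcomp\<close>) and at the \<open>\<epsilon>\<^sub>l\<close> (\<open>ecomp\<close>), the monomials being forced by \<open>\<alpha>\<close>. Where the monomial would have
  to have a negative exponent the coefficient is \<open>0\<close>.
\<close>

definition dcomp ::
  "(nat \<Rightarrow> 'n::finite mdegree) \<Rightarrow> 'n mdegree \<Rightarrow> (br_sym \<Rightarrow>\<^sub>0 ('n, 'k::field) mpolys) \<Rightarrow> nat set \<Rightarrow>
   ((nat \<Rightarrow>\<^sub>0 nat) \<Rightarrow>\<^sub>0 'k)" where
  "dcomp dE \<alpha> x I = Abs_poly_mapping (\<lambda>b. if lcm_deg dE I \<preceq> \<alpha>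
     then lookup (lookup x (Ups b I)) (\<alpha> - lcm_deg dE I) else 0)"

definition ecomp ::
  "(nat \<Rightarrow> 'n mdegree) \<Rightarrow> 'n mdegree \<Rightarrow> (br_sym \<Rightarrow>\<^sub>0 ('n, 'k::field) mpolys) \<Rightarrow> nat \<Rightarrow> 'k" where
  "ecomp dE \<alpha> x l = (if dE l \<preceq> \<alpha> then lookup (lookup x (Eps l)) (\<alpha> - dE l) else 0)"

lemma lookup_dcomp:
  "lookup (dcomp dE \<alpha> x I) b =
    (if lcm_deg dE I \<preceq> \<alpha> then lookup (lookup x (Ups b I)) (\<alpha> - lcm_deg dE I) else 0)"
proof -
  have "{b. lookup (lookup x (Ups b I)) (\<alpha> - lcm_deg dE I) \<noteq> 0} \<subseteq> (\<lambda>u. case u of Ups b _ \<Rightarrow> b) ` keys x"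
  proof
    fix b assume "b \<in> {b. lookup (lookup x (Ups b I)) (\<alpha> - lcm_deg dE I) \<noteq> 0}"
    then have "Ups b I \<in> keys x"
      by (auto simp: in_keys_iff)
    then show "b \<in> (\<lambda>u. case u of Ups b _ \<Rightarrow> b) ` keys x"
      by (rule image_eqI[rotated]) simp
  qed
  then have "finite {b. (if lcm_deg dE I \<preceq> \<alpha> then lookup (lookup x (Ups b I)) (\<alpha> - lcm_deg dE I) else 0) \<noteq> 0}"
    by (auto intro: finite_subset)
  then show ?thesis
    unfolding dcomp_def by (subst lookup_Abs_poly_mapping) auto
qed

lemma dcomp_add: "dcomp dE \<alpha> (x + y) I = dcomp dE \<alpha> x I + dcomp dE \<alpha> y I"
  by (rule poly_mapping_eqI) (simp add: lookup_dcomp lookup_add)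

lemma dcomp_0 [simp]: "dcomp dE \<alpha> 0 I = 0"
  by (rule poly_mapping_eqI) (simp add: lookup_dcomp)

lemma dcomp_sum: "dcomp dE \<alpha> (sum f S) I = (\<Sum>i\<in>S. dcomp dE \<alpha> (f i) I)"
  by (induction S rule: infinite_finite_induct) (auto simp: dcomp_add)

lemma dcomp_ups_elem:
  "dcomp dE \<alpha> (pm_scale q (ups_elem I y)) J =
    (if J = I \<and> lcm_deg dE I \<preceq> \<alpha> then pm_scale (lookup q (\<alpha> - lcm_deg dE I)) y else 0)"
proof (rule poly_mapping_eqI)
  fix b
  show "lookup (dcomp dE \<alpha> (pm_scale q (ups_elem I y)) J) b = lookup
      (if J = I \<and> lcm_deg dE I \<preceq> \<alpha> then pm_scale (lookup q (\<alpha> - lcm_deg dE I)) y else 0) b"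
    by (auto simp: lookup_dcomp lookup_pm_scale lookup_ups_elem lookup_mult_single)
qed

lemma ecomp_add: "ecomp dE \<alpha> (x + y) l = ecomp dE \<alpha> x l + ecomp dE \<alpha> y l"
  by (simp add: ecomp_def lookup_add)

lemma ecomp_0 [simp]: "ecomp dE \<alpha> 0 l = 0"
  by (simp add: ecomp_def)

lemma ecomp_sum: "ecomp dE \<alpha> (sum f S) l = (\<Sum>i\<in>S. ecomp dE \<alpha> (f i) l)"
  by (induction S rule: infinite_finite_induct) (auto simp: ecomp_add)

text \<open>
  A monomial \<open>k\<close> at the face \<open>I\<close> is seen in multidegree \<open>k + |\<epsilon>\<^sub>I|\<close>.
\<close>

lemma poly_eq_by_dcomp:
  assumes "keys x \<subseteq> {u. \<exists>b I. u = Ups b I}" "keys y \<subseteq> {u. \<exists>b I. u = Ups b I}"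
    and "\<And>\<alpha> I. dcomp dE \<alpha> x I = dcomp dE \<alpha> y I"
  shows "x = y"
proof (rule poly_mapping_eqI)
  fix u
  show "lookup x u = lookup y u"
  proof (cases u)
    case (Ups b I)
    show ?thesis
    proof (rule poly_mapping_eqI)
      fix k
      show "lookup (lookup x u) k = lookup (lookup y u) k"
        using arg_cong[OF assms(3)[of "k + lcm_deg dE I" I], of "\<lambda>z. lookup z b"]
        by (simp add: lookup_dcomp Ups)
    qed
  next
    case (Gam i)
    show ?thesis
    proof -
      have "u \<notin> keys x" "u \<notin> keys y"
        using assms(1,2) Gam by auto
      then show ?thesis
        by (simp add: in_keys_iff)
    qed
  next
    case (Eps l)
    show ?thesis
    proof -
      have "u \<notin> keys x" "u \<notin> keys y"
        using assms(1,2) Eps by auto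
      then show ?thesis
        by (simp add: in_keys_iff)
    qed
  qed
qed

lemma poly_eq_by_ecomp:
  assumes "keys x \<subseteq> Eps ` {..<e}" "keys y \<subseteq> Eps ` {..<e}"
    and "\<And>\<alpha> l. l < e \<Longrightarrow> ecomp dE \<alpha> x l = ecomp dE \<alpha> y l"
  shows "x = y"
proof (rule poly_mapping_eqI)
  fix u
  show "lookup x u = lookup y u"
  proof (cases "u \<in> Eps ` {..<e}")
    case True
    then obtain l where l: "l < e" "u = Eps l"
      by auto
    show ?thesis
    proof (rule poly_mapping_eqI)
      fix k
      show "lookup (lookup x u) k = lookup (lookup y u) k"
        using assms(3)[OF l(1), of "k + dE l"] by (simp add: ecomp_def l)
    qed
  next
    case False
    then have "u \<notin> keys x" "u \<notin> keys y"
      using assms by auto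
    then show ?thesis
      by (simp add: in_keys_iff)
  qed
qed

section \<open>The Scarf complex over the polynomial ring\<close>

lemma mdeg_diff_nonzero: "a \<preceq> b \<Longrightarrow> a \<noteq> b \<Longrightarrow> b - a \<noteq> 0"
  using mdeg_diff_add[of a b] by auto

interpretation pv: vector_space "pm_scale :: 'k::field \<Rightarrow> ('b \<Rightarrow>\<^sub>0 'k) \<Rightarrow> ('b \<Rightarrow>\<^sub>0 'k)"
  by unfold_locales (simp_all add: pm.scale_right_distrib pm.scale_left_distrib)

lemma finite_basis_of_homogeneous:
  fixes W :: "((nat \<Rightarrow>\<^sub>0 nat) \<Rightarrow>\<^sub>0 'k::field) set"
  assumes "pm.subspace W" "W \<subseteq> dp_hom r n"
  obtains B where "finite B" "pm.independent B" "pm.span B = W"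
proof -
  let ?E = "{b :: nat \<Rightarrow>\<^sub>0 nat. keys b \<subseteq> {..<r} \<and> (\<Sum>j<r. lookup b j) = n}"
  have "dp_hom r n \<subseteq> pm_free ?E"
    unfolding dp_hom_def by (simp add: subset_iff pm_free_iff)
  obtain B where B: "B \<subseteq> W" "pm.independent B" "W \<subseteq> pm.span B"
    using pv.maximal_independent_subset[of W] by metis
  have "finite B"
  proof -
    have "B \<subseteq> pm.span ((\<lambda>b. Poly_Mapping.single b (1::'k)) ` ?E)"
      using B(1) assms(2) \<open>dp_hom r n \<subseteq> pm_free ?E\<close> unfolding pm_free_def by blast
    then show ?thesis
      using pv.independent_span_bound[OF _ B(2)] finite_exponents[of r n] by blast
  qed
  moreover have "pm.span B = W"
    using B assms(1) by (intro equalityI pm.span_minimal) auto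
  ultimately show thesis
    using that B by blast
qed

text \<open>
  Only finitely many multidegrees occur in an element, so that preimages can be chosen in each of them
  and then added up.
\<close>

lemma component_support:
  fixes x :: "br_sym \<Rightarrow>\<^sub>0 ('n::finite, 'k::field) mpolys"
  obtains \<Gamma> where "finite \<Gamma>" "\<And>\<alpha> I. dcomp dE \<alpha> x I \<noteq> 0 \<Longrightarrow> \<alpha> \<in> \<Gamma>"
    "\<And>\<alpha> l. ecomp dE \<alpha> x l \<noteq> 0 \<Longrightarrow> \<alpha> \<in> \<Gamma>"
proof
  let ?G = "\<Union>u\<in>keys x. (\<lambda>k. k + br_deg dE (\<lambda>_. 0) u) ` keys (lookup x u)"
  show "finite ?G"
    by auto
  show "\<alpha> \<in> ?G" if "dcomp dE \<alpha> x I \<noteq> 0" for \<alpha> I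
  proof -
    obtain b where "lookup (dcomp dE \<alpha> x I) b \<noteq> 0"
      using \<open>dcomp dE \<alpha> x I \<noteq> 0\<close> by (metis poly_mapping_eqI lookup_zero)
    then have le: "lcm_deg dE I \<preceq> \<alpha>" and nz: "lookup (lookup x (Ups b I)) (\<alpha> - lcm_deg dE I) \<noteq> 0"
      by (auto simp: lookup_dcomp split: if_splits)
    then have "Ups b I \<in> keys x" "\<alpha> - lcm_deg dE I \<in> keys (lookup x (Ups b I))"
      by (auto simp: in_keys_iff)
    moreover have "\<alpha> = (\<alpha> - lcm_deg dE I) + br_deg dE (\<lambda>_. 0) (Ups b I)"
      using le by (simp add: mdeg_diff_add)
    ultimately show ?thesis
      by (metis (no_types, lifting) UN_I image_eqI)
  qed
  show "\<alpha> \<in> ?G" if "ecomp dE \<alpha> x l \<noteq> 0" for \<alpha> l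
  proof -
    have le: "dE l \<preceq> \<alpha>" and nz: "lookup (lookup x (Eps l)) (\<alpha> - dE l) \<noteq> 0"
      using \<open>ecomp dE \<alpha> x l \<noteq> 0\<close> by (auto simp: ecomp_def split: if_splits)
    then have "Eps l \<in> keys x" "\<alpha> - dE l \<in> keys (lookup x (Eps l))"
      by (auto simp: in_keys_iff)
    moreover have "\<alpha> = (\<alpha> - dE l) + br_deg dE (\<lambda>_. 0) (Eps l)"
      using le by (simp add: mdeg_diff_add)
    ultimately show ?thesis
      by (metis (no_types, lifting) UN_I image_eqI)
  qed
qed

text \<open>
  The Scarf complex in homological degrees \<open>\<ge> 2\<close> together with \<open>R\<^sub>1 = E\<close>; the map \<open>\<phi>\<close> enters later.
\<close>

locale scarf_complex = generic_system "dim_col C" "mat_rank C" "\<lambda>l j. \<upsilon> j (col C l)" dE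
  for C :: "'k::field mat" and \<upsilon> :: "nat \<Rightarrow> 'k vec \<Rightarrow> 'k" and dE :: "nat \<Rightarrow> 'n::finite mdegree" +
  fixes dG :: "nat \<Rightarrow> 'n mdegree"
  assumes dual_basis: "dual_basis C \<upsilon>"
begin

abbreviation "e \<equiv> dim_col C"
abbreviation "rk \<equiv> mat_rank C"
abbreviation "S \<equiv> scarf_mod dE C \<upsilon> :: nat \<Rightarrow> (br_sym \<Rightarrow>\<^sub>0 ('n, 'k) mpolys) set"
abbreviation "\<delta> i \<equiv> homogenization (br_deg dE dG) (br_map C \<upsilon> i) ::
  (br_sym \<Rightarrow>\<^sub>0 ('n, 'k) mpolys) \<Rightarrow> (br_sym \<Rightarrow>\<^sub>0 ('n, 'k) mpolys)"

lemma scarf_mod_span: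
  "S (Suc (Suc n)) = pm.span {ups_elem I y | I y.
     I \<subseteq> {..<e} \<and> card I = Suc (n + rk) \<and> y \<in> scarf_space I}"
proof -
  have "y \<in> scarf_system dE C \<upsilon> I \<longleftrightarrow> y \<in> scarf_space I" if "I \<subseteq> {..<e}" for I y
    using scarf_system_eq[OF dual_basis generic_system_axioms that] by simp
  then have "{ups_elem I y :: br_sym \<Rightarrow>\<^sub>0 ('n, 'k) mpolys | I y.
      I \<subseteq> {..<e} \<and> card I = rk + Suc (Suc n) - 1 \<and> y \<in> scarf_system dE C \<upsilon> I} =
    {ups_elem I y | I y. I \<subseteq> {..<e} \<and> card I = Suc (n + rk) \<and> y \<in> scarf_space I}"
    by (auto simp: add.commute)
  then show ?thesis
    unfolding scarf_mod_def brt_mod_def by (simp add: add.commute)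
qed

lemma scarf_mod_1: "S (Suc 0) = E_mod e"
  by (simp add: scarf_mod_def brt_mod_def)

lemma scarf_mod_0: "S 0 = G_mod (dim_row C)"
  by (simp add: scarf_mod_def brt_mod_def)

lemma scarf_mod_subspace: "pm.subspace (S i)"
proof (cases "i < 2")
  case True
  then have "i = 0 \<or> i = 1"
    by auto
  then show ?thesis
    by (auto simp: scarf_mod_0 scarf_mod_1 E_mod_def G_mod_def pm_free_def)
next
  case False
  then obtain n where "i = Suc (Suc n)"
    by (metis One_nat_def Suc_1 less_2_cases_iff not0_implies_Suc)
  then show ?thesis
    by (simp add: scarf_mod_span)
qed

lemma ups_elem_in_scarf_mod:
  "I \<subseteq> {..<e} \<Longrightarrow> card I = Suc (n + rk) \<Longrightarrow> y \<in> scarf_space I \<Longrightarrow> ups_elem I y \<in> S (Suc (Suc n))"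
  unfolding scarf_mod_span by (rule pm.span_base) blast

text \<open>
  The modules are spanned over the polynomial ring by elements \<open>y \<otimes> \<epsilon>\<^sub>I\<close>, and the statements on
  their elements extend additively from these generators.
\<close>

lemma scarf_mod_induct [consumes 1, case_names zero step]:
  assumes "x \<in> S (Suc (Suc n))" and "P 0"
    and step: "\<And>q I y x. I \<subseteq> {..<e} \<Longrightarrow> finite I \<Longrightarrow> I \<in> faces e \<Longrightarrow> card I = Suc (n + rk) \<Longrightarrow>
      y \<in> scarf_space I \<Longrightarrow> y \<in> dp_hom rk n \<Longrightarrow> P x \<Longrightarrow> P (pm_scale q (ups_elem I y) + x)"
  shows "P x"
  using assms(1) unfolding scarf_mod_span
proof (induction rule: pm.span_induct_alt)
  case (step q a x)
  then obtain I y where I: "a = ups_elem I y" "I \<subseteq> {..<e}" "card I = Suc (n + rk)" "y \<in> scarf_space I"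
    by blast
  then have "y \<in> dp_hom rk n" "finite I" "I \<in> faces e"
    using scarf_space_hom[OF I(4)] finite_subset by (auto simp: faces_def)
  then show ?case
    using assms(3)[of I y x q] I step by blast
qed (rule assms(2))

lemma scarf_mod_keys: "x \<in> S (Suc (Suc n)) \<Longrightarrow> keys x \<subseteq> {u. \<exists>b I. u = Ups b I}"
proof (induction rule: scarf_mod_induct)
  case (step q I y x)
  have "keys (pm_scale q (ups_elem I y) + x) \<subseteq> keys (pm_scale q (ups_elem I y)) \<union> keys x"
    by (rule Poly_Mapping.keys_add)
  also have "\<dots> \<subseteq> (\<lambda>b. Ups b I) ` keys y \<union> keys x"
    using keys_pm_scale[of q "ups_elem I y"] keys_ups_elem[of I y] by blast
  finally show ?case
    using step by auto
qed simp

lemma dcomp_scarf_space: "x \<in> S (Suc (Suc n)) \<Longrightarrow> dcomp dE \<alpha> x J \<in> scarf_space J"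
  by (induction rule: scarf_mod_induct) (auto simp: dcomp_add dcomp_ups_elem intro: scarf_space_add scarf_space_scale)

lemma dcomp_chain: "x \<in> S (Suc (Suc n)) \<Longrightarrow> dcomp dE \<alpha> x \<in> chain {} (below \<alpha>) (Suc (n + rk)) n"
proof (induction rule: scarf_mod_induct)
  case zero
  have "dcomp dE \<alpha> 0 = (\<lambda>_. 0)"
    by auto
  then show ?case
    by (simp add: chain_0)
next
  case (step q I y x)
  have "dcomp dE \<alpha> (pm_scale q (ups_elem I y)) \<in> chain {} (below \<alpha>) (Suc (n + rk)) n"
    using step lcm_le_iff_below[OF step(3), of dE \<alpha>]
    by (auto simp: chain_def dcomp_ups_elem dp_hom_scale)
  then show ?case
    using chain_add[OF _ step(7)] by (simp add: dcomp_add[abs_def])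
qed

text \<open>
  In each multidegree the homogenized differential is the Koszul differential on the vertices
  below it.
\<close>

lemma dcomp_differential:
  assumes "x \<in> S (Suc (Suc (Suc n)))"
  shows "dcomp dE \<alpha> (\<delta> (Suc (Suc (Suc n))) x) J = koszul (below \<alpha>) (dcomp dE \<alpha> x) J"
  using assms
proof (induction rule: scarf_mod_induct)
  case zero
  have "dcomp dE \<alpha> 0 = (\<lambda>_. 0)"
    by auto
  then show ?case
    by (simp add: homogenization_0 koszul_zero)
next
  case (step q I y x)
  let ?c = "\<lambda>l. contr rk (\<lambda>j. \<upsilon> j (col C l)) y"
  let ?g = "pm_scale q (ups_elem I y)"
  have i: "3 \<le> Suc (Suc (Suc n))"
    by simp
  have "dcomp dE \<alpha> (\<delta> (Suc (Suc (Suc n))) ?g) J =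
      (\<Sum>l\<in>I. dcomp dE \<alpha> (pm_scale (q * Poly_Mapping.single (mdeg I - mdeg (I - {l})) (face_sgn l I))
        (ups_elem (I - {l}) (?c l))) J)"
    unfolding homogenization_scale homogenization_br_map_ge3[OF i step(2)] pm.scale_sum_right
      dcomp_sum pm.scale_scale ..
  also have "\<dots> = (\<Sum>l\<in>I. if J = I - {l} \<and> mdeg I \<preceq> \<alpha>
      then pm_scale (lookup q (\<alpha> - mdeg I) * face_sgn l I) (?c l) else 0)"
  proof (intro sum.cong refl)
    fix l assume l: "l \<in> I"
    have "I - {l} \<noteq> {}"
      using step(2,4) l by (metis card.empty card_Suc_Diff1 add_Suc nat.inject nat.distinct(1))
    then have le: "mdeg (I - {l}) \<preceq> mdeg I"
      using step(2) by (intro lcm_deg_mono) auto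
    show "dcomp dE \<alpha> (pm_scale (q * Poly_Mapping.single (mdeg I - mdeg (I - {l})) (face_sgn l I))
        (ups_elem (I - {l}) (?c l))) J = (if J = I - {l} \<and> mdeg I \<preceq> \<alpha>
        then pm_scale (lookup q (\<alpha> - mdeg I) * face_sgn l I) (?c l) else 0)"
    proof (cases "mdeg (I - {l}) \<preceq> \<alpha>")
      case True
      then show ?thesis
        using mdeg_diff_le[OF le True] by (auto simp: dcomp_ups_elem lookup_mult_single)
    next
      case False
      then show ?thesis
        using le mdeg_le_trans by (auto simp: dcomp_ups_elem)
    qed
  qed
  also have "\<dots> = koszul (below \<alpha>) (dcomp dE \<alpha> ?g) J"
    unfolding koszul_def
  proof (rule sum.mono_neutral_cong)
    fix l assume l: "l \<in> I - (below \<alpha> - J)"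
    have "l \<in> below \<alpha>" if "mdeg I \<preceq> \<alpha>"
      using that lcm_le_iff_below[OF step(3)] l by blast
    then show "(if J = I - {l} \<and> mdeg I \<preceq> \<alpha>
        then pm_scale (lookup q (\<alpha> - mdeg I) * face_sgn l I) (?c l) else 0) = 0"
      using l by auto
  next
    fix l assume "l \<in> (below \<alpha> - J) - I"
    then have "insert l J \<noteq> I"
      by auto
    then show "pm_scale (face_sgn l J) (contr rk (\<lambda>j. \<upsilon> j (col C l)) (dcomp dE \<alpha> ?g (insert l J))) = 0"
      by (simp add: dcomp_ups_elem)
  next
    fix l assume l: "l \<in> I \<inter> (below \<alpha> - J)"
    then have "insert l J = I \<longleftrightarrow> J = I - {l}"
      by auto
    then show "(if J = I - {l} \<and> mdeg I \<preceq> \<alpha>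
        then pm_scale (lookup q (\<alpha> - mdeg I) * face_sgn l I) (?c l) else 0) =
        pm_scale (face_sgn l J) (contr rk (\<lambda>j. \<upsilon> j (col C l)) (dcomp dE \<alpha> ?g (insert l J)))"
      by (auto simp: dcomp_ups_elem contr_scale mult.commute)
  qed (use step(2) in \<open>auto simp: face_below_def\<close>)
  finally have "dcomp dE \<alpha> (\<delta> (Suc (Suc (Suc n))) ?g) J = koszul (below \<alpha>) (dcomp dE \<alpha> ?g) J" .
  then show ?case
    using step(7) by (simp add: homogenization_add dcomp_add[abs_def] koszul_add)
qed

lemma cramer_map_add: "cramer_map (\<lambda>J. y J + z J) l = cramer_map y l + cramer_map z l"
  by (simp add: cramer_map_def lookup_add distrib_left sum.distrib)

lemma ecomp_differential:
  assumes "x \<in> S (Suc (Suc 0))" "l < e"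
  shows "ecomp dE \<alpha> (\<delta> (Suc (Suc 0)) x) l = cramer_map (dcomp dE \<alpha> x) l"
  using assms(1)
proof (induction rule: scarf_mod_induct)
  case zero
  then show ?case
    by (simp add: homogenization_0 cramer_map_def)
next
  case (step q I y x)
  let ?g = "pm_scale q (ups_elem I y)"
  let ?c = "\<lambda>l. face_sgn l I * minor rk (\<lambda>l j. \<upsilon> j (col C l)) (I - {l}) * lookup y 0"
  have "ecomp dE \<alpha> (\<delta> (Suc (Suc 0)) ?g) l = (\<Sum>k\<in>I. ecomp dE \<alpha>
      (pm_scale (q * Poly_Mapping.single (mdeg I - dE k) (?c k)) (Poly_Mapping.single (Eps k) 1)) l)"
    unfolding homogenization_scale homogenization_br_map_2[unfolded numeral_2_eq_2, OF step(2,6)] pm.scale_sum_right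
      ecomp_sum pm.scale_scale ..
  also have "\<dots> = (\<Sum>k\<in>I. if k = l then (if mdeg I \<preceq> \<alpha> then lookup q (\<alpha> - mdeg I) * ?c l else 0) else 0)"
  proof (intro sum.cong refl)
    fix k assume k: "k \<in> I"
    have le: "dE k \<preceq> mdeg I"
      using lcm_deg_upper[OF step(2) k] .
    show "ecomp dE \<alpha> (pm_scale (q * Poly_Mapping.single (mdeg I - dE k) (?c k)) (Poly_Mapping.single (Eps k) 1)) l
        = (if k = l then (if mdeg I \<preceq> \<alpha> then lookup q (\<alpha> - mdeg I) * ?c l else 0) else 0)"
    proof (cases "k = l \<and> dE k \<preceq> \<alpha>")
      case True
      then show ?thesis
        using mdeg_diff_le[OF le, of \<alpha>] by (auto simp: ecomp_def lookup_mult_single)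
    next
      case False
      then show ?thesis
        using le mdeg_le_trans[OF le, of \<alpha>] by (auto simp: ecomp_def lookup_single when_def)
    qed
  qed
  also have "\<dots> = (if l \<in> I \<and> mdeg I \<preceq> \<alpha> then lookup q (\<alpha> - mdeg I) * ?c l else 0)"
    using step(2) by simp
  also have "\<dots> = (\<Sum>J | J \<subseteq> {..<e} - {l} \<and> card J = rk. if J = I - {l}
      then (if l \<in> I \<and> mdeg I \<preceq> \<alpha> then lookup q (\<alpha> - mdeg I) * ?c l else 0) else 0)"
  proof -
    have "I - {l} \<in> {J. J \<subseteq> {..<e} - {l} \<and> card J = rk}" if "l \<in> I"
      using that step(1,2,4) by auto
    then show ?thesis
      by (subst sum.delta) auto
  qed
  also have "\<dots> = cramer_map (dcomp dE \<alpha> ?g) l"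
    unfolding cramer_map_def
  proof (intro sum.cong refl)
    fix J assume "J \<in> {J. J \<subseteq> {..<e} - {l} \<and> card J = rk}"
    then have "l \<notin> J"
      by auto
    then have "insert l J = I \<longleftrightarrow> J = I - {l} \<and> l \<in> I"
      by auto
    then show "(if J = I - {l} then (if l \<in> I \<and> mdeg I \<preceq> \<alpha> then lookup q (\<alpha> - mdeg I) * ?c l else 0) else 0) =
        face_sgn l J * minor rk (\<lambda>l j. \<upsilon> j (col C l)) J * lookup (dcomp dE \<alpha> ?g (insert l J)) 0"
      by (cases "J = I - {l} \<and> l \<in> I \<and> mdeg I \<preceq> \<alpha>")
        (auto simp: dcomp_ups_elem lookup_pm_scale)
  qed
  finally have "ecomp dE \<alpha> (\<delta> (Suc (Suc 0)) ?g) l = cramer_map (dcomp dE \<alpha> ?g) l" .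
  then show ?case
    using step(7) cramer_map_add[of "dcomp dE \<alpha> ?g" "dcomp dE \<alpha> x" l]
    by (simp add: homogenization_add ecomp_add dcomp_add[abs_def])
qed

text \<open>
  If \<open>y \<otimes> \<epsilon>\<^sub>I\<close> is a nonzero generator, then \<open>I = I\<^sub>\<beta>\<close> for its multidegree \<open>\<beta>\<close>. Removing a vertex of the
  core lowers the multidegree, and the contraction with any other vertex of \<open>I\<close> kills \<open>y\<close>. In degree
  \<open>2\<close> the target is some \<open>\<epsilon>\<^sub>l\<close>, whose multidegree differs from \<open>\<beta>\<close>. As the image of the maximal ideal
  is in the module, this also shows that the differential maps into it.
\<close>

lemma differential_minimal:
  assumes "x \<in> S (Suc (Suc n))"
  shows "\<delta> (Suc (Suc n)) x \<in> max_ideal_times (S (Suc n))"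
  using assms
proof (induction rule: scarf_mod_induct)
  case zero
  then show ?case
    by (simp add: homogenization_0 max_ideal_times_def pm.span_zero)
next
  case (step q I y x)
  have base: "pm_scale p z \<in> max_ideal_times (S (Suc n))" if "p \<in> max_ideal" "z \<in> S (Suc n)" for p z
    using that unfolding max_ideal_times_def by (intro pm.span_base) blast
  have "\<delta> (Suc (Suc n)) (ups_elem I y) \<in> max_ideal_times (S (Suc n))"
  proof (cases "y = 0")
    case True
    then show ?thesis
      by (simp add: homogenization_0 max_ideal_times_def pm.span_zero)
  next
    case False
    then have closed: "I = below (mdeg I)"
      using scarf_space_nonzero[OF step(5)] by blast
    have big: "rk < card (below (mdeg I))"
      using closed step(4) by simp
    show ?thesis
    proof (cases n)
      case 0
      have "pm_scale (Poly_Mapping.single (mdeg I - dE l) c) (Poly_Mapping.single (Eps l) 1)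
          \<in> max_ideal_times (S (Suc n))" if l: "l \<in> I" for l c
      proof (rule base)
        have "l < e"
          using l step(1) by auto
        then have "dE l \<noteq> mdeg I"
          using no_maximum[OF step(3) big] by blast
        then show "Poly_Mapping.single (mdeg I - dE l) c \<in> max_ideal"
          using lcm_deg_upper[OF step(2) l] by (intro single_in_max_ideal mdeg_diff_nonzero)
        show "Poly_Mapping.single (Eps l) 1 \<in> S (Suc n)"
          using \<open>l < e\<close> 0 scarf_mod_1 by (simp add: E_mod_def pm_free_iff)
      qed
      then show ?thesis
        using step(2,6) 0 unfolding max_ideal_times_def
        by (simp add: homogenization_br_map_2[unfolded numeral_2_eq_2] pm.span_sum)
    next
      case (Suc n')
      have "pm_scale (Poly_Mapping.single (mdeg I - mdeg (I - {l})) (face_sgn l I))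
          (ups_elem (I - {l}) (contr rk (\<lambda>j. \<upsilon> j (col C l)) y)) \<in> max_ideal_times (S (Suc n))"
        if l: "l \<in> I" for l
      proof (cases "contr rk (\<lambda>j. \<upsilon> j (col C l)) y = 0")
        case True
        then show ?thesis
          by (simp add: max_ideal_times_def pm.span_zero)
      next
        case nz: False
        have "l \<in> core (mdeg I)"
          using scarf_space_upper[OF step(5), of l] nz l closed by (auto simp: face_upper_def)
        have ne: "I - {l} \<noteq> {}"
          using step(2,4) Suc l by (metis card.empty card_Suc_Diff1 add_Suc nat.inject nat.distinct(1))
        then have face: "I - {l} \<in> faces e"
          using step(1) by (auto simp: faces_def)
        have "mdeg (I - {l}) \<noteq> mdeg I"
          using face_core_subset[OF face, of dE] \<open>l \<in> core (mdeg I)\<close> by auto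
        moreover have "mdeg (I - {l}) \<preceq> mdeg I"
          using ne step(2) by (intro lcm_deg_mono) auto
        ultimately have "Poly_Mapping.single (mdeg I - mdeg (I - {l})) (face_sgn l I :: 'k) \<in> max_ideal"
          by (intro single_in_max_ideal mdeg_diff_nonzero)
        moreover have "ups_elem (I - {l}) (contr rk (\<lambda>j. \<upsilon> j (col C l)) y) \<in> S (Suc (Suc n'))"
          using step(1,2,4) Suc l scarf_space_contr[OF step(1,5) l] by (intro ups_elem_in_scarf_mod) auto
        ultimately show ?thesis
          using Suc by (intro base) simp_all
      qed
      moreover have "3 \<le> Suc (Suc n)"
        using Suc by simp
      ultimately show ?thesis
        using step(2) unfolding max_ideal_times_def by (simp add: homogenization_br_map_ge3 pm.span_sum)
    qed
  qed
  then show ?case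
    using step(7) unfolding homogenization_add homogenization_scale max_ideal_times_def
    by (intro pm.span_add pm.span_scale)
qed

lemma differential_maps: "x \<in> S (Suc (Suc n)) \<Longrightarrow> \<delta> (Suc (Suc n)) x \<in> S (Suc n)"
  using differential_minimal max_ideal_times_subset[OF scarf_mod_subspace] by blast

lemma scarf_mod_eqI:
  "x \<in> S (Suc (Suc n)) \<Longrightarrow> y \<in> S (Suc (Suc n)) \<Longrightarrow> (\<And>\<alpha> I. dcomp dE \<alpha> x I = dcomp dE \<alpha> y I) \<Longrightarrow> x = y"
  by (intro poly_eq_by_dcomp scarf_mod_keys)

lemma scarf_mod_1_eqI:
  assumes "x \<in> S (Suc 0)" "y \<in> S (Suc 0)" "\<And>\<alpha> l. l < e \<Longrightarrow> ecomp dE \<alpha> x l = ecomp dE \<alpha> y l"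
  shows "x = y"
  using assms unfolding scarf_mod_1 E_mod_def pm_free_iff by (intro poly_eq_by_ecomp[where e = e and dE = dE])

text \<open>
  A family of strands comes from an element of the module, by supplying the missing monomials.
\<close>

lemma lift_chains:
  assumes fin: "finite \<Gamma>" and w: "\<And>\<alpha>. \<alpha> \<in> \<Gamma> \<Longrightarrow> w \<alpha> \<in> chain {} (below \<alpha>) (Suc (n + rk)) n"
    and F: "\<And>\<alpha> J. \<alpha> \<in> \<Gamma> \<Longrightarrow> w \<alpha> J \<in> scarf_space J"
  shows "\<exists>y\<in>S (Suc (Suc n)). \<forall>\<beta> J. dcomp dE \<beta> y J = (if \<beta> \<in> \<Gamma> then w \<beta> J else 0)"
proof -
  let ?I = "{I. I \<subseteq> {..<e} \<and> card I = Suc (n + rk)}"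
  define y where "y = (\<Sum>\<alpha>\<in>\<Gamma>. \<Sum>I\<in>?I. pm_scale (Poly_Mapping.single (\<alpha> - mdeg I) 1) (ups_elem I (w \<alpha> I)))"
  have finI: "finite ?I"
    by (rule finite_subset[of _ "Pow {..<e}"]) auto
  have "y \<in> S (Suc (Suc n))"
    unfolding y_def scarf_mod_span using F
    by (intro pm.span_sum pm.span_scale pm.span_base) blast
  moreover have "dcomp dE \<beta> y J = (if \<beta> \<in> \<Gamma> then w \<beta> J else 0)" for \<beta> J
  proof -
    have "dcomp dE \<beta> (pm_scale (Poly_Mapping.single (\<alpha> - mdeg I) 1) (ups_elem I (w \<alpha> I))) J =
        (if I = J then if \<alpha> = \<beta> then w \<beta> J else 0 else 0)" if \<alpha>: "\<alpha> \<in> \<Gamma>" and I: "I \<in> ?I" for \<alpha> I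
    proof (cases "I = J \<and> w \<alpha> I \<noteq> 0")
      case False
      then show ?thesis
        by (auto simp: dcomp_ups_elem)
    next
      case True
      then have "I \<subseteq> below \<alpha>"
        using chain_support[OF w[OF \<alpha>], of I] by auto
      moreover have "I \<in> faces e"
        using I by (auto simp: faces_def)
      ultimately have le: "mdeg I \<preceq> \<alpha>"
        using lcm_le_iff_below by blast
      then have "\<alpha> = \<beta>" if "mdeg I \<preceq> \<beta>" "\<alpha> - mdeg I = \<beta> - mdeg I"
        using that mdeg_diff_add by metis
      then show ?thesis
        using le True by (auto simp: dcomp_ups_elem lookup_single when_def)
    qed
    then have "dcomp dE \<beta> y J = (\<Sum>\<alpha>\<in>\<Gamma>. \<Sum>I\<in>?I. if I = J then if \<alpha> = \<beta> then w \<beta> J else 0 else 0)"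
      unfolding y_def dcomp_sum by (intro sum.cong refl) auto
    also have "\<dots> = (\<Sum>\<alpha>\<in>\<Gamma>. if \<alpha> = \<beta> then if J \<in> ?I then w \<beta> J else 0 else 0)"
      using finI by (intro sum.cong refl) (simp add: sum.delta)
    also have "\<dots> = (if \<beta> \<in> \<Gamma> then if J \<in> ?I then w \<beta> J else 0 else 0)"
      using fin by (simp add: sum.delta)
    also have "\<dots> = (if \<beta> \<in> \<Gamma> then w \<beta> J else 0)"
    proof -
      have "J \<in> ?I" if "\<beta> \<in> \<Gamma>" "w \<beta> J \<noteq> 0"
        using chain_support[OF w[OF that(1)] that(2)] by (auto simp: face_below_def)
      then show ?thesis
        by auto
    qed
    finally show ?thesis .
  qed
  ultimately show ?thesis
    by blast
qed

lemma koszul_below: "x \<in> S (Suc (Suc n)) \<Longrightarrow> koszul (below \<alpha>) (dcomp dE \<alpha> x) = koszul {..<e} (dcomp dE \<alpha> x)"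
proof
  fix J assume "x \<in> S (Suc (Suc n))"
  have "below \<alpha> \<subseteq> {..<e}"
    by (auto simp: face_below_def)
  then show "koszul (below \<alpha>) (dcomp dE \<alpha> x) J = koszul {..<e} (dcomp dE \<alpha> x) J"
    using koszul_mono_support[OF dcomp_chain[OF \<open>x \<in> S (Suc (Suc n))\<close>, of \<alpha>], of "{..<e}" J] by simp
qed

lemma differential_squared: "x \<in> S (Suc (Suc (Suc n))) \<Longrightarrow> \<delta> (Suc (Suc n)) (\<delta> (Suc (Suc (Suc n))) x) = 0"
proof -
  assume x: "x \<in> S (Suc (Suc (Suc n)))"
  have dx: "\<delta> (Suc (Suc (Suc n))) x \<in> S (Suc (Suc n))"
    using differential_maps[OF x] by simp
  have comp: "dcomp dE \<alpha> (\<delta> (Suc (Suc (Suc n))) x) = koszul (below \<alpha>) (dcomp dE \<alpha> x)" for \<alpha>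
    using dcomp_differential[OF x] by blast
  show ?thesis
  proof (cases n)
    case 0
    have "\<delta> (Suc (Suc 0)) (\<delta> (Suc (Suc (Suc n))) x) = 0"
    proof (rule scarf_mod_1_eqI)
      show "\<delta> (Suc (Suc 0)) (\<delta> (Suc (Suc (Suc n))) x) \<in> S (Suc 0)"
        using differential_maps[OF dx] 0 by simp
      show "0 \<in> S (Suc 0)"
        using scarf_mod_subspace pm.subspace_0 by blast
      show "ecomp dE \<alpha> (\<delta> (Suc (Suc 0)) (\<delta> (Suc (Suc (Suc n))) x)) l = ecomp dE \<alpha> 0 l" if "l < e" for \<alpha> l
        using ecomp_differential[OF _ that, of "\<delta> (Suc (Suc (Suc n))) x" \<alpha>] dx 0 comp koszul_below[OF x]
          cramer_map_koszul[OF that] by simp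
    qed
    then show ?thesis
      using 0 by simp
  next
    case (Suc k)
    have dx': "\<delta> (Suc (Suc (Suc n))) x \<in> S (Suc (Suc (Suc k)))"
      using dx Suc by simp
    show ?thesis
    proof (rule scarf_mod_eqI[of _ k])
      show "\<delta> (Suc (Suc n)) (\<delta> (Suc (Suc (Suc n))) x) \<in> S (Suc (Suc k))"
        using differential_maps[OF dx'] Suc by simp
      show "0 \<in> S (Suc (Suc k))"
        using scarf_mod_subspace pm.subspace_0 by blast
      show "dcomp dE \<alpha> (\<delta> (Suc (Suc n)) (\<delta> (Suc (Suc (Suc n))) x)) I = dcomp dE \<alpha> 0 I" for \<alpha> I
        using dcomp_differential[OF dx', of \<alpha> I] Suc comp koszul_koszul[of "below \<alpha>"]
        by (simp add: face_below_def)
    qed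
  qed
qed

lemma differential_exact:
  assumes x: "x \<in> S (Suc (Suc n))" and dx: "\<delta> (Suc (Suc n)) x = 0"
  shows "\<exists>y\<in>S (Suc (Suc (Suc n))). \<delta> (Suc (Suc (Suc n))) y = x"
proof -
  obtain \<Gamma> where \<Gamma>: "finite \<Gamma>" "\<And>\<alpha> I. dcomp dE \<alpha> x I \<noteq> 0 \<Longrightarrow> \<alpha> \<in> \<Gamma>"
    using component_support by metis
  have "\<exists>w\<in>chain {} (below \<alpha>) (Suc (Suc (n + rk))) (Suc n).
      (\<forall>J. w J \<in> scarf_space J) \<and> (\<forall>J. koszul (below \<alpha>) w J = dcomp dE \<alpha> x J)" for \<alpha>
  proof (rule scarf_strand_exact[OF dcomp_chain[OF x] dcomp_scarf_space[OF x]])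
    show "\<forall>l<e. cramer_map (dcomp dE \<alpha> x) l = 0" if "n = 0"
    proof (intro allI impI)
      fix l assume "l < e"
      then show "cramer_map (dcomp dE \<alpha> x) l = 0"
        using ecomp_differential[of x l \<alpha>] x dx that by simp
    qed
    show "\<forall>J. koszul (below \<alpha>) (dcomp dE \<alpha> x) J = 0" if pos: "n \<noteq> 0"
    proof -
      obtain k where k: "n = Suc k"
        using pos by (cases n) auto
      show ?thesis
      proof
        fix J
        have "dcomp dE \<alpha> (\<delta> (Suc (Suc n)) x) J = koszul (below \<alpha>) (dcomp dE \<alpha> x) J"
          using x unfolding k by (rule dcomp_differential)
        then show "koszul (below \<alpha>) (dcomp dE \<alpha> x) J = 0"
          unfolding dx by simp
      qed
    qed
  qed
  then have "\<forall>\<alpha>. \<exists>w. w \<in> chain {} (below \<alpha>) (Suc (Suc n + rk)) (Suc n) \<and>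
      (\<forall>J. w J \<in> scarf_space J) \<and> (\<forall>J. koszul (below \<alpha>) w J = dcomp dE \<alpha> x J)"
    unfolding Bex_def by simp
  from choice[OF this] obtain w where w: "\<And>\<alpha>. w \<alpha> \<in> chain {} (below \<alpha>) (Suc (Suc n + rk)) (Suc n)"
    "\<And>\<alpha> J. w \<alpha> J \<in> scarf_space J" "\<And>\<alpha> J. koszul (below \<alpha>) (w \<alpha>) J = dcomp dE \<alpha> x J"
    by blast
  obtain y where y: "y \<in> S (Suc (Suc (Suc n)))"
    "\<And>\<beta> J. dcomp dE \<beta> y J = (if \<beta> \<in> \<Gamma> then w \<beta> J else 0)"
    using lift_chains[OF \<Gamma>(1), of w "Suc n"] w by blast
  have "\<delta> (Suc (Suc (Suc n))) y = x"
  proof (rule scarf_mod_eqI[OF _ x])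
    show "\<delta> (Suc (Suc (Suc n))) y \<in> S (Suc (Suc n))"
      using differential_maps[OF y(1)] by simp
    fix \<alpha> I
    have "dcomp dE \<alpha> y = (if \<alpha> \<in> \<Gamma> then w \<alpha> else (\<lambda>_. 0))"
      using y(2) by auto
    then show "dcomp dE \<alpha> (\<delta> (Suc (Suc (Suc n))) y) I = dcomp dE \<alpha> x I"
      unfolding dcomp_differential[OF y(1)] using w(3) \<Gamma>(2)[of \<alpha> I] by (auto simp: koszul_zero)
  qed
  with y(1) show ?thesis
    by blast
qed

lemma differential_onto_kernel:
  assumes x: "x \<in> S (Suc 0)"
    and ker: "\<And>\<alpha> j. j < rk \<Longrightarrow> (\<Sum>l<e. ecomp dE \<alpha> x l * \<upsilon> j (col C l)) = 0"
  shows "\<exists>y\<in>S (Suc (Suc 0)). \<delta> (Suc (Suc 0)) y = x"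
proof -
  obtain \<Gamma> where \<Gamma>: "finite \<Gamma>" "\<And>\<alpha> l. ecomp dE \<alpha> x l \<noteq> 0 \<Longrightarrow> \<alpha> \<in> \<Gamma>"
    using component_support by metis
  have "\<exists>w\<in>chain {} (below \<alpha>) (Suc rk) 0. (\<forall>J. w J \<in> scarf_space J) \<and>
      (\<forall>l<e. cramer_map w l = ecomp dE \<alpha> x l)" for \<alpha>
  proof (rule scarf_strand_onto_kernel)
    fix l assume l: "l \<notin> below \<alpha>"
    have "Eps l \<notin> keys x" if "\<not> l < e"
      using that x unfolding scarf_mod_1 E_mod_def pm_free_iff by auto
    then show "ecomp dE \<alpha> x l = 0"
      using l by (auto simp: ecomp_def face_below_def in_keys_iff)
  qed (rule ker)
  then have "\<forall>\<alpha>. \<exists>w. w \<in> chain {} (below \<alpha>) (Suc (0 + rk)) 0 \<and>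
      (\<forall>J. w J \<in> scarf_space J) \<and> (\<forall>l<e. cramer_map w l = ecomp dE \<alpha> x l)"
    unfolding Bex_def by simp
  from choice[OF this] obtain w where w: "\<And>\<alpha>. w \<alpha> \<in> chain {} (below \<alpha>) (Suc (0 + rk)) 0"
    "\<And>\<alpha> J. w \<alpha> J \<in> scarf_space J" "\<And>\<alpha> l. l < e \<Longrightarrow> cramer_map (w \<alpha>) l = ecomp dE \<alpha> x l"
    by blast
  obtain y where y: "y \<in> S (Suc (Suc 0))"
    "\<And>\<beta> J. dcomp dE \<beta> y J = (if \<beta> \<in> \<Gamma> then w \<beta> J else 0)"
    using lift_chains[OF \<Gamma>(1), of w 0] w by blast
  have "\<delta> (Suc (Suc 0)) y = x"
  proof (rule scarf_mod_1_eqI[OF _ x])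
    show "\<delta> (Suc (Suc 0)) y \<in> S (Suc 0)"
      using differential_maps[OF y(1)] by simp
    fix \<alpha> l assume l: "l < e"
    have "dcomp dE \<alpha> y = (if \<alpha> \<in> \<Gamma> then w \<alpha> else (\<lambda>_. 0))"
      using y(2) by auto
    then show "ecomp dE \<alpha> (\<delta> (Suc (Suc 0)) y) l = ecomp dE \<alpha> x l"
      unfolding ecomp_differential[OF y(1) l] using w(3)[OF l] \<Gamma>(2)[of \<alpha> l]
      by (auto simp: cramer_map_def)
  qed
  with y(1) show ?thesis
    by auto
qed

lemma differential_in_kernel:
  assumes "x \<in> S (Suc (Suc 0))" "j < rk"
  shows "(\<Sum>l<e. ecomp dE \<alpha> (\<delta> (Suc (Suc 0)) x) l * \<upsilon> j (col C l)) = 0"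
  using assms columns_cramer_map[of j "dcomp dE \<alpha> x"] ecomp_differential[of x _ \<alpha>] by simp

lemma differential_hcomp:
  assumes x: "x \<in> S (Suc (Suc n))" "x \<in> hcomp (br_deg dE dG) a"
  shows "\<delta> (Suc (Suc n)) x \<in> hcomp (br_deg dE dG) a"
proof -
  have zero: "dcomp dE \<alpha> x = (\<lambda>_. 0)" if "\<alpha> \<noteq> a" for \<alpha>
  proof
    fix I
    show "dcomp dE \<alpha> x I = 0"
    proof (rule poly_mapping_eqI, rule ccontr)
      fix b assume "lookup (dcomp dE \<alpha> x I) b \<noteq> lookup 0 b"
      then have le: "mdeg I \<preceq> \<alpha>" and nz: "lookup (lookup x (Ups b I)) (\<alpha> - mdeg I) \<noteq> 0"
        by (auto simp: lookup_dcomp split: if_splits)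
      then have "Ups b I \<in> keys x" "\<alpha> - mdeg I \<in> keys (lookup x (Ups b I))"
        by (auto simp: in_keys_iff)
      then have "\<alpha> - mdeg I + br_deg dE dG (Ups b I) = a"
        using x(2) unfolding hcomp_def by blast
      with le that show False
        by (simp add: mdeg_diff_add)
    qed
  qed
  have dx: "\<delta> (Suc (Suc n)) x \<in> S (Suc n)"
    by (rule differential_maps[OF x(1)])
  show ?thesis
    unfolding hcomp_def
  proof (intro CollectI ballI)
    fix u k assume u: "u \<in> keys (\<delta> (Suc (Suc n)) x)" and k: "k \<in> keys (lookup (\<delta> (Suc (Suc n)) x) u)"
    show "k + br_deg dE dG u = a"
    proof (cases n)
      case 0
      then obtain l where l: "u = Eps l" "l < e"
        using dx u by (auto simp: scarf_mod_1 E_mod_def pm_free_iff)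
      have "ecomp dE (k + dE l) (\<delta> (Suc (Suc 0)) x) l \<noteq> 0"
        using k 0 l by (simp add: ecomp_def in_keys_iff)
      then have "cramer_map (dcomp dE (k + dE l) x) l \<noteq> 0"
        using ecomp_differential[of x l] x(1) 0 l by simp
      then have "dcomp dE (k + dE l) x \<noteq> (\<lambda>_. 0)"
        by (auto simp: cramer_map_def)
      then show ?thesis
        using zero[of "k + dE l"] l by auto
    next
      case (Suc n')
      then have "\<delta> (Suc (Suc n)) x \<in> S (Suc (Suc n'))"
        using dx by simp
      then obtain b J where J: "u = Ups b J"
        using scarf_mod_keys u by blast
      have nz: "lookup (dcomp dE (k + mdeg J) (\<delta> (Suc (Suc n)) x) J) b \<noteq> 0"
        using k J by (simp add: lookup_dcomp in_keys_iff)
      have "dcomp dE (k + mdeg J) (\<delta> (Suc (Suc n)) x) J = koszul (below (k + mdeg J)) (dcomp dE (k + mdeg J) x) J"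
        using x(1) unfolding Suc by (rule dcomp_differential)
      then have "dcomp dE (k + mdeg J) x \<noteq> (\<lambda>_. 0)"
        using nz by (auto simp: koszul_zero)
      then show ?thesis
        using zero[of "k + mdeg J"] J by auto
    qed
  qed
qed

text \<open>
  Bases of the spaces \<open>F\<^sub>I\<close> over the field give a basis of the module over the polynomial ring;
  independence is checked in each multidegree and at each face.
\<close>

lemma scarf_mod_free: "finite_free_multigraded (br_deg dE dG) (S (Suc (Suc n)))"
proof -
  let ?I = "{I. I \<subseteq> {..<e} \<and> card I = Suc (n + rk)}"
  have "\<exists>B. finite B \<and> pm.independent B \<and> pm.span B = scarf_space I" for I
  proof -
    have "pm.subspace (scarf_space I)"
      by (auto simp: pm.subspace_def intro: scarf_space_add scarf_space_scale)
    moreover have "scarf_space I \<subseteq> dp_hom rk (card I - rk - 1)"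
      using scarf_space_hom by blast
    ultimately show ?thesis
      by (rule finite_basis_of_homogeneous) blast
  qed
  then obtain B where B: "\<And>I. finite (B I)" "\<And>I. pm.independent (B I)" "\<And>I. pm.span (B I) = scarf_space I"
    by metis
  define U where "U = (\<Union>I\<in>?I. ups_elem I ` B I :: (br_sym \<Rightarrow>\<^sub>0 ('n, 'k) mpolys) set)"
  have finI: "finite ?I"
    by (rule finite_subset[of _ "Pow {..<e}"]) auto
  have comp: "dcomp dE (mdeg I) (ups_elem I y :: br_sym \<Rightarrow>\<^sub>0 ('n, 'k) mpolys) J = (if J = I then y else 0)" for I J y
    using dcomp_ups_elem[of dE "mdeg I" 1 I y J] by simp
  have nonzero: "0 \<notin> B I" for I
  proof
    assume "0 \<in> B I"
    then have "(1 :: 'k) = 0"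
      using pm.independentD[OF B(2)[of I], of "{0}" "\<lambda>_. 1" 0] by simp
    then show False by simp
  qed
  have inj: "I = J \<and> y = z"
    if "ups_elem I y = (ups_elem J z :: br_sym \<Rightarrow>\<^sub>0 ('n, 'k) mpolys)" "y \<in> B I" "z \<in> B J" for I J y z
  proof -
    have y: "y = dcomp dE (mdeg I) (ups_elem I y :: br_sym \<Rightarrow>\<^sub>0 ('n, 'k) mpolys) I"
      by (simp only: comp if_True simp_thms)
    have "dcomp dE (mdeg I) (pm_scale 1 (ups_elem J z) :: br_sym \<Rightarrow>\<^sub>0 ('n, 'k) mpolys) I = 0" if "I \<noteq> J"
      unfolding dcomp_ups_elem using that by simp
    then have "I = J"
      using y that nonzero unfolding that(1) by (metis pm.scale_one)
    moreover have "z = dcomp dE (mdeg J) (ups_elem J z :: br_sym \<Rightarrow>\<^sub>0 ('n, 'k) mpolys) J"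
      by (simp only: comp if_True simp_thms)
    ultimately show ?thesis
      using y unfolding that(1) by metis
  qed
  show ?thesis
    unfolding finite_free_multigraded_def
  proof (rule exI[of _ U], intro conjI ballI)
    show "finite U"
      unfolding U_def using finI B(1) by blast
    show "\<exists>a. x \<in> hcomp (br_deg dE dG) a" if x: "x \<in> U" for x
    proof -
      obtain I y where "x = ups_elem I y"
        using x by (auto simp: U_def)
      then have "x \<in> hcomp (br_deg dE dG) (mdeg I)"
        using keys_ups_elem[of I y] unfolding hcomp_def
        by (auto simp: lookup_ups_elem split: if_splits)
      then show ?thesis ..
    qed
    show "pm.span U = S (Suc (Suc n))"
    proof
      have "B I \<subseteq> scarf_space I" for I
        using B(3) pm.span_superset by blast
      then show "pm.span U \<subseteq> S (Suc (Suc n))"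
        unfolding scarf_mod_span U_def by (intro pm.span_mono) blast
      have "ups_elem I y \<in> pm.span U" if I: "I \<in> ?I" and y: "y \<in> scarf_space I" for I y
      proof -
        have "y \<in> pm.span (B I)"
          using y B(3) by simp
        then show ?thesis
        proof (induction rule: pm.span_induct_alt)
          case base
          then show ?case
            by (simp add: pm.span_zero)
        next
          case (step c b z)
          have "ups_elem I (pm_scale c b + z) =
              pm_scale (Poly_Mapping.single 0 c) (ups_elem I b) + (ups_elem I z :: br_sym \<Rightarrow>\<^sub>0 ('n, 'k) mpolys)"
            (is "?l = ?r")
          proof (rule poly_mapping_eqI)
            fix u show "lookup ?l u = lookup ?r u"
              by (cases u) (auto simp: lookup_ups_elem lookup_add lookup_pm_scale mult_single single_add)
          qed
          moreover have "ups_elem I b \<in> U"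
            using step(1) I by (auto simp: U_def)
          ultimately show ?case
            using step(2) by (simp add: pm.span_add pm.span_scale pm.span_base)
        qed
      qed
      then show "S (Suc (Suc n)) \<subseteq> pm.span U"
        unfolding scarf_mod_span by (intro pm.span_minimal) auto
    qed
    show "pm.independent U"
      unfolding pm.independent_explicit_module
    proof (intro allI impI)
      fix t u v
      assume t: "finite t" "t \<subseteq> U" and sum: "(\<Sum>v\<in>t. pm_scale (u v) v) = 0" and v: "v \<in> t"
      obtain I y where I: "I \<in> ?I" "y \<in> B I" "v = ups_elem I y"
        using t v by (auto simp: U_def)
      let ?T = "{z \<in> B I. ups_elem I z \<in> t}"
      show "u v = 0"
      proof (rule poly_mapping_eqI)
        fix k
        have "0 = dcomp dE (k + mdeg I) (\<Sum>v\<in>t. pm_scale (u v) v) I"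
          using sum by simp
        also have "\<dots> = (\<Sum>v\<in>t. dcomp dE (k + mdeg I) (pm_scale (u v) v) I)"
          by (rule dcomp_sum)
        also have "\<dots> = (\<Sum>v\<in>ups_elem I ` ?T. dcomp dE (k + mdeg I) (pm_scale (u v) v) I)"
        proof (rule sum.mono_neutral_right[OF t(1)])
          show "\<forall>x\<in>t - ups_elem I ` ?T. dcomp dE (k + mdeg I) (pm_scale (u x) x) I = 0"
          proof
            fix x assume x: "x \<in> t - ups_elem I ` ?T"
            then obtain J z where "J \<in> ?I" "z \<in> B J" "x = ups_elem J z"
              using t(2) by (auto simp: U_def)
            with x have "J \<noteq> I"
              by auto
            then show "dcomp dE (k + mdeg I) (pm_scale (u x) x) I = 0"
              using \<open>x = ups_elem J z\<close> by (simp add: dcomp_ups_elem)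
          qed
        qed auto
        also have "\<dots> = (\<Sum>z\<in>?T. dcomp dE (k + mdeg I) (pm_scale (u (ups_elem I z)) (ups_elem I z)) I)"
          using inj by (intro sum.reindex_cong[OF _ refl refl]) (auto simp: inj_on_def)
        also have "\<dots> = (\<Sum>z\<in>?T. pm_scale (lookup (u (ups_elem I z)) k) z)"
          by (simp add: dcomp_ups_elem)
        finally have "(\<Sum>z\<in>?T. pm_scale (lookup (u (ups_elem I z)) k) z) = 0"
          by simp
        then have "lookup (u (ups_elem I y)) k = 0"
          using B(1)[of I] I v by (intro pm.independentD[OF B(2)[of I], of ?T]) auto
        then show "lookup (u v) k = lookup 0 k"
          using I by simp
      qed
    qed
  qed
qed

end

section \<open>The presentation and its resolution\<close>

lemma hom_sum:
  assumes "multigraded_hom deg N P f" "pm.subspace N" "\<And>i. i \<in> I \<Longrightarrow> x i \<in> N"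
  shows "f (\<Sum>i\<in>I. x i) = (\<Sum>i\<in>I. f (x i))"
proof -
  have add: "\<And>a b. a \<in> N \<Longrightarrow> b \<in> N \<Longrightarrow> f (a + b) = f a + f b"
    and scale: "\<And>q a. a \<in> N \<Longrightarrow> f (pm_scale q a) = pm_scale q (f a)"
    using assms(1) by (auto simp: multigraded_hom_def)
  have "f 0 = 0"
    using scale[of 0 0] pm.subspace_0[OF assms(2)] by simp
  then show ?thesis
    using assms(3)
  proof (induction I rule: infinite_finite_induct)
    case (insert i I)
    then show ?case
      using add pm.subspace_sum[OF assms(2), of I x] by simp
  qed auto
qed

text \<open>
  Since \<open>\<phi>\<close> preserves multidegrees, each of its matrix entries is a single term with coefficient \<open>C\<^sub>i\<^sub>l\<close>.
  The multidegree of \<open>x\<close> that contributes to the monomial \<open>k\<close> at \<open>\<gamma>\<^sub>i\<close> is \<open>k + |\<gamma>\<^sub>i|\<close>.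
\<close>

lemma presentation_coefficient:
  fixes \<phi> :: "(br_sym \<Rightarrow>\<^sub>0 ('n::finite, 'k::field) mpolys) \<Rightarrow> (br_sym \<Rightarrow>\<^sub>0 ('n, 'k) mpolys)"
  assumes hom: "multigraded_hom (br_deg dE dG) (E_mod e) (G_mod g) \<phi>"
    and C: "C = coeff_mat e g dE dG \<phi>" and x: "x \<in> E_mod e" and i: "i < g"
  shows "lookup (lookup (\<phi> x) (Gam i)) k = (\<Sum>l<e. ecomp dE (k + dG i) x l * C $$ (i, l))"
    and "\<And>l. l < e \<Longrightarrow> C $$ (i, l) \<noteq> 0 \<Longrightarrow> dG i \<preceq> dE l"
proof -
  let ?f = "\<lambda>l. lookup (\<phi> (Poly_Mapping.single (Eps l) 1)) (Gam i)"
  have sub: "pm.subspace (E_mod e :: (br_sym \<Rightarrow>\<^sub>0 ('n, 'k) mpolys) set)"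
    by (simp add: E_mod_def pm_free_def)
  have basis: "Poly_Mapping.single (Eps l) 1 \<in> (E_mod e :: (br_sym \<Rightarrow>\<^sub>0 ('n, 'k) mpolys) set)" if "l < e" for l
    using that by (simp add: E_mod_def pm_free_iff)
  have entry: "?f l = Poly_Mapping.single (dE l - dG i) (C $$ (i, l)) \<and> (C $$ (i, l) \<noteq> 0 \<longrightarrow> dG i \<preceq> dE l)"
    if l: "l < e" for l
  proof -
    have Cil: "C $$ (i, l) = lookup (?f l) (dE l - dG i)"
      using i l by (simp add: C coeff_mat_def)
    have "Poly_Mapping.single (Eps l) 1 \<in> hcomp (br_deg dE dG) (dE l)"
      by (auto simp: hcomp_def)
    then have h: "\<phi> (Poly_Mapping.single (Eps l) 1) \<in> hcomp (br_deg dE dG) (dE l)"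
      using hom basis[OF l] unfolding multigraded_hom_def by blast
    have deg: "a + dG i = dE l" if "lookup (?f l) a \<noteq> 0" for a
    proof -
      have "Gam i \<in> keys (\<phi> (Poly_Mapping.single (Eps l) 1))" "a \<in> keys (?f l)"
        using that by (auto simp: in_keys_iff)
      then show ?thesis
        using h unfolding hcomp_def by fastforce
    qed
    have "?f l = Poly_Mapping.single (dE l - dG i) (C $$ (i, l))"
    proof (rule poly_mapping_eqI)
      fix a
      show "lookup (?f l) a = lookup (Poly_Mapping.single (dE l - dG i) (C $$ (i, l))) a"
      proof (cases "lookup (?f l) a = 0")
        case True
        then show ?thesis
          using Cil by (auto simp: lookup_single when_def)
      next
        case False
        then have "dE l - dG i = a"
          using deg by (metis add_diff_cancel_right')
        then show ?thesis
          using Cil by simp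
      qed
    qed
    moreover have "dG i \<preceq> dE l" if "C $$ (i, l) \<noteq> 0"
      using deg[of "dE l - dG i"] that Cil mdeg_add_le by metis
    ultimately show ?thesis by blast
  qed
  show "dG i \<preceq> dE l" if "l < e" "C $$ (i, l) \<noteq> 0" for l
    using entry that by blast
  have "x = (\<Sum>l<e. pm_scale (lookup x (Eps l)) (Poly_Mapping.single (Eps l) 1))"
  proof -
    have "keys x \<subseteq> Eps ` {..<e}"
      using x by (simp add: E_mod_def pm_free_iff)
    then have "(\<Sum>u\<in>Eps ` {..<e}. pm_scale (lookup x u) (Poly_Mapping.single u 1)) =
        (\<Sum>u\<in>keys x. pm_scale (lookup x u) (Poly_Mapping.single u 1))"
      by (intro sum.mono_neutral_right) (auto simp: in_keys_iff)
    then show ?thesis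
      unfolding sum_scaled_singles by (simp add: sum.reindex inj_on_def)
  qed
  then have "\<phi> x = \<phi> (\<Sum>l<e. pm_scale (lookup x (Eps l)) (Poly_Mapping.single (Eps l) 1))"
    by simp
  also have "\<dots> = (\<Sum>l<e. \<phi> (pm_scale (lookup x (Eps l)) (Poly_Mapping.single (Eps l) 1)))"
    using basis by (intro hom_sum[OF hom sub] pm.subspace_scale[OF sub]) auto
  also have "\<dots> = (\<Sum>l<e. pm_scale (lookup x (Eps l)) (\<phi> (Poly_Mapping.single (Eps l) 1)))"
    using hom basis unfolding multigraded_hom_def by (intro sum.cong) (simp_all del: pm_scale_single)
  finally have "lookup (lookup (\<phi> x) (Gam i)) k = (\<Sum>l<e. lookup (lookup x (Eps l) * ?f l) k)"
    by (simp add: lookup_sum lookup_pm_scale)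
  also have "\<dots> = (\<Sum>l<e. ecomp dE (k + dG i) x l * C $$ (i, l))"
  proof (intro sum.cong refl)
    fix l assume "l \<in> {..<e}"
    then have f: "?f l = Poly_Mapping.single (dE l - dG i) (C $$ (i, l))"
      and le: "C $$ (i, l) \<noteq> 0 \<Longrightarrow> dG i \<preceq> dE l"
      using entry by auto
    show "lookup (lookup x (Eps l) * ?f l) k = ecomp dE (k + dG i) x l * C $$ (i, l)"
    proof (cases "C $$ (i, l) = 0")
      case True
      then show ?thesis
        by (simp add: f lookup_mult_single)
    next
      case False
      then show ?thesis
        using mdeg_diff_le[OF le mdeg_add_le[of "dG i" k]] by (auto simp: f lookup_mult_single ecomp_def)
    qed
  qed
  finally show "lookup (lookup (\<phi> x) (Gam i)) k = (\<Sum>l<e. ecomp dE (k + dG i) x l * C $$ (i, l))" .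
qed

text \<open>
  If \<open>|\<gamma>\<^sub>i| \<preceq> \<alpha>\<close> fails, the row \<open>i\<close> of \<open>C\<close> vanishes on all \<open>\<epsilon>\<^sub>l\<close> below \<open>\<alpha>\<close>, so that the row imposes no
  condition, as it should.
\<close>

lemma presentation_kernel:
  fixes \<phi> :: "(br_sym \<Rightarrow>\<^sub>0 ('n::finite, 'k::field) mpolys) \<Rightarrow> (br_sym \<Rightarrow>\<^sub>0 ('n, 'k) mpolys)"
  assumes hom: "multigraded_hom (br_deg dE dG) (E_mod e) (G_mod g) \<phi>"
    and C: "C = coeff_mat e g dE dG \<phi>" and x: "x \<in> E_mod e"
  shows "\<phi> x = 0 \<longleftrightarrow> (\<forall>\<alpha>. C *\<^sub>v vec e (ecomp dE \<alpha> x) = 0\<^sub>v g)"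
proof -
  note coeff = presentation_coefficient[OF hom C x]
  have dim: "dim_row C = g" "dim_col C = e"
    by (simp_all add: C coeff_mat_def)
  have entry: "(C *\<^sub>v vec e (ecomp dE \<alpha> x)) $ i = (\<Sum>l<e. ecomp dE \<alpha> x l * C $$ (i, l))" if "i < g" for i \<alpha>
    using that dim by (simp add: scalar_prod_def atLeast0LessThan mult.commute)
  have keys: "keys (\<phi> x) \<subseteq> Gam ` {..<g}"
  proof -
    have "\<phi> x \<in> G_mod g"
      using hom x by (simp add: multigraded_hom_def)
    then show ?thesis
      by (simp add: G_mod_def pm_free_iff)
  qed
  show ?thesis
  proof
    assume zero: "\<phi> x = 0"
    show "\<forall>\<alpha>. C *\<^sub>v vec e (ecomp dE \<alpha> x) = 0\<^sub>v g"
    proof (intro allI eq_vecI)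
      fix \<alpha> i assume "i < dim_vec (0\<^sub>v g)"
      then have i: "i < g" by simp
      have "(\<Sum>l<e. ecomp dE \<alpha> x l * C $$ (i, l)) = 0"
      proof (cases "dG i \<preceq> \<alpha>")
        case True
        then show ?thesis
          using coeff(1)[OF i, of "\<alpha> - dG i"] zero by (simp add: mdeg_diff_add)
      next
        case False
        have "ecomp dE \<alpha> x l = 0" if "l < e" "C $$ (i, l) \<noteq> 0" for l
          using coeff(2)[OF i that] False mdeg_le_trans by (auto simp: ecomp_def)
        then show ?thesis
          by (intro sum.neutral) auto
      qed
      then show "(C *\<^sub>v vec e (ecomp dE \<alpha> x)) $ i = 0\<^sub>v g $ i"
        using entry i by simp
    qed (simp add: dim)
  next
    assume ker: "\<forall>\<alpha>. C *\<^sub>v vec e (ecomp dE \<alpha> x) = 0\<^sub>v g"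
    show "\<phi> x = 0"
    proof (rule poly_mapping_eqI)
      fix u
      show "lookup (\<phi> x) u = lookup 0 u"
      proof (cases "u \<in> Gam ` {..<g}")
        case False
        then have "u \<notin> keys (\<phi> x)"
          using keys by blast
        then show ?thesis
          by (simp add: in_keys_iff)
      next
        case True
        then obtain i where i: "i < g" "u = Gam i"
          by auto
        have "lookup (lookup (\<phi> x) (Gam i)) k = 0" for k
          using coeff(1)[OF i(1), of k] entry[OF i(1), of "k + dG i"] ker i(1) by simp
        then show ?thesis
          unfolding i(2) by (intro poly_mapping_eqI) simp
      qed
    qed
  qed
qed

text \<open>
  Suppose that \<open>\<epsilon>\<^sub>i\<close> has the multidegree \<open>\<alpha>\<close> and that more than \<open>r\<close> basis elements lie below \<open>\<alpha>\<close>.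
  Homogenizing Cramer's relation between \<open>i\<close> and \<open>r\<close> of the others gives an element of the kernel of \<open>\<phi>\<close>
  whose coefficient at \<open>\<epsilon>\<^sub>i\<close> is a nonzero scalar, because it is a maximal minor.
\<close>

lemma generic_system_of_presentation:
  fixes \<phi> :: "(br_sym \<Rightarrow>\<^sub>0 ('n::finite, 'k::field) mpolys) \<Rightarrow> (br_sym \<Rightarrow>\<^sub>0 ('n, 'k) mpolys)"
  assumes hom: "multigraded_hom (br_deg dE dG) (E_mod e) (G_mod g) \<phi>"
    and minimal: "{x \<in> E_mod e. \<phi> x = 0} \<subseteq> max_ideal_times (E_mod e)"
    and C: "C = coeff_mat e g dE dG \<phi>"
    and gen: "generic dE C" and basis: "dual_basis C \<upsilon>"
  shows "generic_system (dim_col C) (mat_rank C) (\<lambda>l j. \<upsilon> j (col C l)) dE"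
proof -
  have unif: "uniform_rank C" and comb: "combinatorially_generic (dim_col C) dE"
    using gen by (auto simp: generic_def)
  interpret uniform_columns "dim_col C" "mat_rank C" "\<lambda>l j. \<upsilon> j (col C l)"
    by (rule uniform_columns_dual_basis[OF unif basis])
  have dim: "dim_row C = g" "dim_col C = e"
    by (simp_all add: C coeff_mat_def)
  show ?thesis
  proof
    show "combinatorially_generic (dim_col C) dE"
      by (rule comb)
    fix I i
    assume I: "I \<in> faces (dim_col C)" "mat_rank C < card (face_below (dim_col C) dE (lcm_deg dE I))"
      and i: "i < dim_col C"
    let ?A = "face_below (dim_col C) dE (lcm_deg dE I)" and ?\<alpha> = "lcm_deg dE I"
    show "dE i \<noteq> ?\<alpha>"
    proof
      assume max: "dE i = ?\<alpha>"
      then have "i \<in> ?A"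
        using i by (simp add: face_below_def)
      have "finite ?A"
        by (simp add: face_below_def)
      then have "mat_rank C \<le> card (?A - {i})"
        using I(2) \<open>i \<in> ?A\<close> by simp
      then obtain P where P: "P \<subseteq> ?A - {i}" "card P = mat_rank C"
        by (metis obtain_subset_with_card_n)
      have Pe: "P \<subseteq> {..<dim_col C}" and iP: "i \<notin> P"
        using P by (auto simp: face_below_def)
      \<comment> \<open>The coefficients of Cramer's relation between the columns in \<open>P \<union> {i}\<close> are \<open>cramer_map z\<close>.\<close>
      define z :: "nat set \<Rightarrow> ((nat \<Rightarrow>\<^sub>0 nat) \<Rightarrow>\<^sub>0 'k)" where "z K = (if K = insert i P then Poly_Mapping.single 0 1 else 0)"
        for K
      define u where "u = cramer_map z"
      have ui: "u i \<noteq> 0"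
      proof -
        have "u i = face_sgn i P * minor (mat_rank C) (\<lambda>l j. \<upsilon> j (col C l)) P * lookup (z (insert i P)) 0"
          unfolding u_def by (rule cramer_map_star[OF Pe P(2) i iP]) (auto simp: z_def split: if_splits)
        then show ?thesis
          using minors[OF Pe P(2)] face_sgn_nonzero[of i P, where 'k = 'k] by (simp add: z_def)
      qed
      have u_support: "l \<in> ?A" if "u l \<noteq> 0" for l
      proof -
        have "\<exists>J. z (insert l J) \<noteq> 0"
        proof (rule ccontr)
          assume "\<not> ?thesis"
          then have "u l = 0"
            by (simp add: u_def cramer_map_def)
          with that show False by simp
        qed
        then obtain J where "z (insert l J) \<noteq> 0"
          by blast
        then have "insert l J = insert i P"
          by (auto simp: z_def split: if_splits)
        then show ?thesis
          using P(1) \<open>i \<in> ?A\<close> by (metis DiffD1 insertE insertI1 subsetD)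
      qed
      define x :: "br_sym \<Rightarrow>\<^sub>0 ('n, 'k) mpolys" where
        "x = (\<Sum>l<e. Poly_Mapping.single (Eps l) (Poly_Mapping.single (?\<alpha> - dE l) (u l)))"
      have lx: "lookup x (Eps l) = (if l < e then Poly_Mapping.single (?\<alpha> - dE l) (u l) else 0)" for l
      proof -
        have "lookup x (Eps l) = (\<Sum>k<e. if k = l then Poly_Mapping.single (?\<alpha> - dE l) (u l) else 0)"
          unfolding x_def lookup_sum by (intro sum.cong) (auto simp: lookup_single when_def)
        then show ?thesis by simp
      qed
      have xE: "x \<in> E_mod e"
        unfolding E_mod_def pm_free_iff
      proof
        fix v assume "v \<in> keys x"
        then have "\<exists>l<e. v \<in> keys (Poly_Mapping.single (Eps l) (Poly_Mapping.single (?\<alpha> - dE l) (u l)))"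
          using keys_sum[of "\<lambda>l. Poly_Mapping.single (Eps l) (Poly_Mapping.single (?\<alpha> - dE l) (u l))" "{..<e}"]
          unfolding x_def by blast
        then show "v \<in> Eps ` {..<e}"
          by (auto split: if_splits)
      qed
      have comp: "ecomp dE \<beta> x l = (if \<beta> = ?\<alpha> then u l else 0)" if "l < e" for \<beta> l
      proof (cases "u l = 0")
        case True
        then show ?thesis
          using that by (simp add: ecomp_def lx)
      next
        case False
        then have le: "dE l \<preceq> ?\<alpha>"
          using u_support by (auto simp: face_below_def)
        then have "\<beta> = ?\<alpha>" if "dE l \<preceq> \<beta>" "?\<alpha> - dE l = \<beta> - dE l"
          using that mdeg_diff_add by metis
        then show ?thesis
          using that le by (auto simp: ecomp_def lx lookup_single when_def)
      qed
      have "\<phi> x = 0"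
        unfolding presentation_kernel[OF hom C xE]
      proof
        fix \<beta>
        have "C *\<^sub>v vec e (ecomp dE \<beta> x) = 0\<^sub>v (dim_row C)"
        proof (rule iffD2[OF kernel_iff_dual[OF unif basis]], goal_cases)
          case 1
          show ?case
            by (simp add: dim)
        next
          case 2
          show ?case
          proof (intro allI impI)
            fix j assume j: "j < mat_rank C"
            have "(\<Sum>l<e. vec e (ecomp dE \<beta> x) $ l * \<upsilon> j (col C l)) =
                (if \<beta> = ?\<alpha> then \<Sum>l<e. u l * \<upsilon> j (col C l) else 0)"
              by (auto simp: comp intro!: sum.cong sum.neutral)
            also have "\<dots> = 0"
              using columns_cramer_map[OF j, of z] dim by (simp add: u_def)
            finally show "(\<Sum>l<dim_col C. vec e (ecomp dE \<beta> x) $ l * \<upsilon> j (col C l)) = 0"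
              using dim by simp
          qed
        qed
        then show "C *\<^sub>v vec e (ecomp dE \<beta> x) = 0\<^sub>v g"
          using dim by simp
      qed
      then have "x \<in> max_ideal_times (E_mod e)"
        using minimal xE by blast
      then have "lookup (lookup x (Eps i)) 0 = 0"
        by (rule max_ideal_times_lookup_0)
      moreover have "lookup (lookup x (Eps i)) 0 = u i"
        using i dim max by (simp add: lx)
      ultimately show False
        using ui by simp
    qed
  qed
qed

theorem theorem5p6:
  fixes e g :: nat
    and dE dG :: "nat \<Rightarrow> 'n::finite mdegree"
    and \<phi> :: "(br_sym \<Rightarrow>\<^sub>0 ('n, 'k::field) mpolys) \<Rightarrow> (br_sym \<Rightarrow>\<^sub>0 ('n, 'k) mpolys)"
    and scl :: "('n, 'k) mpolys \<Rightarrow> 'm::ab_group_add \<Rightarrow> 'm"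
    and gr :: "'n mdegree \<Rightarrow> 'm set"
    and C :: "'k mat"
    and \<upsilon> :: "nat \<Rightarrow> 'k vec \<Rightarrow> 'k"
  assumes "multigraded_module scl gr"
    and "noetherian_module scl"
    and "minimal_presentation (br_deg dE dG) (E_mod e) (G_mod g) \<phi> scl gr"
    and "C = coeff_mat e g dE dG \<phi>"
    and "generic dE C"
    and "dual_basis C \<upsilon>"
  shows "minimal_free_resolution (br_deg dE dG)
           (scarf_mod dE C \<upsilon>) (brt_diff dE dG \<phi> C \<upsilon>) scl gr"
proof -
  have hom: "multigraded_hom (br_deg dE dG) (E_mod e) (G_mod g) \<phi>"
    and quot: "quotient_iso (br_deg dE dG) (G_mod g) (\<phi> ` E_mod e) scl gr"
    and img: "\<phi> ` E_mod e \<subseteq> max_ideal_times (G_mod g)"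
    and ker: "{x \<in> E_mod e. \<phi> x = 0} \<subseteq> max_ideal_times (E_mod e)"
    using assms(3) by (simp_all add: minimal_presentation_def)
  have dim: "dim_row C = g" "dim_col C = e"
    by (simp_all add: assms(4) coeff_mat_def)
  have unif: "uniform_rank C"
    using assms(5) by (simp add: generic_def)
  interpret scarf_complex C \<upsilon> dE dG
    using generic_system_of_presentation[OF hom ker assms(4,5,6)] assms(6)
    by (simp add: scarf_complex_def scarf_complex_axioms_def)
  let ?d = "brt_diff dE dG \<phi> C \<upsilon>"
  have S0: "scarf_mod dE C \<upsilon> 0 = (G_mod g :: (br_sym \<Rightarrow>\<^sub>0 ('n, 'k) mpolys) set)"
    and S1: "scarf_mod dE C \<upsilon> (Suc 0) = (E_mod e :: (br_sym \<Rightarrow>\<^sub>0 ('n, 'k) mpolys) set)"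
    using scarf_mod_0 scarf_mod_1 dim by simp_all
  have d1: "?d (Suc 0) = \<phi>"
    by (simp add: brt_diff_def)
  have d2: "?d (Suc (Suc n)) = homogenization (br_deg dE dG) (br_map C \<upsilon> (Suc (Suc n)))" for n
    by (simp add: brt_diff_def)
  have degrees: "P i" if "1 \<le> i" "P (Suc 0)" "\<And>n. P (Suc (Suc n))" for P and i :: nat
    using that by (metis One_nat_def Suc_le_D old.nat.exhaust)
  have kernel: "\<phi> x = 0 \<longleftrightarrow>
      (\<forall>\<alpha>. \<forall>j<mat_rank C. (\<Sum>l<dim_col C. ecomp dE \<alpha> x l * \<upsilon> j (col C l)) = 0)"
    if x: "x \<in> E_mod e" for x
  proof -
    have "C *\<^sub>v vec e (ecomp dE \<alpha> x) = 0\<^sub>v g \<longleftrightarrow>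
        (\<forall>j<mat_rank C. (\<Sum>l<dim_col C. ecomp dE \<alpha> x l * \<upsilon> j (col C l)) = 0)" for \<alpha>
      using kernel_iff_dual[OF unif assms(6), of "vec e (ecomp dE \<alpha> x)"] dim by simp
    then show ?thesis
      using presentation_kernel[OF hom assms(4) x] by simp
  qed
  have free: "finite_free_multigraded (br_deg dE dG) (S i)" for i
  proof (cases i)
    case 0
    then show ?thesis
      unfolding 0 S0 G_mod_def by (intro finite_free_pm_free) simp
  next
    case (Suc k)
    show ?thesis
    proof (cases k)
      case 0
      then show ?thesis
        unfolding Suc 0 S1 E_mod_def by (intro finite_free_pm_free) simp
    next
      case (Suc n)
      then show ?thesis
        using scarf_mod_free[of n] \<open>i = Suc k\<close> by simp
    qed
  qed
  have maps: "multigraded_hom (br_deg dE dG) (S i) (S (i - 1)) (?d i)" if "1 \<le> i" for i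
    using that
  proof (rule degrees)
    show "multigraded_hom (br_deg dE dG) (S (Suc 0)) (S (Suc 0 - 1)) (?d (Suc 0))"
      using hom by (simp add: S0 S1 d1)
    show "multigraded_hom (br_deg dE dG) (S (Suc (Suc n))) (S (Suc (Suc n) - 1)) (?d (Suc (Suc n)))" for n
      unfolding multigraded_hom_def d2
      using differential_maps differential_hcomp
      by (auto simp: homogenization_add homogenization_scale)
  qed
  have zero: "?d (i - 1) (?d i x) = 0" if i: "2 \<le> i" and x: "x \<in> S i" for i x
  proof -
    have "1 \<le> i - 1" "i = Suc (i - 1)"
      using i by auto
    moreover have "\<forall>x\<in>S (Suc k). ?d k (?d (Suc k) x) = 0" if "1 \<le> k" for k
      using that
    proof (rule degrees)
      show "\<forall>x\<in>S (Suc (Suc 0)). ?d (Suc 0) (?d (Suc (Suc 0)) x) = 0"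
      proof
        fix x assume x: "x \<in> S (Suc (Suc 0))"
        then have "\<delta> (Suc (Suc 0)) x \<in> E_mod e"
          using differential_maps[of x 0] S1 by simp
        then have "\<phi> (\<delta> (Suc (Suc 0)) x) = 0"
          using kernel differential_in_kernel[OF x] by blast
        then show "?d (Suc 0) (?d (Suc (Suc 0)) x) = 0"
          by (simp only: d1 d2)
      qed
      show "\<forall>x\<in>S (Suc (Suc (Suc n))). ?d (Suc (Suc n)) (?d (Suc (Suc (Suc n))) x) = 0" for n
        unfolding d2 using differential_squared by blast
    qed
    ultimately show ?thesis
      using x by metis
  qed
  have exact: "{x \<in> S i. ?d i x = 0} = ?d (i + 1) ` S (i + 1)" if i: "1 \<le> i" for i
  proof
    show "?d (i + 1) ` S (i + 1) \<subseteq> {x \<in> S i. ?d i x = 0}"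
    proof
      fix y assume "y \<in> ?d (i + 1) ` S (i + 1)"
      then obtain x where x: "x \<in> S (i + 1)" "y = ?d (i + 1) x"
        by blast
      then have "y \<in> S i"
        using maps[of "i + 1"] by (simp add: multigraded_hom_def)
      then show "y \<in> {x \<in> S i. ?d i x = 0}"
        using x zero[of "i + 1" x] i by simp
    qed
    show "{x \<in> S i. ?d i x = 0} \<subseteq> ?d (i + 1) ` S (i + 1)"
      using i
    proof (rule degrees)
      show "{x \<in> S (Suc 0). ?d (Suc 0) x = 0} \<subseteq> ?d (Suc 0 + 1) ` S (Suc 0 + 1)"
      proof
        fix x assume x: "x \<in> {x \<in> S (Suc 0). ?d (Suc 0) x = 0}"
        then have "\<exists>y\<in>S (Suc (Suc 0)). \<delta> (Suc (Suc 0)) y = x"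
          using kernel[of x] by (intro differential_onto_kernel) (auto simp: S1 d1)
        then show "x \<in> ?d (Suc 0 + 1) ` S (Suc 0 + 1)"
          using d2[of 0] by auto
      qed
      show "{x \<in> S (Suc (Suc n)). ?d (Suc (Suc n)) x = 0} \<subseteq> ?d (Suc (Suc n) + 1) ` S (Suc (Suc n) + 1)" for n
        using differential_exact[of _ n] unfolding d2 by (force simp: d2)
    qed
  qed
  have minimal: "?d i ` S i \<subseteq> max_ideal_times (S (i - 1))" if "1 \<le> i" for i
    using that
  proof (rule degrees)
    show "?d (Suc 0) ` S (Suc 0) \<subseteq> max_ideal_times (S (Suc 0 - 1))"
      using img by (simp add: S0 S1 d1)
    show "?d (Suc (Suc n)) ` S (Suc (Suc n)) \<subseteq> max_ideal_times (S (Suc (Suc n) - 1))" for n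
      unfolding d2 using differential_minimal by auto
  qed
  show ?thesis
    unfolding minimal_free_resolution_def
    using free maps zero exact minimal quot by (simp add: S0 S1 d1)
qed

end
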